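(* Let $(X,S,\beta)$ be a virtual pair, let $H$ be a (not necessarily abelian) group and let $f,g\colon X\times X\to H$ be a noncommutative 2-cocycle pair for $(X,S,\beta)$. For an oriented virtual link diagram $L=K_1\cup\dots\cup K_r$, a coloring $\mathcal C$ of $L$ by $(X,S,\beta)$, and a choice of base points $b_i$ on the components $K_i$, let $\Psi_i(L,\mathcal C,f,g)\in H$ be the ordered product of Boltzmann weights along $K_i$ (defined in the context). Then the set of conjugacy classes $$\overrightarrow{\Psi}(L,f,g)=\{[\Psi_i(L,\mathcal C,f,g)] : 1\le i\le r,\ \mathcal C\in \mathrm{Col}_X(L)\}$$ does not depend on the choice of base points and is unchanged under the classical Reidemeister moves RI, RII, RIII, the virtual moves vRI, vRII, vRIII and the mixed RIII move; hence it is an invariant of oriented virtual (and classical) links and knots.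
   Context: A set-theoretic solution of the Yang–Baxter equation is a pair $(X,\sigma)$ with $\sigma\colon X\times X\to X\times X$ a bijection such that $(\mathrm{id}\times\sigma)(\sigma\times\mathrm{id})(\mathrm{id}\times\sigma)=(\sigma\times\mathrm{id})(\mathrm{id}\times\sigma)(\sigma\times\mathrm{id})$; write $\sigma(x,y)=(\sigma^1(x,y),\sigma^2(x,y))$. It is a biquandle if (i) for all $x,z$ there is a unique $y$ with $\sigma^1(x,y)=z$, (ii) for all $y,t$ there is a unique $x$ with $\sigma^2(x,y)=t$, and (iii) there is a bijection $s_\sigma\colon X\to X$ with $\{(x,y):\sigma(x,y)=(x,y)\}=\{(x,s_\sigma(x)):x\in X\}$. A virtual pair $(X,S,\beta)$ consists of two biquandle structures $(X,S)$, $(X,\beta)$ on the same set with $\beta^2=\mathrm{id}$ and $(\mathrm{id}\times\beta)(S\times\mathrm{id})(\mathrm{id}\times\beta)=(\beta\times\mathrm{id})(\mathrm{id}\times S)(\beta\times\mathrm{id})$. Write $s=s_S$ and $s_\beta$ for the maps in (iii). A noncommutative 2-cocycle pair is a pair of maps $f,g\colon X\times X\to H$ such that for all $x,y,z\in X$: (f1) $f(x,y)f(S^2(x,y),z)=f(x,S^1(y,z))f(S^2(x,S^1(y,z)),S^2(y,z))$; (f2) $f(S^1(x,y),S^1(S^2(x,y),z))=f(y,z)$; (f3) $f(x,s(x))=1$; (g1) $g(x,s_\beta(x))=1$; (g2) $g(x,y)g(\beta(x,y))=1$; (g3) $g(x,y)g(\beta^2(x,y),z)=g(x,\beta^1(y,z))g(\beta^2(x,\beta^1(y,z)),\beta^2(y,z))$;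 (g4) $g(y,z)g(\beta^2(x,\beta^1(y,z)),\beta^2(y,z))=g(x,y)g(\beta^1(x,y),\beta^1(\beta^2(x,y),z))$; (g5) $g(y,z)g(x,\beta^1(y,z))=g(\beta^2(x,y),z)g(\beta^1(x,y),\beta^1(\beta^2(x,y),z))$; (m1) $g(y,z)=g(S^1(x,y),\beta^1(S^2(x,y),z))$; (m2) $g(y,z)g(x,\beta^1(y,z))=g(S^2(x,y),z)g(S^1(x,y),\beta^1(S^2(x,y),z))$; (m3) $g(x,\beta^1(y,z))f(\beta^2(x,\beta^1(y,z)),\beta^2(y,z))=f(x,y)g(S^2(x,y),z)$. Virtual link diagrams (Kauffman) are planar diagrams with classical crossings and virtual crossings, considered up to the classical Reidemeister moves, the virtual Reidemeister moves and the mixed RIII move; all links are oriented. A coloring of $L$ by $X$ assigns an element of $X$ to each semi-arc such that, drawing each crossing with both strands oriented downward: at a positive classical crossing whose under-strand goes from top-left to bottom-right and over-strand from top-right to bottom-left, with incoming colors $x$ (top-left) and $y$ (top-right), the outgoing colors are $S^1(x,y)$ (bottom-left) and $S^2(x,y)$ (bottom-right); at a negative classical crossing (over-strand top-left to bottom-right, under-strand top-right to bottom-left), with outgoing colors $x$ (bottom-left) and $y$ (bottom-right), the incoming colors are $S^1(x,y)$ (top-left) and $S^2(x,y)$ (top-right); at a virtual crossing with incoming colors $x$ (top-left, strand going to bottom-right) and $y$ (top-right, strand going to bottom-left), the outgoing colors are $\beta^1(x,y)$ (bottom-left) and $\beta^2(x,y)$ (bottom-right). $\mathrm{Col}_X(L)$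 is the set of colorings. Boltzmann weights: $f(x,y)$ at a positive classical crossing with the notation above, $f(x,y)^{-1}$ at a negative classical crossing with the notation above, and $g(x,y)$ at a virtual crossing with the notation above. $\Psi_i(L,\mathcal C,f,g)$ is obtained by traversing $K_i$ from $b_i$ following its orientation and multiplying, in the order encountered, the weight of each classical crossing at which $K_i$ passes along the under-strand and of each virtual crossing through which $K_i$ passes. $[h]$ denotes the conjugacy class of $h\in H$. *)

theory Defs
  imports Main "HOL-Algebra.Group"
begin

text \<open>The set X is the whole type 'a; a map X x X -> X x X is a function on pairs.\<close>

definition S1 :: "('a \<times> 'a \<Rightarrow> 'a \<times> 'a) \<Rightarrow> 'a \<Rightarrow> 'a \<Rightarrow> 'a" where
  "S1 \<sigma> x y = fst (\<sigma> (x, y))"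

definition S2 :: "('a \<times> 'a \<Rightarrow> 'a \<times> 'a) \<Rightarrow> 'a \<Rightarrow> 'a \<Rightarrow> 'a" where
  "S2 \<sigma> x y = snd (\<sigma> (x, y))"

definition on_left :: "('a \<times> 'a \<Rightarrow> 'a \<times> 'a) \<Rightarrow> 'a \<times> 'a \<times> 'a \<Rightarrow> 'a \<times> 'a \<times> 'a" where
  "on_left \<sigma> t = (case t of (x, y, z) \<Rightarrow> (fst (\<sigma> (x, y)), snd (\<sigma> (x, y)), z))"

definition on_right :: "('a \<times> 'a \<Rightarrow> 'a \<times> 'a) \<Rightarrow> 'a \<times> 'a \<times> 'a \<Rightarrow> 'a \<times> 'a \<times> 'a" where
  "on_right \<sigma> t = (case t of (x, y, z) \<Rightarrow> (x, fst (\<sigma> (y, z)), snd (\<sigma> (y, z))))"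

definition YB_solution :: "('a \<times> 'a \<Rightarrow> 'a \<times> 'a) \<Rightarrow> bool" where
  "YB_solution \<sigma> \<longleftrightarrow> bij \<sigma> \<and>
     on_right \<sigma> \<circ> on_left \<sigma> \<circ> on_right \<sigma> = on_left \<sigma> \<circ> on_right \<sigma> \<circ> on_left \<sigma>"

definition is_fix_map :: "('a \<times> 'a \<Rightarrow> 'a \<times> 'a) \<Rightarrow> ('a \<Rightarrow> 'a) \<Rightarrow> bool" where
  "is_fix_map \<sigma> s \<longleftrightarrow> bij s \<and> {p. \<sigma> p = p} = {(x, s x) | x. True}"

definition biquandle :: "('a \<times> 'a \<Rightarrow> 'a \<times> 'a) \<Rightarrow> bool" where
  "biquandle \<sigma> \<longleftrightarrow> YB_solution \<sigma> \<and>
     (\<forall>x z. \<exists>!y. S1 \<sigma> x y = z) \<and>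
     (\<forall>y t. \<exists>!x. S2 \<sigma> x y = t) \<and>
     (\<exists>s. is_fix_map \<sigma> s)"

text \<open>The map s_sigma of condition (iii) (uniquely determined for a biquandle).\<close>
definition s_map :: "('a \<times> 'a \<Rightarrow> 'a \<times> 'a) \<Rightarrow> 'a \<Rightarrow> 'a" where
  "s_map \<sigma> = (SOME s. is_fix_map \<sigma> s)"

definition virtual_pair :: "('a \<times> 'a \<Rightarrow> 'a \<times> 'a) \<Rightarrow> ('a \<times> 'a \<Rightarrow> 'a \<times> 'a) \<Rightarrow> bool" where
  "virtual_pair S \<beta> \<longleftrightarrow> biquandle S \<and> biquandle \<beta> \<and> \<beta> \<circ> \<beta> = id \<and>
     on_right \<beta> \<circ> on_left S \<circ> on_right \<beta> = on_left \<beta> \<circ> on_right S \<circ> on_left \<beta>"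

definition nc_cocycle_pair ::
  "('h, 'm) monoid_scheme \<Rightarrow> ('a \<times> 'a \<Rightarrow> 'a \<times> 'a) \<Rightarrow> ('a \<times> 'a \<Rightarrow> 'a \<times> 'a)
     \<Rightarrow> ('a \<times> 'a \<Rightarrow> 'h) \<Rightarrow> ('a \<times> 'a \<Rightarrow> 'h) \<Rightarrow> bool" where
  "nc_cocycle_pair H S \<beta> f g \<longleftrightarrow>
     (\<forall>p. f p \<in> carrier H) \<and> (\<forall>p. g p \<in> carrier H) \<and>
     (\<forall>x y z. f (x, y) \<otimes>\<^bsub>H\<^esub> f (S2 S x y, z)
         = f (x, S1 S y z) \<otimes>\<^bsub>H\<^esub> f (S2 S x (S1 S y z), S2 S y z)) \<and>
     (\<forall>x y z. f (S1 S x y, S1 S (S2 S x y) z) = f (y, z)) \<and>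
     (\<forall>x. f (x, s_map S x) = \<one>\<^bsub>H\<^esub>) \<and>
     (\<forall>x. g (x, s_map \<beta> x) = \<one>\<^bsub>H\<^esub>) \<and>
     (\<forall>x y. g (x, y) \<otimes>\<^bsub>H\<^esub> g (\<beta> (x, y)) = \<one>\<^bsub>H\<^esub>) \<and>
     (\<forall>x y z. g (x, y) \<otimes>\<^bsub>H\<^esub> g (S2 \<beta> x y, z)
         = g (x, S1 \<beta> y z) \<otimes>\<^bsub>H\<^esub> g (S2 \<beta> x (S1 \<beta> y z), S2 \<beta> y z)) \<and>
     (\<forall>x y z. g (y, z) \<otimes>\<^bsub>H\<^esub> g (S2 \<beta> x (S1 \<beta> y z), S2 \<beta> y z)
         = g (x, y) \<otimes>\<^bsub>H\<^esub> g (S1 \<beta> x y, S1 \<beta> (S2 \<beta> x y) z)) \<and>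
     (\<forall>x y z. g (y, z) \<otimes>\<^bsub>H\<^esub> g (x, S1 \<beta> y z)
         = g (S2 \<beta> x y, z) \<otimes>\<^bsub>H\<^esub> g (S1 \<beta> x y, S1 \<beta> (S2 \<beta> x y) z)) \<and>
     (\<forall>x y z. g (y, z) = g (S1 S x y, S1 \<beta> (S2 S x y) z)) \<and>
     (\<forall>x y z. g (y, z) \<otimes>\<^bsub>H\<^esub> g (x, S1 \<beta> y z)
         = g (S2 S x y, z) \<otimes>\<^bsub>H\<^esub> g (S1 S x y, S1 \<beta> (S2 S x y) z)) \<and>
     (\<forall>x y z. g (x, S1 \<beta> y z) \<otimes>\<^bsub>H\<^esub> f (S2 \<beta> x (S1 \<beta> y z), S2 \<beta> y z)
         = f (x, y) \<otimes>\<^bsub>H\<^esub> g (S2 S x y, z))"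

text \<open>
  Semi-arcs are labelled by natural numbers.  A crossing is stored in the normal form of the
  paper, both strands drawn downward: Cr k a b c d has incoming semi-arcs a (top-left) and
  b (top-right) and outgoing semi-arcs c (bottom-left) and d (bottom-right); the strands run
  a -> d and b -> c.  For k = Pos the under-strand is a -> d, for k = Neg the over-strand is
  a -> d, for k = Virt the crossing is virtual.  Mark i j is a bivalent marker on a strand
  (a point subdividing a semi-arc; it carries no information), needed so that crossingless
  components and local moves on plain arcs can be represented.  A diagram is a finite set of
  such vertices in which every semi-arc label occurring is incoming at exactly one slot and
  outgoing at exactly one slot.
\<close>

datatype ckind = Pos | Neg | Virt

datatype vert = Mark nat nat | Cr ckind nat nat nat nat

type_synonym diagram = "vert set"

fun ins :: "vert \<Rightarrow> nat list" where
  "ins (Mark i j) = [i]"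
| "ins (Cr k a b c d) = [a, b]"

fun outs :: "vert \<Rightarrow> nat list" where
  "outs (Mark i j) = [j]"
| "outs (Cr k a b c d) = [c, d]"

definition edges :: "diagram \<Rightarrow> nat set" where
  "edges D = (\<Union>v\<in>D. set (ins v) \<union> set (outs v))"

definition wf_diagram :: "diagram \<Rightarrow> bool" where
  "wf_diagram D \<longleftrightarrow> finite D \<and>
     (\<forall>e\<in>edges D. (\<Sum>v\<in>D. count_list (ins v) e) = 1 \<and> (\<Sum>v\<in>D. count_list (outs v) e) = 1)"

fun passes :: "vert \<Rightarrow> nat \<Rightarrow> nat \<Rightarrow> bool" where
  "passes (Mark i j) e e' \<longleftrightarrow> e = i \<and> e' = j"
| "passes (Cr k a b c d) e e' \<longleftrightarrow> (e = a \<and> e' = d) \<or> (e = b \<and> e' = c)"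

definition nxt :: "diagram \<Rightarrow> nat \<Rightarrow> nat" where
  "nxt D e = (THE e'. \<exists>v\<in>D. passes v e e')"

definition component :: "diagram \<Rightarrow> nat \<Rightarrow> nat set" where
  "component D e = {(nxt D ^^ n) e | n. True}"

definition components :: "diagram \<Rightarrow> nat set set" where
  "components D = component D ` edges D"

definition base_points :: "diagram \<Rightarrow> (nat set \<Rightarrow> nat) \<Rightarrow> bool" where
  "base_points D bp \<longleftrightarrow> (\<forall>K\<in>components D. bp K \<in> K)"

fun vert_colored :: "('a \<times> 'a \<Rightarrow> 'a \<times> 'a) \<Rightarrow> ('a \<times> 'a \<Rightarrow> 'a \<times> 'a) \<Rightarrow> (nat \<Rightarrow> 'a) \<Rightarrow> vert \<Rightarrow> bool" where
  "vert_colored S \<beta> C (Mark i j) \<longleftrightarrow> C j = C i"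
| "vert_colored S \<beta> C (Cr Pos a b c d) \<longleftrightarrow> (C c, C d) = S (C a, C b)"
| "vert_colored S \<beta> C (Cr Neg a b c d) \<longleftrightarrow> (C a, C b) = S (C c, C d)"
| "vert_colored S \<beta> C (Cr Virt a b c d) \<longleftrightarrow> (C c, C d) = \<beta> (C a, C b)"

definition colorings :: "('a \<times> 'a \<Rightarrow> 'a \<times> 'a) \<Rightarrow> ('a \<times> 'a \<Rightarrow> 'a \<times> 'a) \<Rightarrow> diagram \<Rightarrow> (nat \<Rightarrow> 'a) set" where
  "colorings S \<beta> D = {C. \<forall>v\<in>D. vert_colored S \<beta> C v}"

text \<open>Contribution of vertex v to a strand entering v along semi-arc e: the Boltzmann weight
  if the strand passes along the under-strand of a classical crossing or through a virtual
  crossing, and 1 otherwise.\<close>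
fun vert_weight :: "('h, 'm) monoid_scheme \<Rightarrow> ('a \<times> 'a \<Rightarrow> 'h) \<Rightarrow> ('a \<times> 'a \<Rightarrow> 'h)
     \<Rightarrow> (nat \<Rightarrow> 'a) \<Rightarrow> vert \<Rightarrow> nat \<Rightarrow> 'h" where
  "vert_weight H f g C (Mark i j) e = \<one>\<^bsub>H\<^esub>"
| "vert_weight H f g C (Cr Pos a b c d) e = (if e = a then f (C a, C b) else \<one>\<^bsub>H\<^esub>)"
| "vert_weight H f g C (Cr Neg a b c d) e = (if e = b then inv\<^bsub>H\<^esub> (f (C c, C d)) else \<one>\<^bsub>H\<^esub>)"
| "vert_weight H f g C (Cr Virt a b c d) e = g (C a, C b)"

definition arc_weight :: "('h, 'm) monoid_scheme \<Rightarrow> ('a \<times> 'a \<Rightarrow> 'h) \<Rightarrow> ('a \<times> 'a \<Rightarrow> 'h)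
     \<Rightarrow> diagram \<Rightarrow> (nat \<Rightarrow> 'a) \<Rightarrow> nat \<Rightarrow> 'h" where
  "arc_weight H f g D C e = vert_weight H f g C (THE v. v \<in> D \<and> e \<in> set (ins v)) e"

definition period :: "diagram \<Rightarrow> nat \<Rightarrow> nat" where
  "period D e = (LEAST n. 0 < n \<and> (nxt D ^^ n) e = e)"

definition Psi :: "('h, 'm) monoid_scheme \<Rightarrow> ('a \<times> 'a \<Rightarrow> 'h) \<Rightarrow> ('a \<times> 'a \<Rightarrow> 'h)
     \<Rightarrow> diagram \<Rightarrow> (nat \<Rightarrow> 'a) \<Rightarrow> nat \<Rightarrow> 'h" where
  "Psi H f g D C e =
     foldr (\<lambda>k acc. arc_weight H f g D C ((nxt D ^^ k) e) \<otimes>\<^bsub>H\<^esub> acc) [0..<period D e] \<one>\<^bsub>H\<^esub>"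

definition conj_class :: "('h, 'm) monoid_scheme \<Rightarrow> 'h \<Rightarrow> 'h set" where
  "conj_class H x = {h \<otimes>\<^bsub>H\<^esub> x \<otimes>\<^bsub>H\<^esub> inv\<^bsub>H\<^esub> h | h. h \<in> carrier H}"

definition Psi_inv :: "('h, 'm) monoid_scheme \<Rightarrow> ('a \<times> 'a \<Rightarrow> 'a \<times> 'a) \<Rightarrow> ('a \<times> 'a \<Rightarrow> 'a \<times> 'a)
     \<Rightarrow> ('a \<times> 'a \<Rightarrow> 'h) \<Rightarrow> ('a \<times> 'a \<Rightarrow> 'h) \<Rightarrow> diagram \<Rightarrow> (nat set \<Rightarrow> nat) \<Rightarrow> 'h set set" where
  "Psi_inv H S \<beta> f g D bp =
     {conj_class H (Psi H f g D C (bp K)) | K C. K \<in> components D \<and> C \<in> colorings S \<beta> D}"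

text \<open>
  Crossings drawn in an arbitrary position: half-edges h0, h1, h2, h3 listed clockwise, each a
  semi-arc label together with a flag telling whether it is incoming; one strand is h0 - h2, the
  other h1 - h3 (each strand has exactly one incoming half-edge).  The over-information says
  which strand is over, or that the crossing is virtual.  gx converts this to the normal form
  (rotate until both strands point downward: the two incoming half-edges, which are adjacent,
  become top-left, top-right in clockwise order).
\<close>

datatype over_info = Over02 | Over13 | OVirt

definition gx :: "over_info \<Rightarrow> nat \<times> bool \<Rightarrow> nat \<times> bool \<Rightarrow> nat \<times> bool \<Rightarrow> nat \<times> bool \<Rightarrow> vert" where
  "gx ov h0 h1 h2 h3 =
    (let (a, b, c, d, aover) =
       (if snd h0 \<and> snd h1 then (fst h0, fst h1, fst h3, fst h2, ov = Over02)
        else if snd h1 \<and> snd h2 then (fst h1, fst h2, fst h0, fst h3, ov = Over13)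
        else if snd h2 \<and> snd h3 then (fst h2, fst h3, fst h1, fst h0, ov = Over02)
        else (fst h3, fst h0, fst h2, fst h1, ov = Over13))
     in Cr (if ov = OVirt then Virt else if aover then Neg else Pos) a b c d)"

definition arc :: "bool \<Rightarrow> nat \<Rightarrow> nat \<Rightarrow> vert" where
  "arc dir p q = (if dir then Mark p q else Mark q p)"

text \<open>RI and vRI: a strand between boundary semi-arcs q0 (top) and q1 (bottom), oriented
  downward iff dir, acquires a kink (on either side) with loop semi-arc l.\<close>
definition move_R1 :: "vert set \<Rightarrow> vert set \<Rightarrow> bool" where
  "move_R1 T T' \<longleftrightarrow> (\<exists>dir q0 q1 l ov.
      T = {arc dir q0 q1} \<and>
      (T' = {gx ov (q0, dir) (l, dir) (l, \<not> dir) (q1, \<not> dir)} \<or>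
       T' = {gx ov (q0, dir) (q1, \<not> dir) (l, \<not> dir) (l, dir)}))"

text \<open>RII and vRII: strand S from q0 (top-left) to q3 (bottom-left), strand T from q1
  (top-right) to q2 (bottom-right), arbitrary orientations dS, dT (True = downward); they
  cross twice forming a bigon with semi-arcs sM, tM; the same strand is over at both
  crossings, or both crossings are virtual.\<close>
definition move_R2 :: "vert set \<Rightarrow> vert set \<Rightarrow> bool" where
  "move_R2 T T' \<longleftrightarrow> (\<exists>dS dT q0 q1 q2 q3 sM tM ovU ovW.
      (ovU, ovW) \<in> {(Over02, Over13), (Over13, Over02), (OVirt, OVirt)} \<and>
      T = {arc dS q0 q3, arc dT q1 q2} \<and>
      T' = {gx ovU (q0, dS) (q1, dT) (sM, \<not> dS) (tM, \<not> dT),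
            gx ovW (tM, dT) (sM, dS) (q2, \<not> dT) (q3, \<not> dS)})"

datatype pair_kind = PVirt | FirstOver | SecondOver

text \<open>Allowed combinations: all three crossings classical with the over/under information
  coming from an ordering of the strands by height (RIII); all virtual (vRIII); or one strand
  crossing the two others virtually while they cross classically (mixed RIII).  A single
  virtual crossing (forbidden moves) or a cyclic over-relation is excluded.\<close>
definition r3_kinds :: "pair_kind \<Rightarrow> pair_kind \<Rightarrow> pair_kind \<Rightarrow> bool" where
  "r3_kinds kAB kAC kBC \<longleftrightarrow>
     (kAB = PVirt \<and> kAC = PVirt \<and> kBC = PVirt) \<or>
     (kAB = PVirt \<and> kAC = PVirt \<and> kBC \<noteq> PVirt) \<or>
     (kAB = PVirt \<and> kBC = PVirt \<and> kAC \<noteq> PVirt) \<or>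
     (kAC = PVirt \<and> kBC = PVirt \<and> kAB \<noteq> PVirt) \<or>
     (kAB \<noteq> PVirt \<and> kAC \<noteq> PVirt \<and> kBC \<noteq> PVirt \<and>
      \<not> (kAB = FirstOver \<and> kBC = FirstOver \<and> kAC = SecondOver) \<and>
      \<not> (kAB = SecondOver \<and> kBC = SecondOver \<and> kAC = FirstOver))"

fun ov_first02 :: "pair_kind \<Rightarrow> over_info" where
  "ov_first02 PVirt = OVirt" | "ov_first02 FirstOver = Over02" | "ov_first02 SecondOver = Over13"

fun ov_first13 :: "pair_kind \<Rightarrow> over_info" where
  "ov_first13 PVirt = OVirt" | "ov_first13 FirstOver = Over13" | "ov_first13 SecondOver = Over02"

text \<open>RIII, vRIII and mixed RIII.  Six boundary semi-arcs p0..p5 at clockwise positions of a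
  disc; strand A joins p0,p3, strand B joins p1,p4, strand C joins p2,p5 (dA: A runs p0 -> p3,
  dB: B runs p1 -> p4, dC: C runs p2 -> p5).  The two sides of the move are the two
  triangle configurations; eA, eB, eC (resp. fA, fB, fC) are the inner semi-arcs.\<close>
definition move_R3 :: "vert set \<Rightarrow> vert set \<Rightarrow> bool" where
  "move_R3 T T' \<longleftrightarrow> (\<exists>dA dB dC p0 p1 p2 p3 p4 p5 eA eB eC fA fB fC kAB kAC kBC.
      r3_kinds kAB kAC kBC \<and>
      T = {gx (ov_first02 kAB) (eA, dA) (eB, dB) (p3, \<not> dA) (p4, \<not> dB),
           gx (ov_first02 kAC) (p0, dA) (eC, dC) (eA, \<not> dA) (p5, \<not> dC),
           gx (ov_first13 kBC) (eC, \<not> dC) (p1, dB) (p2, dC) (eB, \<not> dB)} \<and>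
      T' = {gx (ov_first02 kAB) (fA, \<not> dA) (fB, \<not> dB) (p0, dA) (p1, dB),
            gx (ov_first02 kAC) (p3, \<not> dA) (fC, \<not> dC) (fA, dA) (p2, dC),
            gx (ov_first13 kBC) (fC, dC) (p4, \<not> dB) (p5, \<not> dC) (fB, dB)})"

definition local_move :: "diagram \<Rightarrow> diagram \<Rightarrow> bool" where
  "local_move D D' \<longleftrightarrow> (\<exists>R T T'. D = R \<union> T \<and> D' = R \<union> T' \<and> R \<inter> T = {} \<and> R \<inter> T' = {} \<and>
      (move_R1 T T' \<or> move_R2 T T' \<or> move_R3 T T'))"

fun rename_in :: "nat \<Rightarrow> nat \<Rightarrow> vert \<Rightarrow> vert" where
  "rename_in e e' (Mark i j) = Mark (if i = e then e' else i) j"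
| "rename_in e e' (Cr k a b c d) = Cr k (if a = e then e' else a) (if b = e then e' else b) c d"

fun map_vert :: "(nat \<Rightarrow> nat) \<Rightarrow> vert \<Rightarrow> vert" where
  "map_vert h (Mark i j) = Mark (h i) (h j)"
| "map_vert h (Cr k a b c d) = Cr k (h a) (h b) (h c) (h d)"

definition subdivide :: "diagram \<Rightarrow> diagram \<Rightarrow> bool" where
  "subdivide D D' \<longleftrightarrow> (\<exists>e e'. e \<in> edges D \<and> e' \<notin> edges D \<and>
      D' = rename_in e e' ` D \<union> {Mark e e'})"

definition relabel :: "diagram \<Rightarrow> diagram \<Rightarrow> bool" where
  "relabel D D' \<longleftrightarrow> (\<exists>h. inj h \<and> D' = map_vert h ` D)"

definition diagram_move :: "diagram \<Rightarrow> diagram \<Rightarrow> bool" where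
  "diagram_move D D' \<longleftrightarrow> wf_diagram D \<and> wf_diagram D' \<and>
     (local_move D D' \<or> subdivide D D' \<or> relabel D D')"

definition vlink_equiv :: "diagram \<Rightarrow> diagram \<Rightarrow> bool" where
  "vlink_equiv = equivclp diagram_move"

end

theory Submission
  imports Defs
begin

text \<open>
  Replace every color \<open>x\<close> by a pair \<open>(x, h)\<close>, where \<open>h\<close> records the product of the weights collected
  so far along the strand. A crossing then multiplies \<open>h\<close> by its Boltzmann weight, and the cocycle
  conditions say exactly that these decorated crossings again form a virtual pair on \<open>X \<times> H\<close>.
  Hence it suffices to understand colorings: for any virtual pair, the two sides of a move admit
  the same boundary colors, and applied to the decorated pair this gives equality of the weights
  collected along each strand of the tangle. All orientations and over/under patterns of RIII
  reduce to the braid relation, because reversing a strand exchanges the two ends of the strands it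
  crosses and crossing relations are bijective in all directions. Outside the tangle nothing
  changes, so the products along closed components agree; moving a base point conjugates them.
\<close>

section \<open>Crossing relations of a virtual pair\<close>

text \<open>The accumulated weight cannot be carried once around a closed component: the product
  over a full turn is the very element that is measured. Decorated colors are therefore used only
  inside the disc of a move, where every strand starts with weight \<open>\<one>\<close> at its
  entrance, so that the weight at its exit is the contribution of the strand. They are attached to
  slots of crossings, not to labels, since two boundary ends may carry the same label.

  The two sides of a move have different numbers of vertices, so cycles are not compared step by
  step. They are cut at semi-arcs common to both diagrams, and the pieces agree in target and
  product.

  Two further obstacles come from the encoding. The carrier of \<open>H\<close> is only a subset of
  a type, while colors fill a whole type. And a diagram is a set of vertices, so two crossings of a
  move pattern may coincide; such merged patterns are not covered by the geometric argument and are
  reduced to kinks.\<close>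

lemma on_left_apply [simp]: "on_left \<sigma> (x, y, z) = (S1 \<sigma> x y, S2 \<sigma> x y, z)"
  by (simp add: on_left_def S1_def S2_def)

lemma on_right_apply [simp]: "on_right \<sigma> (x, y, z) = (x, S1 \<sigma> y z, S2 \<sigma> y z)"
  by (simp add: on_right_def S1_def S2_def)

lemma on_left_comp: "on_left \<sigma> (on_left \<tau> t) = on_left (\<sigma> \<circ> \<tau>) t"
  by (cases t) (simp add: S1_def S2_def)

lemma on_right_comp: "on_right \<sigma> (on_right \<tau> t) = on_right (\<sigma> \<circ> \<tau>) t"
  by (cases t) (simp add: on_right_def)

lemma on_left_id [simp]: "on_left id t = t"
  by (cases t) (simp add: S1_def S2_def)

lemma on_right_id [simp]: "on_right id t = t"
  by (cases t) (simp add: S1_def S2_def)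

lemma biquandle_fixed_iff:
  assumes "biquandle \<sigma>"
  shows "\<sigma> (x, y) = (x, y) \<longleftrightarrow> y = s_map \<sigma> x"
proof -
  have "is_fix_map \<sigma> (s_map \<sigma>)"
    using assms unfolding biquandle_def s_map_def by (metis someI_ex)
  then have "{p. \<sigma> p = p} = {(x, s_map \<sigma> x) | x. True}"
    by (simp add: is_fix_map_def)
  then have "(x, y) \<in> {p. \<sigma> p = p} \<longleftrightarrow> (x, y) \<in> {(x, s_map \<sigma> x) | x. True}"
    by simp
  then show ?thesis by simp
qed

lemma bij_s_map: "biquandle \<sigma> \<Longrightarrow> bij (s_map \<sigma>)"
  unfolding biquandle_def s_map_def is_fix_map_def by (metis (mono_tags, lifting) someI_ex)

text \<open>Compare with the fixed point that has the preserved coordinate: unique solvability in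
  the other coordinate leaves no second candidate. For the right coordinate this fixed point exists
  because \<open>s_map\<close> is onto.\<close>

lemma biquandle_kink:
  assumes "biquandle \<sigma>"
  shows "\<sigma> (x, y) = (x', y) \<Longrightarrow> x' = x \<and> y = s_map \<sigma> x"
    and "\<sigma> (x, y) = (x, y') \<Longrightarrow> y' = y \<and> y = s_map \<sigma> x"
proof -
  assume eq: "\<sigma> (x, y) = (x', y)"
  obtain x0 where x0: "s_map \<sigma> x0 = y"
    using bij_s_map[OF assms] by (metis bij_pointE)
  then have "\<sigma> (x0, y) = (x0, y)"
    using biquandle_fixed_iff[OF assms] by blast
  then have "S2 \<sigma> x0 y = y" "S2 \<sigma> x y = y" using eq by (simp_all add: S2_def)
  then have "x = x0" using assms unfolding biquandle_def by metis
  then show "x' = x \<and> y = s_map \<sigma> x" using \<open>\<sigma> (x0, y) = (x0, y)\<close> x0 eq by simp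
next
  assume eq: "\<sigma> (x, y) = (x, y')"
  have "\<sigma> (x, s_map \<sigma> x) = (x, s_map \<sigma> x)"
    using biquandle_fixed_iff[OF assms] by blast
  then have "S1 \<sigma> x (s_map \<sigma> x) = x" "S1 \<sigma> x y = x" using eq by (simp_all add: S1_def)
  then have "y = s_map \<sigma> x" using assms unfolding biquandle_def by metis
  then show "y' = y \<and> y = s_map \<sigma> x" using \<open>\<sigma> (x, s_map \<sigma> x) = _\<close> eq by simp
qed

text \<open>Both strands point downward, and the first one enters from the left.\<close>
fun crossing_map :: "('a \<times> 'a \<Rightarrow> 'a \<times> 'a) \<Rightarrow> ('a \<times> 'a \<Rightarrow> 'a \<times> 'a) \<Rightarrow> pair_kind \<Rightarrow> 'a \<times> 'a \<Rightarrow> 'a \<times> 'a" where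
  "crossing_map S \<beta> PVirt = \<beta>"
| "crossing_map S \<beta> SecondOver = S"
| "crossing_map S \<beta> FirstOver = inv_into UNIV S"

text \<open>Turning a crossing upside down about one strand shows that reversing the first strand
  amounts to exchanging the two ends of the second one, and vice versa.\<close>
definition xrel :: "('a \<times> 'a \<Rightarrow> 'a \<times> 'a) \<Rightarrow> ('a \<times> 'a \<Rightarrow> 'a \<times> 'a) \<Rightarrow> pair_kind \<Rightarrow> bool \<Rightarrow> bool
    \<Rightarrow> 'a \<Rightarrow> 'a \<Rightarrow> 'a \<Rightarrow> 'a \<Rightarrow> bool" where
  "xrel S \<beta> k dP dQ x y x' y' \<longleftrightarrow>
     ((if dP then y' else y), (if dQ then x' else x))
       = crossing_map S \<beta> k ((if dQ then x else x'), (if dP then y else y'))"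

fun opposite :: "pair_kind \<Rightarrow> pair_kind" where
  "opposite PVirt = PVirt" | "opposite FirstOver = SecondOver" | "opposite SecondOver = FirstOver"

locale vpair =
  fixes S \<beta> :: "'a \<times> 'a \<Rightarrow> 'a \<times> 'a"
  assumes vp: "virtual_pair S \<beta>"
begin

abbreviation cm where "cm \<equiv> crossing_map S \<beta>"

lemma bq_S: "biquandle S" and bq_\<beta>: "biquandle \<beta>" and \<beta>\<beta>: "\<beta> \<circ> \<beta> = id"
  using vp by (auto simp: virtual_pair_def)

lemma bij_S: "bij S"
  using bq_S by (simp add: biquandle_def YB_solution_def)

lemma \<beta>_invol [simp]: "\<beta> (\<beta> p) = p"
  using \<beta>\<beta> by (metis comp_apply id_apply)

lemma crossing_map_opposite [simp]: "cm (opposite k) (cm k p) = p" "cm k (cm (opposite k) p) = p"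
  using bij_S by (cases k; simp add: bij_is_inj bij_is_surj surj_f_inv_f)+

lemma crossing_map_eq_iff: "q = cm k p \<longleftrightarrow> p = cm (opposite k) q"
  by (metis crossing_map_opposite)

text \<open>In the \<open>FirstOver\<close> case the equation says \<open>S (z, w) = (x, y)\<close>
  for some \<open>w\<close>. The first coordinate determines \<open>w\<close>, and then the second
  one is \<open>y\<close>.\<close>

lemma crossing_map_left_unique:
  "\<exists>!y. fst (cm k (x, y)) = z"
proof (cases k)
  case PVirt
  then show ?thesis using bq_\<beta> by (simp add: biquandle_def S1_def)
next
  case SecondOver
  then show ?thesis using bq_S by (simp add: biquandle_def S1_def)
next
  case FirstOver
  obtain w where w: "S (z, w) = (x, snd (S (z, w)))"
    using bq_S unfolding biquandle_def S1_def by (metis prod.collapse)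
  have inv: "inv_into UNIV S (S p) = p" "S (inv_into UNIV S p) = p" for p
    using bij_S by (simp_all add: bij_is_inj bij_is_surj surj_f_inv_f)
  show ?thesis
  proof (rule ex1I[of _ "snd (S (z, w))"])
    show "fst (cm k (x, snd (S (z, w)))) = z"
      using FirstOver w inv(1)[of "(z, w)"] by simp
  next
    fix y assume "fst (cm k (x, y)) = z"
    then obtain w' where "inv_into UNIV S (x, y) = (z, w')"
      using FirstOver by (metis crossing_map.simps(3) prod.collapse)
    then have e: "S (z, w') = (x, y)" using inv(2)[of "(x, y)"] by simp
    then have "S1 S z w' = S1 S z w" using w by (metis S1_def fst_conv)
    then have "w' = w" using bq_S unfolding biquandle_def by metis
    then show "y = snd (S (z, w))" using e by simp
  qed
qed

lemma crossing_map_right_unique: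
  "\<exists>!x. snd (cm k (x, y)) = t"
proof (cases k)
  case PVirt
  then show ?thesis using bq_\<beta> by (simp add: biquandle_def S2_def)
next
  case SecondOver
  then show ?thesis using bq_S by (simp add: biquandle_def S2_def)
next
  case FirstOver
  obtain w where w: "S (w, t) = (fst (S (w, t)), y)"
    using bq_S unfolding biquandle_def S2_def by (metis prod.collapse)
  have inv: "inv_into UNIV S (S p) = p" "S (inv_into UNIV S p) = p" for p
    using bij_S by (simp_all add: bij_is_inj bij_is_surj surj_f_inv_f)
  show ?thesis
  proof (rule ex1I[of _ "fst (S (w, t))"])
    show "snd (cm k (fst (S (w, t)), y)) = t"
      using FirstOver w inv(1)[of "(w, t)"] by simp
  next
    fix x assume "snd (cm k (x, y)) = t"
    then obtain w' where "inv_into UNIV S (x, y) = (w', t)"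
      using FirstOver by (metis crossing_map.simps(3) prod.collapse)
    then have e: "S (w', t) = (x, y)" using inv(2)[of "(x, y)"] by simp
    then have "S2 S w' t = S2 S w t" using w by (metis S2_def snd_conv)
    then have "w' = w" using bq_S unfolding biquandle_def by metis
    then show "x = fst (S (w, t))" using e by simp
  qed
qed

lemma crossing_map_kink:
  "cm k (x, y) = (x', y) \<longleftrightarrow> x' = x \<and> cm k (x, y) = (x, y)"
  "cm k (x, y) = (x, y') \<longleftrightarrow> y' = y \<and> cm k (x, y) = (x, y)"
  using biquandle_kink[OF bq_S] biquandle_kink[OF bq_\<beta>]
  by (cases k; metis crossing_map_eq_iff crossing_map.simps opposite.simps)+

lemma crossing_map_fixed_right: "\<exists>y. cm k (x, y) = (x, y)"
proof -
  obtain y where "fst (cm k (x, y)) = x" using crossing_map_left_unique by blast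
  then show ?thesis by (metis crossing_map_kink(2) prod.collapse)
qed

lemma crossing_map_fixed_left: "\<exists>x. cm k (x, y) = (x, y)"
proof -
  obtain x where "snd (cm k (x, y)) = y" using crossing_map_right_unique by blast
  then show ?thesis by (metis crossing_map_kink(1) prod.collapse)
qed

text \<open>In a kink the loop fills two adjacent slots of the crossing, so the coloring condition
  preserves one coordinate of \<open>cm k\<close>. Which one depends on the side of the loop and on
  the orientation.\<close>

lemma xrel_R1:
  "(\<exists>l. xrel S \<beta> k d d q0 l l q1) \<longleftrightarrow> q0 = q1"
  "(\<exists>l. xrel S \<beta> k d (\<not> d) q0 q1 l l) \<longleftrightarrow> q0 = q1"
  unfolding xrel_def
  by (cases d; simp; metis crossing_map_kink crossing_map_fixed_left crossing_map_fixed_right)+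

text \<open>The second crossing of a bigon, read backwards with the two strands exchanged, is the
  first one.\<close>

lemma xrel_opposite: "xrel S \<beta> (opposite k) dT dS t s q2 q3 \<longleftrightarrow> xrel S \<beta> k dS dT q3 q2 s t"
  unfolding xrel_def by (cases dS; cases dT; simp; metis crossing_map_eq_iff)

text \<open>For parallel strands this is bijectivity of \<open>cm k\<close>; for antiparallel
  strands it is unique solvability in each coordinate.\<close>

lemma xrel_bijective:
  "\<exists>x' y'. xrel S \<beta> k dP dQ x y x' y'"
  "\<exists>x y. xrel S \<beta> k dP dQ x y x' y'"
  "xrel S \<beta> k dP dQ x y x' y' \<Longrightarrow> xrel S \<beta> k dP dQ x y x'' y'' \<Longrightarrow> x'' = x' \<and> y'' = y'"
  "xrel S \<beta> k dP dQ x y x' y' \<Longrightarrow> xrel S \<beta> k dP dQ x2 y2 x' y' \<Longrightarrow> x2 = x \<and> y2 = y"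
  unfolding xrel_def
  subgoal
    using crossing_map_left_unique[of k x y] crossing_map_right_unique[of k y x]
    by (cases dP; cases dQ; simp; metis crossing_map_eq_iff prod.collapse)
  subgoal
    using crossing_map_left_unique[of k x' y'] crossing_map_right_unique[of k y' x']
    by (cases dP; cases dQ; simp; metis crossing_map_eq_iff prod.collapse)
  subgoal
    using crossing_map_left_unique[of k x y] crossing_map_right_unique[of k y x]
    by (cases dP; cases dQ; simp; metis crossing_map_eq_iff prod.collapse prod.inject)
  subgoal
    using crossing_map_left_unique[of k x' y'] crossing_map_right_unique[of k y' x']
    by (cases dP; cases dQ; simp; metis crossing_map_eq_iff prod.collapse prod.inject)
  done

text \<open>Both crossings become one and the same relation with the common ends \<open>s\<close>
  and \<open>t\<close>, which determine the other two ends.\<close>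

lemma xrel_R2:
  "(\<exists>s t. xrel S \<beta> k dS dT q0 q1 s t \<and> xrel S \<beta> (opposite k) dT dS t s q2 q3)
     \<longleftrightarrow> q0 = q3 \<and> q1 = q2"
  unfolding xrel_opposite by (metis xrel_bijective)

section \<open>The braid relation, and RIII for colors in all orientations\<close>

lemma braid_relation:
  assumes "r3_kinds kAB kAC kBC"
  shows "on_right (cm kAB) (on_left (cm kAC) (on_right (cm kBC) t))
       = on_left (cm kBC) (on_right (cm kAC) (on_left (cm kAB) t))"
proof -
  let ?l = "\<lambda>k. on_left (cm k)" and ?r = "\<lambda>k. on_right (cm k)"
  have opp: "cm k \<circ> cm (opposite k) = id" for k by (rule ext) simp
  have opp': "cm (opposite k) \<circ> cm k = id" for k by (rule ext) simp
  have c: "?l k (?l (opposite k) u) = u" "?l (opposite k) (?l k u) = u"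
    "?r k (?r (opposite k) u) = u" "?r (opposite k) (?r k u) = u" for k u
    by (simp_all only: on_left_comp on_right_comp opp opp' on_left_id on_right_id)
  note c1 = c[of SecondOver, unfolded opposite.simps] and c2 = c[of PVirt, unfolded opposite.simps]
  have yS: "?r SecondOver (?l SecondOver (?r SecondOver u)) = ?l SecondOver (?r SecondOver (?l SecondOver u))" for u
    using bq_S by (auto simp: biquandle_def YB_solution_def dest: fun_cong[of _ _ u])
  have yB: "?r PVirt (?l PVirt (?r PVirt u)) = ?l PVirt (?r PVirt (?l PVirt u))" for u
    using bq_\<beta> by (auto simp: biquandle_def YB_solution_def dest: fun_cong[of _ _ u])
  have m: "?r PVirt (?l SecondOver (?r PVirt u)) = ?l PVirt (?r SecondOver (?l PVirt u))" for u
    using vp by (auto simp: virtual_pair_def dest: fun_cong[of _ _ u])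
  \<comment> \<open>Inverting all factors on both sides of \<open>m\<close> replaces its classical
    crossing \<open>S\<close> by the inverse of \<open>S\<close>.\<close>
  have mk: "?r PVirt (?l k (?r PVirt u)) = ?l PVirt (?r k (?l PVirt u))" for k u
  proof (cases k)
    case FirstOver
    define w where "w = ?r PVirt (?l FirstOver (?r PVirt u))"
    have "?r PVirt (?l SecondOver (?r PVirt w)) = u"
      unfolding w_def by (simp only: c1 c2)
    then have "?l PVirt (?r FirstOver (?l PVirt (?l PVirt (?r SecondOver (?l PVirt w)))))
        = ?l PVirt (?r FirstOver (?l PVirt u))"
      by (simp only: m)
    then have "w = ?l PVirt (?r FirstOver (?l PVirt u))"
      by (simp only: c1 c2)
    then show ?thesis using FirstOver by (simp only: w_def)
  qed (simp_all only: yB m)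
  \<comment> \<open>As \<open>\<beta>\<close> is an involution, a virtual factor can be moved from
    one side to the other. This places the classical crossing between another pair of
    strands.\<close>
  have m2: "?r k (?l PVirt (?r PVirt u)) = ?l PVirt (?r PVirt (?l k u))" for k u
    using mk[of k "?r PVirt u"] by (metis c2)
  have m3: "?r PVirt (?l PVirt (?r k u)) = ?l k (?r PVirt (?l PVirt u))" for k u
    using mk[of k "?l PVirt u"] by (metis c2)
  define l where "l = ?l SecondOver"
  define l' where "l' = ?l FirstOver"
  define r where "r = ?r SecondOver"
  define r' where "r' = ?r FirstOver"
  note c' = c1[folded l_def l'_def r_def r'_def] and y = yS[folded l_def r_def]
  \<comment> \<open>Each equation is \<open>y\<close> with some factors moved to the other side by
    inversion. Together with \<open>y\<close> these are the six consistent height orders; the two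
    sign patterns missing are the cyclic ones.\<close>
  have s: "r (l (r' u)) = l' (r (l u))" "r' (l (r u)) = l (r (l' u))"
    "r' (l' (r u)) = l (r' (l' u))" "r (l' (r' u)) = l' (r' (l u))" "r' (l' (r' u)) = l' (r' (l' u))" for u
  proof -
    show "r (l (r' u)) = l' (r (l u))" using y[of "r' u"] by (simp add: c')
    show "r' (l (r u)) = l (r (l' u))" using y[of "l' u", symmetric] by (simp add: c')
    show "r' (l' (r u)) = l (r' (l' u))" using y[of "r' (l' u)"] by (simp add: c')
    show "r (l' (r' u)) = l' (r' (l u))" using y[of "l' (r' u)", symmetric] by (simp add: c')
    show "r' (l' (r' u)) = l' (r' (l' u))" using y[of "r' (l' (r' u))"] by (metis c')
  qed
  note s' = s[unfolded l_def l'_def r_def r'_def]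
  show ?thesis
    using assms unfolding r3_kinds_def
    apply (elim disjE conjE; hypsubst?)
        apply (rule yB)
       apply (rule m3)
      apply (rule mk)
     apply (rule m2)
    apply (cases kAB; cases kAC; cases kBC; simp only: simp_thms pair_kind.distinct yS s')
    done
qed

text \<open>The Yang-Baxter equation for relations instead of maps: the two triangles admit the same
  six boundary colors. No end is singled out as input, so reversing a strand only permutes
  arguments.\<close>

definition YB3 :: "('a \<Rightarrow> 'a \<Rightarrow> 'a \<Rightarrow> 'a \<Rightarrow> bool) \<Rightarrow> ('a \<Rightarrow> 'a \<Rightarrow> 'a \<Rightarrow> 'a \<Rightarrow> bool)
    \<Rightarrow> ('a \<Rightarrow> 'a \<Rightarrow> 'a \<Rightarrow> 'a \<Rightarrow> bool) \<Rightarrow> bool" where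
  "YB3 rAB rAC rBC \<longleftrightarrow> (\<forall>p0 p1 p2 p3 p4 p5.
     (\<exists>eA eB eC. rAB eA eB p3 p4 \<and> rAC p0 eC eA p5 \<and> rBC p1 p2 eB eC) \<longleftrightarrow>
     (\<exists>fA fB fC. rAB p0 p1 fA fB \<and> rAC fA p2 p3 fC \<and> rBC fB fC p4 p5))"

lemma YB3_downward:
  assumes "r3_kinds kAB kAC kBC"
  shows "YB3 (xrel S \<beta> kAB True True) (xrel S \<beta> kAC True True) (xrel S \<beta> kBC True True)"
  unfolding YB3_def
proof (intro allI)
  fix p0 p1 p2 p3 p4 p5
  \<comment> \<open>From left to right the strands enter in the order A, B, C and leave in the order
    C, B, A, hence the reversed triple.\<close>
  have "(\<exists>eA eB eC. xrel S \<beta> kAB True True eA eB p3 p4 \<and> xrel S \<beta> kAC True True p0 eC eA p5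
            \<and> xrel S \<beta> kBC True True p1 p2 eB eC)
        \<longleftrightarrow> on_right (cm kAB) (on_left (cm kAC) (on_right (cm kBC) (p0, p1, p2))) = (p5, p4, p3)"
    by (auto simp: xrel_def on_left_def on_right_def prod_eq_iff split_beta)
  moreover have "(\<exists>fA fB fC. xrel S \<beta> kAB True True p0 p1 fA fB \<and> xrel S \<beta> kAC True True fA p2 p3 fC
            \<and> xrel S \<beta> kBC True True fB fC p4 p5)
        \<longleftrightarrow> on_left (cm kBC) (on_right (cm kAC) (on_left (cm kAB) (p0, p1, p2))) = (p5, p4, p3)"
    by (auto simp: xrel_def on_left_def on_right_def prod_eq_iff split_beta)
  ultimately show "(\<exists>eA eB eC. xrel S \<beta> kAB True True eA eB p3 p4 \<and> xrel S \<beta> kAC True True p0 eC eA p5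
            \<and> xrel S \<beta> kBC True True p1 p2 eB eC) \<longleftrightarrow>
     (\<exists>fA fB fC. xrel S \<beta> kAB True True p0 p1 fA fB \<and> xrel S \<beta> kAC True True fA p2 p3 fC
            \<and> xrel S \<beta> kBC True True fB fC p4 p5)"
    by (simp only: braid_relation[OF assms])
qed

text \<open>Reversing an outer strand: apply the relation to the configuration in which the reversed
  strand is slid across the crossing of the other two, whose colors are recovered by bijectivity.\<close>
lemma YB3_reverse_A:
  assumes "YB3 rAB rAC rBC" and "rBC = xrel S \<beta> k d d'"
  shows "YB3 (\<lambda>x y x' y'. rAB x y' x' y) (\<lambda>x y x' y'. rAC x y' x' y) rBC"
proof -
  note b = xrel_bijective[of k d d', folded assms(2)]
  note y = assms(1)[unfolded YB3_def, rule_format]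
  show ?thesis
    unfolding YB3_def
  proof (intro allI iffI; elim exE conjE)
    fix p0 p1 p2 p3 p4 p5 eA eB eC
    assume e: "rAB eA p4 p3 eB" "rAC p0 p5 eA eC" "rBC p1 p2 eB eC"
    obtain u v where uv: "rBC u v p4 p5" using b(2) by blast
    \<comment> \<open>The positional arguments of \<open>y\<close> stand for \<open>p3\<close>,
      \<open>p4\<close>, \<open>p0\<close>, \<open>p5\<close>, \<open>p1\<close>, \<open>p2\<close>
      in this order. For B and C, inner colors of the given triangle serve as boundary colors and
      vice versa.\<close>
    obtain fA fB fC where f: "rAB p0 u fA fB" "rAC fA v p3 fC" "rBC fB fC eB eC"
      using y[of p3 eB p0 eC u v] e uv by blast
    then have "fB = p1 \<and> fC = p2" using b(4) e(3) by blast
    then show "\<exists>fA fB fC. rAB p0 fB fA p1 \<and> rAC fA fC p3 p2 \<and> rBC fB fC p4 p5"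
      using f uv by blast
  next
    fix p0 p1 p2 p3 p4 p5 fA fB fC
    assume f: "rAB p0 fB fA p1" "rAC fA fC p3 p2" "rBC fB fC p4 p5"
    obtain u v where uv: "rBC p1 p2 u v" using b(1) by blast
    obtain eA eB eC where e: "rAB eA eB p3 u" "rAC p0 eC eA v" "rBC fB fC eB eC"
      using y[of p3 u p0 v fB fC] f uv by blast
    then have "eB = p4 \<and> eC = p5" using b(3) f(3) by blast
    then show "\<exists>eA eB eC. rAB eA p4 p3 eB \<and> rAC p0 p5 eA eC \<and> rBC p1 p2 eB eC"
      using e uv by blast
  qed
qed

lemma YB3_reverse_C:
  assumes "YB3 rAB rAC rBC" and "rAB = xrel S \<beta> k d d'"
  shows "YB3 rAB (\<lambda>x y x' y'. rAC x' y x y') (\<lambda>x y x' y'. rBC x' y x y')"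
proof -
  note b = xrel_bijective[of k d d', folded assms(2)]
  note y = assms(1)[unfolded YB3_def, rule_format]
  show ?thesis
    unfolding YB3_def
  proof (intro allI iffI; elim exE conjE)
    fix p0 p1 p2 p3 p4 p5 eA eB eC
    assume e: "rAB eA eB p3 p4" "rAC eA eC p0 p5" "rBC eB p2 p1 eC"
    obtain u v where uv: "rAB p0 p1 u v" using b(1) by blast
    obtain fA fB fC where f: "rAB eA eB fA fB" "rAC fA p2 u fC" "rBC fB fC v p5"
      using y[of u v eA p5 eB p2] e uv by blast
    then have "fA = p3 \<and> fB = p4" using b(3) e(1) by blast
    then show "\<exists>fA fB fC. rAB p0 p1 fA fB \<and> rAC p3 p2 fA fC \<and> rBC p4 fC fB p5"
      using f uv by blast
  next
    fix p0 p1 p2 p3 p4 p5 fA fB fC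
    assume f: "rAB p0 p1 fA fB" "rAC p3 p2 fA fC" "rBC p4 fC fB p5"
    obtain u v where uv: "rAB u v p3 p4" using b(2) by blast
    obtain eA eB eC where e: "rAB eA eB fA fB" "rAC u eC eA p5" "rBC v p2 eB eC"
      using y[of fA fB u p5 v p2] f uv by blast
    then have "eA = p0 \<and> eB = p1" using b(4) f(1) by blast
    then show "\<exists>eA eB eC. rAB eA eB p3 p4 \<and> rAC eA eC p0 p5 \<and> rBC eB p2 p1 eC"
      using e uv by blast
  qed
qed

text \<open>A half-turn of the disc interchanges the two triangles and reverses the direction in
  which each strand is read.\<close>

lemma YB3_reverse_all:
  "YB3 rAB rAC rBC \<Longrightarrow>
   YB3 (\<lambda>x y x' y'. rAB x' y' x y) (\<lambda>x y x' y'. rAC x' y' x y) (\<lambda>x y x' y'. rBC x' y' x y)"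
  unfolding YB3_def by meson

lemma xrel_reverse_first: "xrel S \<beta> k (\<not> dP) dQ = (\<lambda>x y x' y'. xrel S \<beta> k dP dQ x y' x' y)"
  and xrel_reverse_second: "xrel S \<beta> k dP (\<not> dQ) = (\<lambda>x y x' y'. xrel S \<beta> k dP dQ x' y x y')"
  by (auto simp: xrel_def fun_eq_iff)

lemma xrel_R3:
  assumes "r3_kinds kAB kAC kBC"
  shows "YB3 (xrel S \<beta> kAB dA dB) (xrel S \<beta> kAC dA dC) (xrel S \<beta> kBC dB dC)"
proof -
  have 1: "YB3 (xrel S \<beta> kAB dA True) (xrel S \<beta> kAC dA True) (xrel S \<beta> kBC True True)" for dA
    using YB3_downward[OF assms] YB3_reverse_A[OF YB3_downward[OF assms] refl]
      xrel_reverse_first[where dP = True] by (cases dA) simp_all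
  have 2: "YB3 (xrel S \<beta> kAB dA True) (xrel S \<beta> kAC dA dC) (xrel S \<beta> kBC True dC)" for dA dC
    using 1[of dA] YB3_reverse_C[OF 1[of dA] refl] xrel_reverse_second[where dQ = True]
    by (cases dC) simp_all
  \<comment> \<open>The middle strand B is turned by reversing all three strands in the case where A
    and C have been reversed before.\<close>
  have "YB3 (xrel S \<beta> kAB dA False) (xrel S \<beta> kAC dA dC) (xrel S \<beta> kBC False dC)"
    using YB3_reverse_all[OF 2[of "\<not> dA" "\<not> dC"]]
    by (cases dA; cases dC) (simp_all add: xrel_def[abs_def])
  with 2[of dA dC] show ?thesis by (cases dB) simp_all
qed

end

section \<open>The decorated virtual pair\<close>

text \<open>Right multiplication on the carrier, extended by the identity to a permutation of the
  whole type; a type carrying a group structure is not available.\<close>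
definition rmul :: "('h, 'm) monoid_scheme \<Rightarrow> 'h \<Rightarrow> 'h \<Rightarrow> 'h" where
  "rmul H w h = (if h \<in> carrier H then h \<otimes>\<^bsub>H\<^esub> w else h)"

text \<open>Colors decorated with the product of the weights collected so far.\<close>
definition lift :: "('h, 'm) monoid_scheme \<Rightarrow> ('a \<times> 'a \<Rightarrow> 'a \<times> 'a) \<Rightarrow> ('a \<times> 'a \<Rightarrow> 'h) \<Rightarrow> ('a \<times> 'a \<Rightarrow> 'h)
    \<Rightarrow> ('a \<times> 'h) \<times> ('a \<times> 'h) \<Rightarrow> ('a \<times> 'h) \<times> ('a \<times> 'h)" where
  "lift H \<sigma> u v p = (case p of ((x, h), (y, k)) \<Rightarrow>
     ((S1 \<sigma> x y, rmul H (v (x, y)) k), (S2 \<sigma> x y, rmul H (u (x, y)) h)))"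

context group
begin

lemma rmul_one [simp]: "rmul G \<one> h = h"
  by (simp add: rmul_def)

lemma rmul_rmul: "a \<in> carrier G \<Longrightarrow> b \<in> carrier G \<Longrightarrow> rmul G b (rmul G a h) = rmul G (a \<otimes> b) h"
  by (simp add: rmul_def m_assoc)

lemma rmul_inverse [simp]:
  "a \<in> carrier G \<Longrightarrow> rmul G a (rmul G (inv a) h) = h"
  "a \<in> carrier G \<Longrightarrow> rmul G (inv a) (rmul G a h) = h"
  by (simp_all add: rmul_rmul)

lemma rmul_in_carrier [simp]: "a \<in> carrier G \<Longrightarrow> rmul G a h \<in> carrier G \<longleftrightarrow> h \<in> carrier G"
  by (simp add: rmul_def)

lemma rmul_carrier: "h \<in> carrier G \<Longrightarrow> rmul G a h = h \<otimes> a"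
  by (simp add: rmul_def)

lemma rmul_cancel [simp]: "a \<in> carrier G \<Longrightarrow> rmul G a h = rmul G a k \<longleftrightarrow> h = k"
  by (metis rmul_inverse(2))

lemma lift_apply [simp]:
  "lift G \<sigma> u v ((x, h), (y, k)) =
     ((S1 \<sigma> x y, rmul G (v (x, y)) k), (S2 \<sigma> x y, rmul G (u (x, y)) h))"
  by (simp add: lift_def)

lemma S1_lift [simp]: "S1 (lift G \<sigma> u v) (x, h) (y, k) = (S1 \<sigma> x y, rmul G (v (x, y)) k)"
  and S2_lift [simp]: "S2 (lift G \<sigma> u v) (x, h) (y, k) = (S2 \<sigma> x y, rmul G (u (x, y)) h)"
  by (simp_all add: S1_def S2_def lift_def)

text \<open>Right multiplication by a fixed element is a permutation, so bijectivity and the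
  solvability conditions lift for arbitrary weights in the carrier. Trivial weights at fixed points
  make a decorated pair fixed iff the colors are fixed and both decorations agree. Only the
  Yang-Baxter equation needs the cocycle identities, hence it enters as a hypothesis.\<close>

lemma biquandle_lift:
  fixes \<sigma> :: "'c \<times> 'c \<Rightarrow> 'c \<times> 'c"
  assumes bq: "biquandle \<sigma>" and u: "\<And>p. u p \<in> carrier G" and v: "\<And>p. v p \<in> carrier G"
    and fix1: "\<And>x. u (x, s_map \<sigma> x) = \<one>" "\<And>x. v (x, s_map \<sigma> x) = \<one>"
    and yb: "on_right (lift G \<sigma> u v) \<circ> on_left (lift G \<sigma> u v) \<circ> on_right (lift G \<sigma> u v)
      = on_left (lift G \<sigma> u v) \<circ> on_right (lift G \<sigma> u v) \<circ> on_left (lift G \<sigma> u v)"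
  shows "biquandle (lift G \<sigma> u v)"
proof -
  let ?L = "lift G \<sigma> u v"
  have bij: "bij \<sigma>" and u1: "\<And>x z. \<exists>!y. S1 \<sigma> x y = z" and u2: "\<And>y t. \<exists>!x. S2 \<sigma> x y = t"
    using bq by (auto simp: biquandle_def YB_solution_def)
  have pair: "\<sigma> (x, y) = (S1 \<sigma> x y, S2 \<sigma> x y)" for x y by (simp add: S1_def S2_def)
  have "bij ?L"
  proof (rule bijI)
    show "inj ?L"
    proof (rule injI)
      fix p p' assume L: "?L p = ?L p'"
      obtain x h y k x' h' y' k' where p: "p = ((x, h), y, k)" "p' = ((x', h'), y', k')"
        by (metis surj_pair)
      note e = L[unfolded p]
      have "\<sigma> (x, y) = \<sigma> (x', y')" using e by (simp add: pair)
      then have "(x, y) = (x', y')" using bij by (simp only: bij_def inj_eq)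
      then show "p = p'" using e u v by (simp add: p)
    qed
    show "surj ?L"
      unfolding surj_def
    proof
      fix q :: "('c \<times> 'a) \<times> 'c \<times> 'a"
      obtain a h b k where q: "q = ((a, h), b, k)" by (metis surj_pair)
      obtain x y where xy: "\<sigma> (x, y) = (a, b)" using bij by (metis bij_pointE surj_pair)
      have "q = ?L ((x, rmul G (inv (u (x, y))) k), (y, rmul G (inv (v (x, y))) h))"
        using xy u v by (simp add: q pair)
      then show "\<exists>p. q = ?L p" by blast
    qed
  qed
  moreover have "\<exists>!q. S1 ?L p q = r" for p r
  proof -
    obtain x h z m where pr: "p = (x, h)" "r = (z, m)" by (metis surj_pair)
    obtain y where y: "S1 \<sigma> x y = z" and uniq: "\<And>y'. S1 \<sigma> x y' = z \<Longrightarrow> y' = y" using u1 by metis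
    show ?thesis
    proof (rule ex1I[of _ "(y, rmul G (inv (v (x, y))) m)"])
      fix q assume q: "S1 ?L p q = r"
      obtain y' k where q': "q = (y', k)" by (metis surj_pair)
      then have "y' = y" using q uniq by (simp add: pr)
      with q show "q = (y, rmul G (inv (v (x, y))) m)" by (auto simp: pr q' v)
    qed (simp add: pr y v)
  qed
  moreover have "\<exists>!p. S2 ?L p q = r" for q r
  proof -
    obtain y k t m where pr: "q = (y, k)" "r = (t, m)" by (metis surj_pair)
    obtain x where x: "S2 \<sigma> x y = t" and uniq: "\<And>x'. S2 \<sigma> x' y = t \<Longrightarrow> x' = x" using u2 by metis
    show ?thesis
    proof (rule ex1I[of _ "(x, rmul G (inv (u (x, y))) m)"])
      fix p assume p: "S2 ?L p q = r"
      obtain x' h where p': "p = (x', h)" by (metis surj_pair)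
      then have "x' = x" using p uniq by (simp add: pr)
      with p show "p = (x, rmul G (inv (u (x, y))) m)" by (auto simp: pr p' u)
    qed (simp add: pr x u)
  qed
  moreover have "is_fix_map ?L (\<lambda>(x, h). (s_map \<sigma> x, h))"
  proof -
    have bs: "bij (s_map \<sigma>)" by (rule bij_s_map[OF bq])
    have "bij (\<lambda>(x, h :: 'a). (s_map \<sigma> x, h))"
      using bs unfolding bij_def inj_def surj_def by auto
    moreover have "?L ((x, h), (y, k)) = ((x, h), (y, k)) \<longleftrightarrow> y = s_map \<sigma> x \<and> k = h" for x h y k
      using biquandle_fixed_iff[OF bq, of x y] by (auto simp: pair fix1)
    ultimately show ?thesis unfolding is_fix_map_def by fastforce
  qed
  ultimately show ?thesis
    using yb unfolding biquandle_def YB_solution_def by blast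
qed

end

locale cocycle = vpair S \<beta> + group H
  for S \<beta> :: "'a \<times> 'a \<Rightarrow> 'a \<times> 'a" and H :: "('h, 'm) monoid_scheme" (structure) +
  fixes f g :: "'a \<times> 'a \<Rightarrow> 'h"
  assumes cocycle: "nc_cocycle_pair H S \<beta> f g"
begin

lemmas f_closed [simp] = cocycle[unfolded nc_cocycle_pair_def, THEN conjunct1, rule_format]
lemmas g_closed [simp] = cocycle[unfolded nc_cocycle_pair_def, THEN conjunct2, THEN conjunct1, rule_format]

lemmas cocycle_eqs = cocycle[unfolded nc_cocycle_pair_def, THEN conjunct2, THEN conjunct2]
lemmas f_assoc = cocycle_eqs[THEN conjunct1, rule_format]
lemmas f_shift = cocycle_eqs[THEN conjunct2, THEN conjunct1, rule_format]
lemmas f_fixed = cocycle_eqs[THEN conjunct2, THEN conjunct2, THEN conjunct1, rule_format]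
lemmas g_fixed = cocycle_eqs[THEN conjunct2, THEN conjunct2, THEN conjunct2, THEN conjunct1, rule_format]
lemmas g_invol = cocycle_eqs[THEN conjunct2, THEN conjunct2, THEN conjunct2, THEN conjunct2, THEN conjunct1, rule_format]
lemmas g3 = cocycle_eqs[THEN conjunct2, THEN conjunct2, THEN conjunct2, THEN conjunct2, THEN conjunct2, THEN conjunct1, rule_format]
lemmas g4 = cocycle_eqs[THEN conjunct2, THEN conjunct2, THEN conjunct2, THEN conjunct2, THEN conjunct2, THEN conjunct2, THEN conjunct1, rule_format]
lemmas g5 = cocycle_eqs[THEN conjunct2, THEN conjunct2, THEN conjunct2, THEN conjunct2, THEN conjunct2, THEN conjunct2, THEN conjunct2, THEN conjunct1, rule_format]
text \<open>Turned around so that rewriting simplifies the arguments of \<open>g\<close>.\<close>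

lemmas m1 = cocycle_eqs[THEN conjunct2, THEN conjunct2, THEN conjunct2, THEN conjunct2, THEN conjunct2, THEN conjunct2, THEN conjunct2, THEN conjunct2, THEN conjunct1, rule_format, symmetric]
lemmas m2 = cocycle_eqs[THEN conjunct2, THEN conjunct2, THEN conjunct2, THEN conjunct2, THEN conjunct2, THEN conjunct2, THEN conjunct2, THEN conjunct2, THEN conjunct2, THEN conjunct1, rule_format]
lemmas m3 = cocycle_eqs[THEN conjunct2, THEN conjunct2, THEN conjunct2, THEN conjunct2, THEN conjunct2, THEN conjunct2, THEN conjunct2, THEN conjunct2, THEN conjunct2, THEN conjunct2, rule_format]

abbreviation Sl where "Sl \<equiv> lift H S f (\<lambda>_. \<one>)"
abbreviation \<beta>l where "\<beta>l \<equiv> lift H \<beta> g g"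

lemma \<beta>l_invol: "\<beta>l \<circ> \<beta>l = id"
proof (rule ext, clarify)
  fix x h y k
  have "\<beta> (S1 \<beta> x y, S2 \<beta> x y) = (x, y)"
    using \<beta>_invol[of "(x, y)"] by (simp add: S1_def S2_def)
  then have "S1 \<beta> (S1 \<beta> x y) (S2 \<beta> x y) = x" "S2 \<beta> (S1 \<beta> x y) (S2 \<beta> x y) = y"
    by (simp_all add: S1_def S2_def)
  moreover have "g (x, y) \<otimes> g (S1 \<beta> x y, S2 \<beta> x y) = \<one>"
    using g_invol[of x y] by (simp add: S1_def S2_def)
  ultimately show "(\<beta>l \<circ> \<beta>l) ((x, h), y, k) = id ((x, h), y, k)"
    by (simp add: rmul_rmul)
qed

text \<open>The decorations are compared strand by strand: the leftmost strand passes under both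
  others, which is \<open>f_assoc\<close>; the middle one passes under the third only, which is
  \<open>f_shift\<close>; the rightmost one collects nothing.\<close>

lemma yang_baxter_lift_S: "on_right Sl \<circ> on_left Sl \<circ> on_right Sl = on_left Sl \<circ> on_right Sl \<circ> on_left Sl"
proof (rule ext, clarify)
  fix x h y k z m
  have "on_right S (on_left S (on_right S (x, y, z))) = on_left S (on_right S (on_left S (x, y, z)))"
    using bq_S by (auto simp: biquandle_def YB_solution_def dest: fun_cong[of _ _ "(x, y, z)"])
  then show "(on_right Sl \<circ> on_left Sl \<circ> on_right Sl) ((x, h), (y, k), z, m)
      = (on_left Sl \<circ> on_right Sl \<circ> on_left Sl) ((x, h), (y, k), z, m)"
    by (simp add: rmul_rmul f_assoc[of x y z] f_shift)
qed

text \<open>At a virtual crossing both strands collect a weight, so there is one identity per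
  strand: \<open>g3\<close> for the left, \<open>g4\<close> for the middle and \<open>g5\<close> for
  the right one.\<close>

lemma yang_baxter_lift_\<beta>: "on_right \<beta>l \<circ> on_left \<beta>l \<circ> on_right \<beta>l = on_left \<beta>l \<circ> on_right \<beta>l \<circ> on_left \<beta>l"
proof (rule ext, clarify)
  fix x h y k z m
  have "on_right \<beta> (on_left \<beta> (on_right \<beta> (x, y, z))) = on_left \<beta> (on_right \<beta> (on_left \<beta> (x, y, z)))"
    using bq_\<beta> by (auto simp: biquandle_def YB_solution_def dest: fun_cong[of _ _ "(x, y, z)"])
  then show "(on_right \<beta>l \<circ> on_left \<beta>l \<circ> on_right \<beta>l) ((x, h), (y, k), z, m)
      = (on_left \<beta>l \<circ> on_right \<beta>l \<circ> on_left \<beta>l) ((x, h), (y, k), z, m)"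
    by (simp add: rmul_rmul g3[of x y z] g4[of y z x] g5[of y z x])
qed

text \<open>The conditions (m1)-(m3) describe the mixed move in which the classical crossing lies
  between the first two strands.\<close>
lemma mixed_lift:
  "on_right \<beta>l \<circ> on_left Sl \<circ> on_right \<beta>l = on_left \<beta>l \<circ> on_right Sl \<circ> on_left \<beta>l"
proof -
  have *: "on_right Sl (on_left \<beta>l (on_right \<beta>l t)) = on_left \<beta>l (on_right \<beta>l (on_left Sl t))" for t
  proof (cases t)
    case (fields p q r)
    obtain x h y k z m where t: "t = ((x, h), (y, k), z, m)" using fields by (metis surj_pair)
    \<comment> \<open>This settles the undecorated colors; \<open>m3\<close>, \<open>m1\<close> and
      \<open>m2\<close> then compare the weights of the first, second and third strand.\<close>
    have "r3_kinds SecondOver PVirt PVirt" by (simp add: r3_kinds_def)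
    from braid_relation[OF this, of "(x, y, z)"] show ?thesis
      by (simp add: t rmul_rmul m1 m2[of y z x] m3[of x y z])
  qed
  have L: "on_left \<beta>l (on_left \<beta>l t) = t" and R: "on_right \<beta>l (on_right \<beta>l t) = t" for t
    by (simp_all only: on_left_comp on_right_comp \<beta>l_invol on_left_id on_right_id)
  show ?thesis
  proof
    fix t
    \<comment> \<open>Composing \<open>*\<close> with one virtual crossing before and one after
      moves the classical crossing to the outer pair of strands.\<close>
    show "(on_right \<beta>l \<circ> on_left Sl \<circ> on_right \<beta>l) t = (on_left \<beta>l \<circ> on_right Sl \<circ> on_left \<beta>l) t"
      using *[of "on_right \<beta>l t"] by (metis L R comp_apply)
  qed
qed

lemma virtual_pair_lift: "virtual_pair Sl \<beta>l"
  unfolding virtual_pair_def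
  using biquandle_lift[OF bq_S _ _ f_fixed _ yang_baxter_lift_S]
    biquandle_lift[OF bq_\<beta> _ _ g_fixed g_fixed yang_baxter_lift_\<beta>] \<beta>l_invol mixed_lift
  by simp

sublocale lifted: vpair Sl \<beta>l
  by unfold_locales (rule virtual_pair_lift)

end

section \<open>Products along strands\<close>

lemma passes_in_out: "passes v e e' \<Longrightarrow> e \<in> set (ins v) \<and> e' \<in> set (outs v)"
  by (cases v) auto

lemma edges_ins: "v \<in> D \<Longrightarrow> e \<in> set (ins v) \<Longrightarrow> e \<in> edges D"
  and edges_outs: "v \<in> D \<Longrightarrow> e \<in> set (outs v) \<Longrightarrow> e \<in> edges D"
  by (auto simp: edges_def)

lemma edges_Un: "edges (A \<union> B) = edges A \<union> edges B"
  and edges_insert: "edges (insert v A) = set (ins v) \<union> set (outs v) \<union> edges A"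
  and edges_empty: "edges {} = {}"
  by (auto simp: edges_def)

lemma in_has_out: "e \<in> set (ins v) \<Longrightarrow> \<exists>e'. passes v e e'"
  by (cases v) auto

lemma sum_count_le_1D:
  assumes "finite D" "(\<Sum>v\<in>D. count_list (l v) e) = 1" "v \<in> D" "w \<in> D" "e \<in> set (l v)" "e \<in> set (l w)"
  shows "v = w" and "count_list (l v) e = 1"
proof -
  have pos: "count_list (l u) e \<ge> 1" if "e \<in> set (l u)" for u
    using that by (metis One_nat_def Suc_leI count_list_0_iff gr0I)
  show "v = w"
  proof (rule ccontr)
    assume "v \<noteq> w"
    then have "(\<Sum>u\<in>{v, w}. count_list (l u) e) \<ge> 2" using pos[OF assms(5)] pos[OF assms(6)] by simp
    moreover have "(\<Sum>u\<in>{v, w}. count_list (l u) e) \<le> (\<Sum>u\<in>D. count_list (l u) e)"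
      by (rule sum_mono2) (use assms in auto)
    ultimately show False using assms(2) by linarith
  qed
  have "count_list (l v) e \<le> (\<Sum>u\<in>D. count_list (l u) e)"
    using assms by (intro member_le_sum) auto
  then show "count_list (l v) e = 1" using pos[OF assms(5)] assms(2) by linarith
qed

lemma wf_finite: "wf_diagram D \<Longrightarrow> finite D"
  by (simp add: wf_diagram_def)

lemma finite_edges: "wf_diagram D \<Longrightarrow> finite (edges D)"
  by (auto simp: edges_def wf_diagram_def)

lemma wf_in_unique:
  assumes "wf_diagram D" "v \<in> D" "w \<in> D" "e \<in> set (ins v)" "e \<in> set (ins w)"
  shows "v = w"
  using sum_count_le_1D(1)[of D ins e v w] assms edges_ins[OF assms(2,4)]
  by (auto simp: wf_diagram_def)

lemma wf_out_unique:
  assumes "wf_diagram D" "v \<in> D" "w \<in> D" "e \<in> set (outs v)" "e \<in> set (outs w)"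
  shows "v = w"
  using sum_count_le_1D(1)[of D outs e v w] assms edges_outs[OF assms(2,4)]
  by (auto simp: wf_diagram_def)

lemma wf_crossing_distinct:
  assumes "wf_diagram D" "Cr k a b c d \<in> D"
  shows "a \<noteq> b" and "c \<noteq> d"
proof -
  have "a \<in> edges D" "c \<in> edges D" using edges_ins[OF assms(2), of a] edges_outs[OF assms(2), of c] by auto
  then have "count_list (ins (Cr k a b c d)) a = 1" "count_list (outs (Cr k a b c d)) c = 1"
    using sum_count_le_1D(2)[of D ins a "Cr k a b c d" "Cr k a b c d"]
      sum_count_le_1D(2)[of D outs c "Cr k a b c d" "Cr k a b c d"] assms
    by (auto simp: wf_diagram_def)
  then show "a \<noteq> b" "c \<noteq> d" by auto
qed

lemma wf_ex_in:
  assumes "wf_diagram D" "e \<in> edges D"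
  obtains v where "v \<in> D" "e \<in> set (ins v)"
proof -
  have "(\<Sum>v\<in>D. count_list (ins v) e) = 1" using assms by (simp add: wf_diagram_def)
  then have "\<exists>v\<in>D. count_list (ins v) e \<noteq> 0" by (metis sum.neutral zero_neq_one)
  then show ?thesis using that by (metis count_list_0_iff)
qed

lemma wf_ex_out:
  assumes "wf_diagram D" "e \<in> edges D"
  obtains v where "v \<in> D" "e \<in> set (outs v)"
proof -
  have "(\<Sum>v\<in>D. count_list (outs v) e) = 1" using assms by (simp add: wf_diagram_def)
  then have "\<exists>v\<in>D. count_list (outs v) e \<noteq> 0" by (metis sum.neutral zero_neq_one)
  then show ?thesis using that by (metis count_list_0_iff)
qed

lemma wf_passes_unique:
  assumes "wf_diagram D" "v \<in> D" "w \<in> D" "passes v e m" "passes w e m'"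
  shows "w = v \<and> m' = m"
proof -
  have "w = v" using wf_in_unique assms passes_in_out by metis
  moreover have "m' = m"
  proof (cases v)
    case (Cr k a b c d)
    then show ?thesis using assms wf_crossing_distinct[of D k a b c d] \<open>w = v\<close> by auto
  qed (use assms \<open>w = v\<close> in auto)
  ultimately show ?thesis by simp
qed

lemma wf_passes_unique_source:
  assumes "wf_diagram D" "v \<in> D" "w \<in> D" "passes v e m" "passes w e' m"
  shows "e' = e"
proof -
  have "w = v" using wf_out_unique assms passes_in_out by metis
  show ?thesis
  proof (cases v)
    case (Cr k a b c d)
    then show ?thesis using assms wf_crossing_distinct[of D k a b c d] \<open>w = v\<close> by auto
  qed (use assms \<open>w = v\<close> in auto)
qed

lemma wf_ex_passes:
  assumes "wf_diagram D" "e \<in> edges D"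
  obtains v m where "v \<in> D" "passes v e m"
  using wf_ex_in[OF assms] in_has_out by metis

lemma nxt_eq: "wf_diagram D \<Longrightarrow> v \<in> D \<Longrightarrow> passes v e m \<Longrightarrow> nxt D e = m"
  unfolding nxt_def by (rule the_equality) (blast dest: wf_passes_unique)+

lemma nxt_in_edges: "wf_diagram D \<Longrightarrow> e \<in> edges D \<Longrightarrow> nxt D e \<in> edges D"
  by (metis nxt_eq wf_ex_passes passes_in_out edges_outs)

lemma nxt_funpow_in_edges: "wf_diagram D \<Longrightarrow> e \<in> edges D \<Longrightarrow> (nxt D ^^ n) e \<in> edges D"
  by (induction n) (auto simp: nxt_in_edges)

lemma inj_on_nxt: "wf_diagram D \<Longrightarrow> inj_on (nxt D) (edges D)"
  by (rule inj_onI) (metis wf_ex_passes nxt_eq wf_passes_unique_source)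

lemma nxt_funpow_cancel:
  assumes "wf_diagram D" "e \<in> edges D" "e' \<in> edges D" "(nxt D ^^ n) e = (nxt D ^^ n) e'"
  shows "e = e'"
  using assms(4)
proof (induction n)
  case (Suc n)
  then show ?case
    using inj_on_nxt[OF assms(1)] nxt_funpow_in_edges[OF assms(1)] assms(2,3)
    by (simp add: inj_on_eq_iff)
qed simp

text \<open>Two iterates coincide because there are finitely many labels, and injectivity of
  \<open>nxt\<close> lets the common initial steps be cancelled.\<close>

lemma ex_period:
  assumes "wf_diagram D" "e \<in> edges D"
  shows "\<exists>n>0. (nxt D ^^ n) e = e"
proof -
  have "\<not> inj (\<lambda>n. (nxt D ^^ n) e)"
  proof
    assume "inj (\<lambda>n. (nxt D ^^ n) e)"
    moreover have "range (\<lambda>n. (nxt D ^^ n) e) \<subseteq> edges D"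
      using nxt_funpow_in_edges[OF assms] by auto
    ultimately show False
      using finite_edges[OF assms(1)] by (meson finite_subset infinite_UNIV_nat finite_imageD)
  qed
  then obtain i j where ij: "i < j" "(nxt D ^^ i) e = (nxt D ^^ j) e"
    unfolding inj_def by (metis linorder_neqE_nat)
  then have "(nxt D ^^ i) ((nxt D ^^ (j - i)) e) = (nxt D ^^ i) e"
    by (simp add: funpow_add[symmetric, THEN fun_cong, unfolded comp_def])
  then have "(nxt D ^^ (j - i)) e = e"
    using nxt_funpow_cancel assms nxt_funpow_in_edges by blast
  then show ?thesis using ij(1) by (intro exI[of _ "j - i"]) simp
qed

lemma period_pos: "wf_diagram D \<Longrightarrow> e \<in> edges D \<Longrightarrow> 0 < period D e"
  and nxt_funpow_period: "wf_diagram D \<Longrightarrow> e \<in> edges D \<Longrightarrow> (nxt D ^^ period D e) e = e"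
  unfolding period_def by (metis (mono_tags, lifting) LeastI_ex ex_period)+

lemma nxt_funpow_less_period: "0 < n \<Longrightarrow> n < period D e \<Longrightarrow> (nxt D ^^ n) e \<noteq> e"
  unfolding period_def by (metis (mono_tags, lifting) not_less_Least)

lemma period_nxt:
  assumes "wf_diagram D" "e \<in> edges D"
  shows "period D (nxt D e) = period D e"
proof -
  have "(nxt D ^^ n) (nxt D e) = nxt D e \<longleftrightarrow> (nxt D ^^ n) e = e" for n
  proof -
    have "(nxt D ^^ n) (nxt D e) = nxt D ((nxt D ^^ n) e)" by (simp add: funpow_swap1)
    then show ?thesis
      using inj_on_nxt[OF assms(1)] assms nxt_funpow_in_edges[OF assms] by (simp add: inj_on_eq_iff)
  qed
  then show ?thesis by (simp add: period_def)
qed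

lemma arc_weight_eq:
  assumes "wf_diagram D" "v \<in> D" "passes v e m"
  shows "arc_weight H f g D C e = vert_weight H f g C v e"
proof -
  have "(THE v. v \<in> D \<and> e \<in> set (ins v)) = v"
    by (rule the_equality) (use assms passes_in_out wf_in_unique in blast)+
  then show ?thesis by (simp add: arc_weight_def)
qed

lemma vert_weight_cong:
  assumes "\<And>e. e \<in> set (ins v) \<union> set (outs v) \<Longrightarrow> C' e = C e"
  shows "vert_weight H f g C' v = vert_weight H f g C v"
proof (cases v)
  case (Cr k a b c d)
  then show ?thesis using assms by (cases k) (auto simp: fun_eq_iff)
qed (auto simp: fun_eq_iff)

lemma vert_colored_cong:
  assumes "\<And>e. e \<in> set (ins v) \<union> set (outs v) \<Longrightarrow> C' e = C e"
  shows "vert_colored S \<beta> C' v \<longleftrightarrow> vert_colored S \<beta> C v"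
proof (cases v)
  case (Cr k a b c d)
  then show ?thesis using assms by (cases k) auto
qed (use assms in auto)

section \<open>Conjugacy classes and change of base point\<close>

context group
begin

lemma conj_class_commute:
  assumes "a \<in> carrier G" "b \<in> carrier G"
  shows "conj_class G (a \<otimes> b) = conj_class G (b \<otimes> a)"
proof -
  have sub: "conj_class G (a \<otimes> b) \<subseteq> conj_class G (b \<otimes> a)"
    if ab: "a \<in> carrier G" "b \<in> carrier G" for a b
  proof
    fix x assume "x \<in> conj_class G (a \<otimes> b)"
    then obtain h where h: "h \<in> carrier G" "x = h \<otimes> (a \<otimes> b) \<otimes> inv h"
      by (auto simp: conj_class_def)
    have "x = (h \<otimes> a) \<otimes> (b \<otimes> a) \<otimes> inv (h \<otimes> a)"
      using h ab by (simp add: m_assoc inv_mult_group) (simp add: m_assoc[symmetric])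
    then show "x \<in> conj_class G (b \<otimes> a)"
      using h ab unfolding conj_class_def by blast
  qed
  show ?thesis using sub[OF assms] sub[OF assms(2,1)] by blast
qed

end

context cocycle
begin

abbreviation vw where "vw \<equiv> vert_weight H f g"
abbreviation \<Psi> where "\<Psi> \<equiv> Psi H f g"

lemma vw_closed [simp]: "vw C v e \<in> carrier H"
proof (cases v)
  case (Cr k a b c d)
  then show ?thesis by (cases k) auto
qed auto

lemma arc_weight_closed [simp]: "arc_weight H f g D C e \<in> carrier H"
  by (simp add: arc_weight_def)

lemma foldr_closed: "foldr (\<lambda>k acc. arc_weight H f g D C (p k) \<otimes> acc) ks \<one> \<in> carrier H"
  by (induction ks) auto

lemma foldr_append_mult:
  "foldr (\<lambda>k acc. arc_weight H f g D C (p k) \<otimes> acc) (ks @ ls) \<one>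
   = foldr (\<lambda>k acc. arc_weight H f g D C (p k) \<otimes> acc) ks \<one>
     \<otimes> foldr (\<lambda>k acc. arc_weight H f g D C (p k) \<otimes> acc) ls \<one>"
  by (induction ks) (simp_all add: foldr_closed m_assoc)

text \<open>One step of the base point moves the first factor of the product to the end, and
  conjugation by \<open>a\<close> takes \<open>b \<otimes> a\<close> to
  \<open>a \<otimes> b\<close>.\<close>

lemma conj_class_Psi_nxt:
  assumes "wf_diagram D" "e \<in> edges D"
  shows "conj_class H (\<Psi> D C (nxt D e)) = conj_class H (\<Psi> D C e)"
proof -
  let ?w = "\<lambda>k. arc_weight H f g D C ((nxt D ^^ k) e)"
  let ?F = "\<lambda>ks. foldr (\<lambda>k acc. ?w k \<otimes> acc) ks \<one>"
  define N where "N = period D e"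
  have N: "0 < N" and per: "(nxt D ^^ N) e = e"
    using assms period_pos nxt_funpow_period by (auto simp: N_def)
  have "\<Psi> D C (nxt D e) = foldr (\<lambda>k acc. ?w (Suc k) \<otimes> acc) [0..<N] \<one>"
    using assms by (simp add: Psi_def period_nxt N_def funpow_swap1)
  also have "\<dots> = ?F (map Suc [0..<N])"
    by (simp add: foldr_map comp_def)
  also have "map Suc [0..<N] = [1..<N] @ [N]"
    using N by (simp add: map_Suc_upt upt_Suc_append)
  also have "?F ([1..<N] @ [N]) = ?F [1..<N] \<otimes> ?F [N]"
    by (rule foldr_append_mult)
  also have "?F [N] = ?w 0" using per by simp
  finally have 1: "\<Psi> D C (nxt D e) = ?F [1..<N] \<otimes> ?w 0" .
  have "[0..<N] = 0 # [1..<N]" using N by (simp add: upt_conv_Cons)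
  then have 2: "\<Psi> D C e = ?w 0 \<otimes> ?F [1..<N]"
    by (simp add: Psi_def N_def[symmetric])
  show ?thesis unfolding 1 2 by (intro conj_class_commute foldr_closed arc_weight_closed)
qed

lemma conj_class_Psi_funpow:
  assumes "wf_diagram D" "e \<in> edges D"
  shows "conj_class H (\<Psi> D C ((nxt D ^^ n) e)) = conj_class H (\<Psi> D C e)"
  by (induction n) (use conj_class_Psi_nxt nxt_funpow_in_edges assms in auto)

text \<open>Every semi-arc serves as a base point, so neither components nor choices occur when two
  diagrams are compared. This adds no classes, since moving a base point along its component
  conjugates the product.\<close>

definition Psi_classes :: "diagram \<Rightarrow> 'h set set" where
  "Psi_classes D = {conj_class H (\<Psi> D C e) | C e. e \<in> edges D \<and> C \<in> colorings S \<beta> D}"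

lemma Psi_inv_eq_Psi_classes:
  assumes "wf_diagram D" "base_points D bp"
  shows "Psi_inv H S \<beta> f g D bp = Psi_classes D"
proof -
  have *: "conj_class H (\<Psi> D C (bp (component D e))) = conj_class H (\<Psi> D C e)"
    if e: "e \<in> edges D" for e C
  proof -
    have "bp (component D e) \<in> component D e"
      using assms(2) e by (auto simp: base_points_def components_def)
    then show ?thesis
      using conj_class_Psi_funpow[OF assms(1) e] by (auto simp: component_def)
  qed
  show ?thesis
  proof (intro equalityI subsetI)
    fix x assume "x \<in> Psi_inv H S \<beta> f g D bp"
    then obtain e C where "e \<in> edges D" "C \<in> colorings S \<beta> D"
      "x = conj_class H (\<Psi> D C (bp (component D e)))"
      unfolding Psi_inv_def components_def by blast
    then show "x \<in> Psi_classes D" unfolding Psi_classes_def using * by blast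
  next
    fix x assume "x \<in> Psi_classes D"
    then obtain e C where eC: "e \<in> edges D" "C \<in> colorings S \<beta> D" "x = conj_class H (\<Psi> D C e)"
      unfolding Psi_classes_def by blast
    then have "x = conj_class H (\<Psi> D C (bp (component D e)))" using * by simp
    then show "x \<in> Psi_inv H S \<beta> f g D bp"
      unfolding Psi_inv_def components_def using eC by blast
  qed
qed

text \<open>\<open>first_return D C b n e h\<close>: following the diagram from \<open>e\<close>, the semi-arc \<open>b\<close> is reached
  (again) after \<open>n > 0\<close> steps and not earlier, and \<open>h\<close> is the product of the weights on the way.\<close>
inductive first_return :: "diagram \<Rightarrow> (nat \<Rightarrow> 'a) \<Rightarrow> nat \<Rightarrow> nat \<Rightarrow> nat \<Rightarrow> 'h \<Rightarrow> bool"
  for D C b where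
  last: "v \<in> D \<Longrightarrow> passes v e b \<Longrightarrow> first_return D C b 1 e (vw C v e)"
| step: "v \<in> D \<Longrightarrow> passes v e m \<Longrightarrow> m \<noteq> b \<Longrightarrow> first_return D C b n m h
    \<Longrightarrow> first_return D C b (Suc n) e (vw C v e \<otimes> h)"

text \<open>\<open>segment D C M e h e'\<close>: a nonempty path from \<open>e\<close> to \<open>e'\<close> with total weight \<open>h\<close>, whose
  intermediate semi-arcs lie in \<open>M\<close>.\<close>
inductive segment :: "diagram \<Rightarrow> (nat \<Rightarrow> 'a) \<Rightarrow> nat set \<Rightarrow> nat \<Rightarrow> 'h \<Rightarrow> nat \<Rightarrow> bool"
  for D C M where
  single: "v \<in> D \<Longrightarrow> passes v e e' \<Longrightarrow> segment D C M e (vw C v e) e'"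
| step: "v \<in> D \<Longrightarrow> passes v e m \<Longrightarrow> m \<in> M \<Longrightarrow> segment D C M m h e'
    \<Longrightarrow> segment D C M e (vw C v e \<otimes> h) e'"

lemma first_return_closed: "first_return D C b n e h \<Longrightarrow> h \<in> carrier H"
  by (induction rule: first_return.induct) auto

lemma segment_closed: "segment D C M e h e' \<Longrightarrow> h \<in> carrier H"
  by (induction rule: segment.induct) auto

lemma segment_mono: "segment D C M e h e' \<Longrightarrow> D \<subseteq> D' \<Longrightarrow> segment D' C M e h e'"
  by (induction rule: segment.induct) (auto intro: segment.intros)

lemma segment_target: "segment D C M e h e' \<Longrightarrow> e' \<in> edges D"
  by (induction rule: segment.induct) (auto dest: passes_in_out edges_outs)

lemma segment_funpow:
  "segment D C M e h e' \<Longrightarrow> wf_diagram D \<Longrightarrow> \<exists>n. e' = (nxt D ^^ n) e"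
proof (induction rule: segment.induct)
  case (single v e e')
  then show ?case using nxt_eq by (intro exI[of _ 1]) auto
next
  case (step v e m h e')
  then obtain n where "e' = (nxt D ^^ n) m" by blast
  then show ?case using step nxt_eq[of D v e m] by (intro exI[of _ "Suc n"]) (auto simp: funpow_swap1)
qed

lemma first_return_Psi:
  assumes "wf_diagram D" "b \<in> edges D"
  shows "first_return D C b (period D b) b (\<Psi> D C b)"
proof -
  define N where "N = period D b"
  let ?F = "\<lambda>j. foldr (\<lambda>k acc. arc_weight H f g D C ((nxt D ^^ k) b) \<otimes> acc) [j..<N] \<one>"
  \<comment> \<open>Induction backwards from the end of the cycle: the path starts
    \<open>Suc d\<close> steps before the return to \<open>b\<close>.\<close>
  have "first_return D C b (Suc d) ((nxt D ^^ (N - Suc d)) b) (?F (N - Suc d))" if "d < N" for d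
    using that
  proof (induction d)
    case 0
    define e where "e = (nxt D ^^ (N - 1)) b"
    obtain v m where v: "v \<in> D" "passes v e m"
      using wf_ex_passes nxt_funpow_in_edges assms unfolding e_def by metis
    have "m = nxt D e" using nxt_eq assms v by metis
    also have "\<dots> = (nxt D ^^ N) b" using 0 unfolding e_def by (cases N) auto
    also have "\<dots> = b" using nxt_funpow_period assms N_def by metis
    finally have "first_return D C b 1 e (vw C v e)" using v first_return.last by blast
    moreover have "?F (N - 1) = vw C v e"
      using 0 arc_weight_eq[OF assms(1) v, of H f g C] by (simp add: upt_conv_Cons e_def)
    ultimately show ?case by (simp add: e_def)
  next
    case (Suc d)
    define j where "j = N - Suc (Suc d)"
    have j: "N - Suc d = Suc j" "0 < Suc j" "Suc j < N" using Suc.prems by (auto simp: j_def)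
    define e where "e = (nxt D ^^ j) b"
    obtain v m where v: "v \<in> D" "passes v e m"
      using wf_ex_passes nxt_funpow_in_edges assms unfolding e_def by metis
    have m: "m = (nxt D ^^ Suc j) b" using nxt_eq assms v unfolding e_def by fastforce
    then have "m \<noteq> b" using nxt_funpow_less_period[of "Suc j" D b] j N_def by simp
    moreover have "first_return D C b (Suc d) m (?F (Suc j))"
      using Suc j m by simp
    ultimately have "first_return D C b (Suc (Suc d)) e (vw C v e \<otimes> ?F (Suc j))"
      using v first_return.step by blast
    moreover have "?F j = vw C v e \<otimes> ?F (Suc j)"
      using j arc_weight_eq[OF assms(1) v, of H f g C] by (simp add: upt_conv_Cons e_def)
    ultimately show ?case by (simp add: e_def j_def[symmetric])
  qed
  from this[of "N - 1"] show ?thesis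
    using period_pos[OF assms] by (simp add: N_def Psi_def)
qed

lemma first_return_fun:
  "first_return D C b n e h \<Longrightarrow> wf_diagram D \<Longrightarrow> first_return D C b n' e h' \<Longrightarrow> h' = h"
proof (induction arbitrary: n' h' rule: first_return.induct)
  case (last v e)
  from last(4) show ?case using last(1-3) by cases (auto dest: wf_passes_unique)
next
  case (step v e m n h)
  note IH = step.IH and hyps = step.hyps and prems = step.prems
  from prems(2) show ?case
  proof cases
    case (last v')
    then show ?thesis using hyps prems wf_passes_unique by metis
  next
    case (step v' m' n'' h'')
    then have "v' = v \<and> m' = m" using prems hyps wf_passes_unique by metis
    then show ?thesis using step IH[OF prems(1)] by metis
  qed
qed

lemma Psi_eqI: "wf_diagram D \<Longrightarrow> b \<in> edges D \<Longrightarrow> first_return D C b n b h \<Longrightarrow> \<Psi> D C b = h"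
  using first_return_Psi first_return_fun by metis

section \<open>Comparison of two diagrams along common semi-arcs\<close>

lemma first_return_prepend:
  assumes "segment D C M e k e'" "b \<notin> M" "e' \<noteq> b" "first_return D C b n e' h"
  shows "\<exists>n. first_return D C b n e (k \<otimes> h)"
  using assms
proof (induction arbitrary: rule: segment.induct)
  case (single v e e')
  then show ?case using first_return.step by metis
next
  case (step v e m k e')
  then obtain n' where "first_return D C b n' m (k \<otimes> h)" by blast
  moreover have "m \<noteq> b" using step by auto
  ultimately have "first_return D C b (Suc n') e (vw C v e \<otimes> (k \<otimes> h))"
    using step first_return.step by metis
  moreover have "vw C v e \<otimes> (k \<otimes> h) = vw C v e \<otimes> k \<otimes> h"
    using step segment_closed first_return_closed by (metis m_assoc vw_closed)
  ultimately show ?case by metis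
qed

lemma segment_first_return:
  assumes "segment D C M e k b" "b \<notin> M"
  shows "\<exists>n. first_return D C b n e k"
  using assms
proof (induction e k b rule: segment.induct)
  case (single v e e')
  then show ?case using first_return.last by metis
next
  case (step v e m k e')
  then show ?case using first_return.step by metis
qed

text \<open>Paths are deterministic, so a path to \<open>b\<close> has to follow the segment, and it
  cannot stop inside because \<open>b \<notin> M\<close>. The inequality \<open>n' < n\<close>
  provides the induction measure for the transfer between diagrams.\<close>

lemma first_return_cut:
  assumes "segment D C M e k e'" "wf_diagram D" "b \<notin> M" "first_return D C b n e h"
  shows "(e' = b \<and> h = k) \<or> (e' \<noteq> b \<and> (\<exists>n' h'. n' < n \<and> first_return D C b n' e' h' \<and> h = k \<otimes> h'))"
  using assms
proof (induction arbitrary: n h rule: segment.induct)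
  case (single v e e')
  from single(5) show ?case
  proof cases
    case (last v')
    then show ?thesis using single wf_passes_unique by metis
  next
    case (step v' m n' h')
    then have "v' = v \<and> m = e'" using single wf_passes_unique by metis
    then show ?thesis using step by blast
  qed
next
  case (step v e m k e')
  note IH = step.IH and hyps = step.hyps and prems = step.prems
  from prems(3) show ?case
  proof cases
    case (last v')
    then show ?thesis using hyps prems wf_passes_unique by metis
  next
    case (step v' m' n' h')
    then have "v' = v \<and> m' = m" using hyps prems wf_passes_unique by metis
    then have h: "first_return D C b n' m h'" "h = vw C v e \<otimes> h'" "n = Suc n'" using step by auto
    from IH[OF prems(1,2) h(1)] show ?thesis
    proof (elim disjE conjE exE)
      fix n2 h2 assume "e' \<noteq> b" "n2 < n'" "first_return D C b n2 e' h2" "h' = k \<otimes> h2"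
      moreover have "k \<in> carrier H" "h2 \<in> carrier H"
        using hyps segment_closed calculation first_return_closed by auto
      ultimately have "e' \<noteq> b \<and> n2 < n \<and> first_return D C b n2 e' h2 \<and> h = vw C v e \<otimes> k \<otimes> h2"
        using h by (simp add: m_assoc)
      then show ?thesis by blast
    qed (use h in auto)
  qed
qed

text \<open>The two cycles through \<open>b\<close> decompose into the same sequence of segments
  between semi-arcs of \<open>B\<close>, with equal weights, although their numbers of steps may
  differ. The induction is on the steps left in \<open>D\<close>.\<close>

lemma Psi_transfer:
  assumes "wf_diagram D" "wf_diagram D'" "B \<subseteq> edges D" "B \<subseteq> edges D'" "M \<inter> B = {}" "M' \<inter> B = {}"
    and seg: "\<And>e. e \<in> B \<Longrightarrow> \<exists>k e'. e' \<in> B \<and> segment D C M e k e' \<and> segment D' C' M' e k e'"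
    and b: "b \<in> B"
  shows "\<Psi> D' C' b = \<Psi> D C b"
proof -
  have bM: "b \<notin> M" "b \<notin> M'" using assms by auto
  have "\<exists>n'. first_return D' C' b n' e h" if "first_return D C b n e h" "e \<in> B" for n e h
    using that
  proof (induction n arbitrary: e h rule: less_induct)
    case (less n)
    obtain k e' where s: "e' \<in> B" "segment D C M e k e'" "segment D' C' M' e k e'"
      using seg less by blast
    from first_return_cut[OF s(2) assms(1) bM(1) less.prems(1)] show ?case
    proof (elim disjE conjE exE)
      assume "e' = b" "h = k"
      then show ?thesis using segment_first_return s bM by blast
    next
      fix n' h' assume *: "e' \<noteq> b" "n' < n" "first_return D C b n' e' h'" "h = k \<otimes> h'"
      then obtain n2 where "first_return D' C' b n2 e' h'" using less.IH s by blast
      then show ?thesis using first_return_prepend[OF s(3) bM(2) *(1)] * by blast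
    qed
  qed
  then obtain n' where "first_return D' C' b n' b (\<Psi> D C b)"
    using first_return_Psi assms b by blast
  then show ?thesis using Psi_eqI assms b by blast
qed

text \<open>By \<open>cover\<close> no component stays outside \<open>B\<close>: a base point there
  can be moved along its strand into \<open>B\<close>, which only conjugates the product.\<close>

lemma Psi_classes_subset:
  assumes "wf_diagram D" "wf_diagram D'" "B \<subseteq> edges D" "B \<subseteq> edges D'" "M \<inter> B = {}" "M' \<inter> B = {}"
    and cover: "\<And>C e. e \<in> edges D - B \<Longrightarrow> \<exists>k e'. e' \<in> B \<and> segment D C M e k e'"
    and col: "\<And>C. C \<in> colorings S \<beta> D \<Longrightarrow> \<exists>C' \<in> colorings S \<beta> D'.
        \<forall>e\<in>B. \<exists>k e'. e' \<in> B \<and> segment D C M e k e' \<and> segment D' C' M' e k e'"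
  shows "Psi_classes D \<subseteq> Psi_classes D'"
proof
  fix x assume "x \<in> Psi_classes D"
  then obtain C e where e: "x = conj_class H (\<Psi> D C e)" "e \<in> edges D" "C \<in> colorings S \<beta> D"
    by (auto simp: Psi_classes_def)
  obtain b where b: "b \<in> B" "x = conj_class H (\<Psi> D C b)"
  proof (cases "e \<in> B")
    case False
    then obtain k b where "b \<in> B" "segment D C M e k b" using cover e by blast
    then show ?thesis
      using that conj_class_Psi_funpow[OF assms(1) e(2)] segment_funpow assms(1) e(1) by metis
  qed (use e that in auto)
  obtain C' where C': "C' \<in> colorings S \<beta> D'"
    "\<And>e. e \<in> B \<Longrightarrow> \<exists>k e'. e' \<in> B \<and> segment D C M e k e' \<and> segment D' C' M' e k e'"
    using col[OF e(3)] by blast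
  have "\<Psi> D' C' b = \<Psi> D C b"
    by (rule Psi_transfer[OF assms(1-6) C'(2) b(1)])
  then have "x = conj_class H (\<Psi> D' C' b)" using b by simp
  then show "x \<in> Psi_classes D'" using C'(1) b assms(4) unfolding Psi_classes_def by blast
qed

text \<open>Here \<open>M\<close> and \<open>M'\<close> are the inner semi-arcs of the two sides of a local move.\<close>
lemma Psi_classes_subset_local:
  assumes wf: "wf_diagram (R \<union> T)" "wf_diagram (R \<union> T')"
    and bd: "edges T - M = edges T' - M'"
    and M: "M \<inter> edges R = {}" and M': "M' \<inter> edges R = {}"
    and cover: "\<And>C m. m \<in> edges T \<Longrightarrow> m \<in> M \<Longrightarrow> \<exists>k e'. e' \<notin> M \<and> segment T C M m k e'"
    and col: "\<And>C. \<forall>v\<in>T. vert_colored S \<beta> C v \<Longrightarrow>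
        \<exists>C'. (\<forall>e. e \<notin> M' \<longrightarrow> C' e = C e) \<and> (\<forall>v\<in>T'. vert_colored S \<beta> C' v) \<and>
          (\<forall>v\<in>T. \<forall>e\<in>set (ins v) - M. \<exists>k e'. e' \<notin> M \<and> segment T C M e k e' \<and> segment T' C' M' e k e')"
  shows "Psi_classes (R \<union> T) \<subseteq> Psi_classes (R \<union> T')"
proof (rule Psi_classes_subset[OF wf, where B = "edges (R \<union> T) - M" and M = M and M' = M'])
  have RB: "edges R \<subseteq> edges (R \<union> T) - M" using M by (auto simp: edges_Un)
  show "edges (R \<union> T) - M \<subseteq> edges (R \<union> T')" using bd by (auto simp: edges_Un)
  show "M' \<inter> (edges (R \<union> T) - M) = {}" using bd M' by (auto simp: edges_Un)
  show "\<exists>k e'. e' \<in> edges (R \<union> T) - M \<and> segment (R \<union> T) C M e k e'"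
    if "e \<in> edges (R \<union> T) - (edges (R \<union> T) - M)" for C e
  proof -
    have "e \<in> edges T" "e \<in> M" using that M by (auto simp: edges_Un)
    then obtain k e' where "e' \<notin> M" "segment T C M e k e'" using cover by blast
    then show ?thesis
      using segment_target[of T C M e k e'] segment_mono[of T C M e k e' "R \<union> T"]
      by (auto simp: edges_Un)
  qed
  fix C assume "C \<in> colorings S \<beta> (R \<union> T)"
  then have CR: "\<forall>v\<in>R. vert_colored S \<beta> C v" and CT: "\<forall>v\<in>T. vert_colored S \<beta> C v"
    by (auto simp: colorings_def)
  obtain C' where C': "\<And>e. e \<notin> M' \<Longrightarrow> C' e = C e" "\<forall>v\<in>T'. vert_colored S \<beta> C' v"
    "\<And>v e. v \<in> T \<Longrightarrow> e \<in> set (ins v) \<Longrightarrow> e \<notin> M \<Longrightarrow>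
       \<exists>k e'. e' \<notin> M \<and> segment T C M e k e' \<and> segment T' C' M' e k e'"
    using col[OF CT] by blast
  have agree: "C' e = C e" if "v \<in> R" "e \<in> set (ins v) \<union> set (outs v)" for v e
  proof -
    have "e \<in> edges R" using that by (auto simp: edges_def)
    then show ?thesis using C'(1) M' by auto
  qed
  have "\<forall>v\<in>R. vert_colored S \<beta> C' v"
    using CR vert_colored_cong[of _ C' C] agree by metis
  then have 1: "C' \<in> colorings S \<beta> (R \<union> T')" using C'(2) by (auto simp: colorings_def)
  have 2: "\<exists>k e'. e' \<in> edges (R \<union> T) - M \<and> segment (R \<union> T) C M e k e' \<and> segment (R \<union> T') C' M' e k e'"
    if e: "e \<in> edges (R \<union> T) - M" for e
  proof -
    obtain v where v: "v \<in> R \<union> T" "e \<in> set (ins v)" using wf_ex_in[OF wf(1)] e by blast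
    show ?thesis
    proof (cases "v \<in> T")
      case True
      then obtain k e' where "e' \<notin> M" "segment T C M e k e'" "segment T' C' M' e k e'"
        using C'(3) v e by blast
      then show ?thesis
        using segment_target[of T C M e k e'] segment_mono[of T C M e k e' "R \<union> T"]
          segment_mono[of T' C' M' e k e' "R \<union> T'"]
        by (auto simp: edges_Un)
    next
      case False
      then have vR: "v \<in> R" using v by blast
      obtain e' where p: "passes v e e'" using in_has_out v(2) by blast
      \<comment> \<open>Away from the tangle a single vertex is a segment. Its labels avoid
        \<open>M'\<close>, so recoloring the tangle does not change its weight.\<close>
      have "vw C' v e = vw C v e" using vert_weight_cong[of v C' C] agree[OF vR] by metis
      then have "segment (R \<union> T) C M e (vw C v e) e'" "segment (R \<union> T') C' M' e (vw C v e) e'"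
        using segment.single[of v "R \<union> T" e e' C M] segment.single[of v "R \<union> T'" e e' C' M'] vR p by auto
      moreover have "e' \<in> edges R" using p passes_in_out vR edges_outs by metis
      ultimately show ?thesis using RB by blast
    qed
  qed
  show "\<exists>C'\<in>colorings S \<beta> (R \<union> T'). \<forall>e\<in>edges (R \<union> T) - M. \<exists>k e'. e' \<in> edges (R \<union> T) - M \<and>
     segment (R \<union> T) C M e k e' \<and> segment (R \<union> T') C' M' e k e'"
    using 1 2 by blast
qed auto

end

section \<open>Invariance under the moves\<close>

text \<open>The slots follow the argument order of \<open>xrel\<close>, so that a crossing of the
  diagram and its color relation are read alike.\<close>

definition xing :: "pair_kind \<Rightarrow> bool \<Rightarrow> bool \<Rightarrow> nat \<Rightarrow> nat \<Rightarrow> nat \<Rightarrow> nat \<Rightarrow> vert" where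
  "xing k dP dQ P0 Q0 P1 Q1 = gx (ov_first02 k) (P0, dP) (Q0, dQ) (P1, \<not> dP) (Q1, \<not> dQ)"

text \<open>These are four rotations of one picture. After a quarter turn the first strand joins
  \<open>h1\<close> and \<open>h3\<close>, which is what \<open>ov_first13\<close> accounts
  for.\<close>

lemma gx_eq_xing:
  "gx (ov_first02 k) (P0, dP) (Q0, dQ) (P1, \<not> dP) (Q1, \<not> dQ) = xing k dP dQ P0 Q0 P1 Q1"
  "gx (ov_first02 k) (P1, \<not> dP) (Q1, \<not> dQ) (P0, dP) (Q0, dQ) = xing k dP dQ P0 Q0 P1 Q1"
  "gx (ov_first13 k) (Q1, \<not> dQ) (P0, dP) (Q0, dQ) (P1, \<not> dP) = xing k dP dQ P0 Q0 P1 Q1"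
  "gx (ov_first13 k) (Q0, dQ) (P1, \<not> dP) (Q1, \<not> dQ) (P0, dP) = xing k dP dQ P0 Q0 P1 Q1"
  by (cases k; cases dP; cases dQ; simp add: xing_def gx_def)+

fun sign :: "pair_kind \<Rightarrow> ckind" where
  "sign PVirt = Virt" | "sign FirstOver = Neg" | "sign SecondOver = Pos"

text \<open>If exactly one strand is reversed, the second strand becomes the one entering at the top
  left, and the over-information seen from it is \<open>opposite k\<close>.\<close>

lemma xing_eq_Cr:
  "xing k True True P0 Q0 P1 Q1 = Cr (sign k) P0 Q0 Q1 P1"
  "xing k False False P0 Q0 P1 Q1 = Cr (sign k) P1 Q1 Q0 P0"
  "xing k False True P0 Q0 P1 Q1 = Cr (sign (opposite k)) Q0 P1 P0 Q1"
  "xing k True False P0 Q0 P1 Q1 = Cr (sign (opposite k)) Q1 P0 P1 Q0"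
  by (cases k; simp add: xing_def gx_def)+

lemma ins_xing: "set (ins (xing k dP dQ P0 Q0 P1 Q1)) = {if dP then P0 else P1, if dQ then Q0 else Q1}"
  and outs_xing: "set (outs (xing k dP dQ P0 Q0 P1 Q1)) = {if dP then P1 else P0, if dQ then Q1 else Q0}"
  by (cases dP; cases dQ; auto simp: xing_eq_Cr)+

lemma passes_xing:
  "passes (xing k dP dQ P0 Q0 P1 Q1) (if dP then P0 else P1) (if dP then P1 else P0)"
  "passes (xing k dP dQ P0 Q0 P1 Q1) (if dQ then Q0 else Q1) (if dQ then Q1 else Q0)"
  by (cases dP; cases dQ; auto simp: xing_eq_Cr)+

lemma wf_xing_distinct:
  assumes "wf_diagram D" "xing k dP dQ P0 Q0 P1 Q1 \<in> D"
  shows "(if dP then P0 else P1) \<noteq> (if dQ then Q0 else Q1)"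
    and "(if dP then P1 else P0) \<noteq> (if dQ then Q1 else Q0)"
  using assms(2)
  by (cases dP; cases dQ; simp add: xing_eq_Cr; metis wf_crossing_distinct[OF assms(1)])+

lemma ins_arc: "set (ins (arc d p q)) = {if d then p else q}"
  and outs_arc: "set (outs (arc d p q)) = {if d then q else p}"
  and passes_arc: "passes (arc d p q) (if d then p else q) (if d then q else p)"
  and vert_colored_arc: "vert_colored S \<beta> C (arc d p q) \<longleftrightarrow> C p = C q"
  and vert_weight_arc: "vert_weight H f g C (arc d p q) e = \<one>\<^bsub>H\<^esub>"
  by (auto simp: arc_def)

text \<open>The only incoming and the only outgoing slot of \<open>e\<close> are both used up inside
  \<open>T\<close>.\<close>

lemma inner_not_outside:
  assumes "wf_diagram (R \<union> T)" "R \<inter> T = {}" "v \<in> T" "w \<in> T" "e \<in> set (ins v)" "e \<in> set (outs w)"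
  shows "e \<notin> edges R"
proof
  assume "e \<in> edges R"
  then obtain u where "u \<in> R" "e \<in> set (ins u) \<or> e \<in> set (outs u)" by (auto simp: edges_def)
  then have "u = v \<or> u = w"
    using wf_in_unique[OF assms(1)] wf_out_unique[OF assms(1)] assms by (metis UnCI)
  then show False using \<open>u \<in> R\<close> assms by blast
qed

lemma wf_slots_disjoint:
  assumes "wf_diagram D" "v \<in> D" "w \<in> D" "v \<noteq> w"
  shows "set (ins v) \<inter> set (ins w) = {}" "set (outs v) \<inter> set (outs w) = {}"
  using wf_in_unique[OF assms(1-3)] wf_out_unique[OF assms(1-3)] assms(4) by blast+

text \<open>The coloring rule for values in slots instead of labels. Decorated colors need this
  form, because equal labels at two boundary slots may carry different accumulated weights.\<close>

fun val_colored :: "('a \<times> 'a \<Rightarrow> 'a \<times> 'a) \<Rightarrow> ('a \<times> 'a \<Rightarrow> 'a \<times> 'a) \<Rightarrow> ckind \<Rightarrow> 'a \<Rightarrow> 'a \<Rightarrow> 'a \<Rightarrow> 'a \<Rightarrow> bool" where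
  "val_colored S \<beta> Pos a b c d \<longleftrightarrow> (c, d) = S (a, b)"
| "val_colored S \<beta> Neg a b c d \<longleftrightarrow> (a, b) = S (c, d)"
| "val_colored S \<beta> Virt a b c d \<longleftrightarrow> (c, d) = \<beta> (a, b)"

lemma (in vpair) xrel_iff_val_colored:
  "xrel S \<beta> k True True x y x' y' \<longleftrightarrow> val_colored S \<beta> (sign k) x y y' x'"
  "xrel S \<beta> k False False x y x' y' \<longleftrightarrow> val_colored S \<beta> (sign k) x' y' y x"
  "xrel S \<beta> k False True x y x' y' \<longleftrightarrow> val_colored S \<beta> (sign (opposite k)) y x' x y'"
  "xrel S \<beta> k True False x y x' y' \<longleftrightarrow> val_colored S \<beta> (sign (opposite k)) y' x x' y"
proof -
  have F: "p = inv_into UNIV S q \<longleftrightarrow> q = S p" for p q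
    using crossing_map_eq_iff[of p FirstOver q] by simp
  have V: "p = \<beta> q \<longleftrightarrow> q = \<beta> p" for p q
    by (metis \<beta>_invol)
  show "xrel S \<beta> k True True x y x' y' \<longleftrightarrow> val_colored S \<beta> (sign k) x y y' x'"
    "xrel S \<beta> k False False x y x' y' \<longleftrightarrow> val_colored S \<beta> (sign k) x' y' y x"
    by (cases k; simp add: xrel_def F)+
  show "xrel S \<beta> k False True x y x' y' \<longleftrightarrow> val_colored S \<beta> (sign (opposite k)) y x' x y'"
    "xrel S \<beta> k True False x y x' y' \<longleftrightarrow> val_colored S \<beta> (sign (opposite k)) y' x x' y"
    using V[of "(y, x')" "(x, y')"] V[of "(y', x)" "(x', y)"] by (cases k; simp add: xrel_def F)+
qed

context cocycle
begin

text \<open>\<open>adv d C v P0 P1 h0 h1\<close>: a strand joining \<open>P0\<close> and \<open>P1\<close> through \<open>v\<close>, oriented from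
  \<open>P0\<close> to \<open>P1\<close> iff \<open>d\<close>, carries the accumulated weights \<open>h0\<close> at \<open>P0\<close> and \<open>h1\<close> at \<open>P1\<close>.\<close>
definition adv :: "bool \<Rightarrow> (nat \<Rightarrow> 'a) \<Rightarrow> vert \<Rightarrow> nat \<Rightarrow> nat \<Rightarrow> 'h \<Rightarrow> 'h \<Rightarrow> bool" where
  "adv d C v P0 P1 h0 h1 \<longleftrightarrow> (if d then h1 = h0 \<otimes> vw C v P0 else h0 = h1 \<otimes> vw C v P1)"

lemma val_colored_lift_iff:
  assumes ab: "a \<noteq> b"
    and cl: "ha \<in> carrier H" "hb \<in> carrier H" "hc \<in> carrier H" "he \<in> carrier H"
  shows "val_colored Sl \<beta>l k (C a, ha) (C b, hb) (C c, hc) (C d, he) \<longleftrightarrow>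
    vert_colored S \<beta> C (Cr k a b c d) \<and>
    he = ha \<otimes> vw C (Cr k a b c d) a \<and> hc = hb \<otimes> vw C (Cr k a b c d) b"
proof -
  have pr: "p = \<sigma> (x, y) \<longleftrightarrow> p = (S1 \<sigma> x y, S2 \<sigma> x y)" for p x y and \<sigma> :: "'a \<times> 'a \<Rightarrow> 'a \<times> 'a"
    by (simp add: S1_def S2_def)
  \<comment> \<open>At a negative crossing the decorated map runs from the outgoing to the incoming
    ends, so along the under-strand its weight appears inverted.\<close>
  have "hb = hc \<otimes> f (C c, C d) \<longleftrightarrow> hc = hb \<otimes> inv (f (C c, C d))"
    using cl by (metis f_closed inv_closed inv_solve_right')
  then show ?thesis
    using assms by (cases k) (auto simp: pr rmul_carrier)
qed

text \<open>The bridge between algebra and diagrams: statements about the decorated pair become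
  statements about colorings and products of weights. The incoming labels must differ because
  \<open>vert_weight\<close> recognizes a strand by its incoming label.\<close>

lemma xrel_lift_iff:
  assumes "(if dP then P0 else P1) \<noteq> (if dQ then Q0 else Q1)"
    and cl: "h0 \<in> carrier H" "k0 \<in> carrier H" "h1 \<in> carrier H" "k1 \<in> carrier H"
    and v: "v = xing k dP dQ P0 Q0 P1 Q1"
  shows "xrel Sl \<beta>l k dP dQ (C P0, h0) (C Q0, k0) (C P1, h1) (C Q1, k1) \<longleftrightarrow>
    vert_colored S \<beta> C v \<and> adv dP C v P0 P1 h0 h1 \<and> adv dQ C v Q0 Q1 k0 k1"
  using assms(1)
  by (cases dP; cases dQ; simp add: v lifted.xrel_iff_val_colored xing_eq_Cr adv_def
      val_colored_lift_iff cl) blast+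

text \<open>Existence statements for the lifted pair produce decorations somewhere in the type. They
  lie in the carrier because \<open>rmul\<close> preserves membership in both directions along a
  strand.\<close>

lemma xrel_lift_closed:
  assumes "xrel Sl \<beta>l k dP dQ p q p' q'"
  shows "snd p \<in> carrier H \<longleftrightarrow> snd p' \<in> carrier H" "snd q \<in> carrier H \<longleftrightarrow> snd q' \<in> carrier H"
proof -
  have *: "(snd a \<in> carrier H \<longleftrightarrow> snd d \<in> carrier H) \<and> (snd b \<in> carrier H \<longleftrightarrow> snd c \<in> carrier H)"
    if "val_colored Sl \<beta>l s a b c d" for s a b c d
    using that by (cases s; cases a; cases b; cases c; cases d) auto
  show "snd p \<in> carrier H \<longleftrightarrow> snd p' \<in> carrier H" "snd q \<in> carrier H \<longleftrightarrow> snd q' \<in> carrier H"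
    using assms by (cases dP; cases dQ; auto simp: lifted.xrel_iff_val_colored dest: *)+
qed

text \<open>The value is normalized to \<open>\<one>\<close> at the entrance of the strand, so that
  at the exit it is the product of the two weights.\<close>

lemma adv_exists:
  "\<exists>h0 hm h1. h0 \<in> carrier H \<and> hm \<in> carrier H \<and> h1 \<in> carrier H \<and>
     adv d C v P0 m h0 hm \<and> adv d C w m P1 hm h1 \<and> (if d then h0 else h1) = \<one>"
proof (cases d)
  case True
  then show ?thesis
    by (intro exI[of _ \<one>] exI[of _ "vw C v P0"] exI[of _ "vw C v P0 \<otimes> vw C w m"]) (simp add: adv_def)
next
  case False
  then show ?thesis
    by (intro exI[of _ "vw C w P1 \<otimes> vw C v m"] exI[of _ "vw C w P1"] exI[of _ \<one>]) (simp add: adv_def)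
qed

lemma segment_adv:
  assumes "v \<in> T" "w \<in> T" "m \<in> M"
    and "passes v (if d then P0 else m) (if d then m else P0)"
    and "passes w (if d then m else P1) (if d then P1 else m)"
    and "adv d C v P0 m h0 hm" "adv d C w m P1 hm h1" "(if d then h0 else h1) = \<one>"
  shows "segment T C M (if d then P0 else P1) (if d then h1 else h0) (if d then P1 else P0)"
proof (cases d)
  case True
  then show ?thesis
    using assms segment.step[of v T P0 m M C "vw C w m" P1] segment.single[of w T m P1 C M]
    by (simp add: adv_def)
next
  case False
  then show ?thesis
    using assms segment.step[of w T P1 m M C "vw C v m" P0] segment.single[of v T m P0 C M]
    by (simp add: adv_def)
qed

section \<open>RI, RII, and RIII with pairwise distinct crossings\<close>

lemma Psi_classes_R1:
  assumes wf: "wf_diagram (R \<union> {arc d q0 q1})" "wf_diagram (R \<union> {v})" and vR: "v \<notin> R"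
    and v: "v = xing k d d q0 l l q1 \<or> v = xing k d (\<not> d) q0 q1 l l"
  shows "Psi_classes (R \<union> {arc d q0 q1}) = Psi_classes (R \<union> {v})"
proof -
  let ?T = "{arc d q0 q1}" and ?T' = "{v}"
  let ?i = "if d then q0 else q1" and ?o = "if d then q1 else q0"
  have ins: "set (ins v) = {?i, l}" and outs: "set (outs v) = {l, ?o}"
    using v by (cases d; auto simp: ins_xing outs_xing)+
  have "?i \<noteq> l \<and> ?o \<noteq> l"
    using v
  proof
    assume "v = xing k d d q0 l l q1"
    then show ?thesis using wf_xing_distinct[OF wf(2), of k d d q0 l l q1] by (cases d) auto
  next
    assume "v = xing k d (\<not> d) q0 q1 l l"
    then show ?thesis using wf_xing_distinct[OF wf(2), of k d "\<not> d" q0 q1 l l] by (cases d) auto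
  qed
  then have ne: "?i \<noteq> l" "?o \<noteq> l" by blast+
  have lR: "l \<notin> edges R"
    by (rule inner_not_outside[OF wf(2), of v v]) (use vR ins outs in auto)
  have bd: "edges ?T = {q0, q1}" "edges ?T' = {q0, q1, l}"
    using ins outs by (cases d; auto simp: edges_insert edges_empty ins_arc outs_arc)+
  have p: "passes v (if d then q0 else l) (if d then l else q0)" "passes v (if d then l else q1) (if d then q1 else l)"
    using v by (cases d; auto simp: xing_eq_Cr)+
  have lift: "(if d then h0 else h1) = \<one> \<Longrightarrow> h0 \<in> carrier H \<Longrightarrow> hl \<in> carrier H \<Longrightarrow> h1 \<in> carrier H \<Longrightarrow>
      (xrel Sl \<beta>l k d d (C q0, h0) (C l, hl) (C l, hl) (C q1, h1) \<longleftrightarrow>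
        vert_colored S \<beta> C v \<and> adv d C v q0 l h0 hl \<and> adv d C v l q1 hl h1)"
    if "v = xing k d d q0 l l q1" for C h0 hl h1
    using xrel_lift_iff[of d q0 l d l q1 h0 hl hl h1 v k C] that ne by (cases d) auto
  have lift': "(if d then h0 else h1) = \<one> \<Longrightarrow> h0 \<in> carrier H \<Longrightarrow> hl \<in> carrier H \<Longrightarrow> h1 \<in> carrier H \<Longrightarrow>
      (xrel Sl \<beta>l k d (\<not> d) (C q0, h0) (C q1, h1) (C l, hl) (C l, hl) \<longleftrightarrow>
        vert_colored S \<beta> C v \<and> adv d C v q0 l h0 hl \<and> adv d C v l q1 hl h1)"
    if "v = xing k d (\<not> d) q0 q1 l l" for C h0 hl h1
    using xrel_lift_iff[of d q0 l "\<not> d" q1 l h0 h1 hl hl v k C] that ne by (cases d) (auto simp: adv_def)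
  have arc_seg: "segment ?T C {} ?i \<one> ?o" for C
    using segment.single[of "arc d q0 q1" ?T ?i ?o C "{}"] passes_arc[of d q0 q1] by (simp add: vert_weight_arc)
  have "Psi_classes (R \<union> ?T) \<subseteq> Psi_classes (R \<union> ?T')"
  proof (rule Psi_classes_subset_local[OF wf, where M = "{}" and M' = "{l}"])
    show "edges ?T - {} = edges ?T' - {l}" using bd ne by (cases d) auto
    fix C assume "\<forall>v\<in>?T. vert_colored S \<beta> C v"
    then have C: "C q0 = C q1" by (simp add: vert_colored_arc)
    \<comment> \<open>The loop color is taken from the decorated pair with weight
      \<open>\<one>\<close> prescribed at both ends; this makes the total weight of the kink
      \<open>\<one>\<close>.\<close>
    obtain L where L: "xrel Sl \<beta>l k d d (C q0, \<one>) L L (C q1, \<one>)" if "v = xing k d d q0 l l q1"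
      using lifted.xrel_R1(1)[of k d "(C q0, \<one>)" "(C q1, \<one>)"] C by auto
    obtain L' where L': "xrel Sl \<beta>l k d (\<not> d) (C q0, \<one>) (C q1, \<one>) L' L'" if "v = xing k d (\<not> d) q0 q1 l l"
      using lifted.xrel_R1(2)[of k d "(C q0, \<one>)" "(C q1, \<one>)"] C by auto
    have "\<exists>x h. h \<in> carrier H \<and> vert_colored S \<beta> (C(l := x)) v \<and>
        adv d (C(l := x)) v q0 l \<one> h \<and> adv d (C(l := x)) v l q1 h \<one>"
      using v
    proof
      assume v: "v = xing k d d q0 l l q1"
      then have "snd L \<in> carrier H" using xrel_lift_closed[OF L] by simp
      then show ?thesis
        using L[OF v] lift[OF v, of \<one> \<one> "snd L" "C(l := fst L)"] ne C
        by (intro exI[of _ "fst L"] exI[of _ "snd L"]) (cases d; auto)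
    next
      assume v: "v = xing k d (\<not> d) q0 q1 l l"
      then have "snd L' \<in> carrier H" using xrel_lift_closed[OF L'] by simp
      then show ?thesis
        using L'[OF v] lift'[OF v, of \<one> \<one> "snd L'" "C(l := fst L')"] ne C
        by (intro exI[of _ "fst L'"] exI[of _ "snd L'"]) (cases d; auto)
    qed
    then obtain x h where x: "vert_colored S \<beta> (C(l := x)) v"
        "adv d (C(l := x)) v q0 l \<one> h" "adv d (C(l := x)) v l q1 h \<one>" by blast
    have "segment ?T' (C(l := x)) {l} ?i \<one> ?o"
      using segment_adv[of v ?T' v l "{l}", OF _ _ _ p x(2,3)] by simp
    then have "\<exists>k e'. e' \<notin> {} \<and> segment ?T C {} ?i k e' \<and> segment ?T' (C(l := x)) {l} ?i k e'"
      using arc_seg by blast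
    then show "\<exists>C'. (\<forall>e. e \<notin> {l} \<longrightarrow> C' e = C e) \<and> (\<forall>v\<in>?T'. vert_colored S \<beta> C' v) \<and>
          (\<forall>v\<in>?T. \<forall>e\<in>set (ins v) - {}. \<exists>k e'. e' \<notin> {} \<and> segment ?T C {} e k e' \<and> segment ?T' C' {l} e k e')"
      using x(1) by (intro exI[of _ "C(l := x)"] conjI) (simp_all add: ins_arc)
  qed (use lR in auto)
  moreover have "Psi_classes (R \<union> ?T') \<subseteq> Psi_classes (R \<union> ?T)"
  proof (rule Psi_classes_subset_local[OF wf(2,1), where M' = "{}" and M = "{l}"])
    show "edges ?T' - {l} = edges ?T - {}" using bd ne by (cases d) auto
    show "\<exists>k e'. e' \<notin> {l} \<and> segment ?T' C {l} m k e'" if "m \<in> {l}" for C m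
      using segment.single[of v ?T' l ?o C "{l}"] that p ne by (cases d) auto
    fix C assume "\<forall>v\<in>?T'. vert_colored S \<beta> C v"
    then have C: "vert_colored S \<beta> C v" by simp
    \<comment> \<open>A given coloring of the kink is followed from the entrance with weight
      \<open>\<one>\<close>; the decorated \<open>xrel_R1\<close> returns the same color and weight
      at the exit.\<close>
    obtain h0 hl h1 where h: "h0 \<in> carrier H" "hl \<in> carrier H" "h1 \<in> carrier H"
      "adv d C v q0 l h0 hl" "adv d C v l q1 hl h1" "(if d then h0 else h1) = \<one>"
      using adv_exists[of d C v q0 l v q1] by blast
    have "(C q0, h0) = (C q1, h1)"
      using v
    proof
      assume v: "v = xing k d d q0 l l q1"
      then show ?thesis
        using lift[OF v h(6) h(1-3), of C] C h(4,5) lifted.xrel_R1(1)[of k d "(C q0, h0)" "(C q1, h1)"] by blast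
    next
      assume v: "v = xing k d (\<not> d) q0 q1 l l"
      then show ?thesis
        using lift'[OF v h(6) h(1-3), of C] C h(4,5) lifted.xrel_R1(2)[of k d "(C q0, h0)" "(C q1, h1)"] by blast
    qed
    then have eq: "C q0 = C q1" "h0 = \<one>" "h1 = \<one>" using h(6) by (auto split: if_splits)
    have "segment ?T' C {l} ?i \<one> ?o"
      using segment_adv[of v ?T' v l "{l}", OF _ _ _ p h(4,5,6)] eq by (cases d) simp_all
    then have "\<exists>k e'. e' \<notin> {l} \<and> segment ?T' C {l} ?i k e' \<and> segment ?T C {} ?i k e'"
      using arc_seg ne by blast
    moreover have "\<forall>v\<in>?T'. \<forall>e\<in>set (ins v) - {l}. e = ?i" using ins by auto
    ultimately have "\<forall>v\<in>?T'. \<forall>e\<in>set (ins v) - {l}. \<exists>k e'. e' \<notin> {l} \<and> segment ?T' C {l} e k e' \<and> segment ?T C {} e k e'"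
      by metis
    then show "\<exists>C'. (\<forall>e. e \<notin> {} \<longrightarrow> C' e = C e) \<and> (\<forall>v\<in>?T. vert_colored S \<beta> C' v) \<and>
          (\<forall>v\<in>?T'. \<forall>e\<in>set (ins v) - {l}. \<exists>k e'. e' \<notin> {l} \<and> segment ?T' C {l} e k e' \<and> segment ?T C' {} e k e')"
      using eq(1) by (intro exI[of _ C] conjI) (simp_all add: vert_colored_arc)
  qed (use lR in auto)
  ultimately show ?thesis by blast
qed

text \<open>Each strand leaves the decorated bigon with the color and the weight it had on entering,
  so along each strand the contributions of the two crossings cancel.\<close>

lemma Psi_classes_R2:
  assumes wf: "wf_diagram (R \<union> {arc dS q0 q3, arc dT q1 q2})" "wf_diagram (R \<union> {U, W})"
    and R: "R \<inter> {U, W} = {}" and ne: "U \<noteq> W"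
    and U: "U = xing k dS dT q0 q1 s t" and W: "W = xing (opposite k) dT dS t s q2 q3"
  shows "Psi_classes (R \<union> {arc dS q0 q3, arc dT q1 q2}) = Psi_classes (R \<union> {U, W})"
proof -
  let ?T = "{arc dS q0 q3, arc dT q1 q2}" and ?T' = "{U, W}" and ?M = "{s, t}"
  let ?iS = "if dS then q0 else q3" and ?oS = "if dS then q3 else q0"
  let ?iT = "if dT then q1 else q2" and ?oT = "if dT then q2 else q1"
  have dist: "(if dS then q0 else s) \<noteq> (if dT then q1 else t)" "(if dS then s else q0) \<noteq> (if dT then t else q1)"
    "(if dT then t else q2) \<noteq> (if dS then s else q3)" "(if dT then q2 else t) \<noteq> (if dS then q3 else s)"
    using wf_xing_distinct[OF wf(2)] U W by (metis UnCI insertCI)+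
  \<comment> \<open>Both slots of \<open>s\<close> and of \<open>t\<close> are filled inside the
    bigon, so neither label can recur at a boundary end.\<close>
  have st: "s \<noteq> t" "s \<notin> {q0, q1, q2, q3}" "t \<notin> {q0, q1, q2, q3}"
    using dist wf_slots_disjoint[OF wf(2) _ _ ne] by (cases dS; cases dT; auto simp: U W ins_xing outs_xing)+
  have MR: "?M \<inter> edges R = {}"
  proof -
    have "s \<notin> edges R"
      by (rule inner_not_outside[OF wf(2) R, of "if dS then W else U" "if dS then U else W"])
        (auto simp: U W ins_xing outs_xing)
    moreover have "t \<notin> edges R"
      by (rule inner_not_outside[OF wf(2) R, of "if dT then W else U" "if dT then U else W"])
        (auto simp: U W ins_xing outs_xing)
    ultimately show ?thesis by blast
  qed
  have bd: "edges ?T = {q0, q1, q2, q3}" "edges ?T' = {q0, q1, q2, q3, s, t}"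
    by (cases dS; cases dT; auto simp: U W edges_insert edges_empty ins_arc outs_arc ins_xing outs_xing)+
  have pS: "passes U (if dS then q0 else s) (if dS then s else q0)" "passes W (if dS then s else q3) (if dS then q3 else s)"
    and pT: "passes U (if dT then q1 else t) (if dT then t else q1)" "passes W (if dT then t else q2) (if dT then q2 else t)"
    unfolding U W by (rule passes_xing)+
  have lift: "xrel Sl \<beta>l k dS dT (C q0, h0) (C q1, k0) (C s, hs) (C t, kt) \<longleftrightarrow>
        vert_colored S \<beta> C U \<and> adv dS C U q0 s h0 hs \<and> adv dT C U q1 t k0 kt"
      "xrel Sl \<beta>l (opposite k) dT dS (C t, kt) (C s, hs) (C q2, k1) (C q3, h1) \<longleftrightarrow>
        vert_colored S \<beta> C W \<and> adv dT C W t q2 kt k1 \<and> adv dS C W s q3 hs h1"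
    if "h0 \<in> carrier H" "hs \<in> carrier H" "h1 \<in> carrier H" "k0 \<in> carrier H" "kt \<in> carrier H" "k1 \<in> carrier H"
    for C h0 hs h1 k0 kt k1
    using that dist by (intro xrel_lift_iff U W; simp)+
  have arc_seg: "segment ?T C {} ?iS \<one> ?oS" "segment ?T C {} ?iT \<one> ?oT" for C
    using segment.single[of "arc dS q0 q3" ?T ?iS ?oS C "{}"] passes_arc[of dS q0 q3]
      segment.single[of "arc dT q1 q2" ?T ?iT ?oT C "{}"] passes_arc[of dT q1 q2] by (simp_all add: vert_weight_arc)
  have segs: "segment ?T' C ?M ?iS \<one> ?oS \<and> segment ?T' C ?M ?iT \<one> ?oT"
    if "adv dS C U q0 s \<one> hs" "adv dS C W s q3 hs \<one>" "adv dT C U q1 t \<one> kt" "adv dT C W t q2 kt \<one>" for C hs kt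
    using segment_adv[of U ?T' W s ?M, OF _ _ _ pS that(1,2)] segment_adv[of U ?T' W t ?M, OF _ _ _ pT that(3,4)]
    by simp
  have "Psi_classes (R \<union> ?T) \<subseteq> Psi_classes (R \<union> ?T')"
  proof (rule Psi_classes_subset_local[OF wf, where M = "{}" and M' = ?M])
    show "edges ?T - {} = edges ?T' - ?M" using bd st by auto
    fix C assume "\<forall>v\<in>?T. vert_colored S \<beta> C v"
    then have C: "C q0 = C q3" "C q1 = C q2" by (simp_all add: vert_colored_arc)
    obtain X Y where XY: "xrel Sl \<beta>l k dS dT (C q0, \<one>) (C q1, \<one>) X Y"
        "xrel Sl \<beta>l (opposite k) dT dS Y X (C q2, \<one>) (C q3, \<one>)"
      using lifted.xrel_R2[of k dS dT "(C q0, \<one>)" "(C q1, \<one>)" "(C q2, \<one>)" "(C q3, \<one>)"] C by auto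
    have cl: "snd X \<in> carrier H" "snd Y \<in> carrier H" using xrel_lift_closed[OF XY(1)] by simp_all
    define C' where "C' = C(s := fst X, t := fst Y)"
    have C': "C' s = fst X" "C' t = fst Y" "C' q0 = C q0" "C' q1 = C q1" "C' q2 = C q2" "C' q3 = C q3"
      using st by (auto simp: C'_def)
    have *: "vert_colored S \<beta> C' U" "adv dS C' U q0 s \<one> (snd X)" "adv dT C' U q1 t \<one> (snd Y)"
      "vert_colored S \<beta> C' W" "adv dT C' W t q2 (snd Y) \<one>" "adv dS C' W s q3 (snd X) \<one>"
      using XY lift[of \<one> "snd X" \<one> \<one> "snd Y" \<one> C'] cl by (simp_all add: C')
    have agree: "\<forall>e. e \<notin> ?M \<longrightarrow> C' e = C e" by (simp add: C'_def)
    have "\<exists>k e'. e' \<notin> {} \<and> segment ?T C {} e k e' \<and> segment ?T' C' ?M e k e'"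
      if "v \<in> ?T" "e \<in> set (ins v) - {}" for v e
    proof -
      have "e = ?iS \<or> e = ?iT" using that by (auto simp: ins_arc)
      then show ?thesis using arc_seg segs[OF *(2,6,3,5)] by (elim disjE; hypsubst) blast+
    qed
    then show "\<exists>C'. (\<forall>e. e \<notin> ?M \<longrightarrow> C' e = C e) \<and> (\<forall>v\<in>?T'. vert_colored S \<beta> C' v) \<and>
          (\<forall>v\<in>?T. \<forall>e\<in>set (ins v) - {}. \<exists>k e'. e' \<notin> {} \<and> segment ?T C {} e k e' \<and> segment ?T' C' ?M e k e')"
      using agree * by (intro exI[of _ C'] conjI) simp_all
  qed (use MR in auto)
  moreover have "Psi_classes (R \<union> ?T') \<subseteq> Psi_classes (R \<union> ?T)"
  proof (rule Psi_classes_subset_local[OF wf(2,1), where M' = "{}" and M = ?M])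
    show "edges ?T' - ?M = edges ?T - {}" using bd st by auto
    show "\<exists>k e'. e' \<notin> ?M \<and> segment ?T' C ?M m k e'" if "m \<in> ?M" for C m
    proof -
      have "\<exists>v\<in>?T'. \<exists>e'. e' \<notin> ?M \<and> passes v m e'"
        using that pS pT st by (cases dS; cases dT; auto)
      then show ?thesis using segment.single by metis
    qed
    fix C assume C: "\<forall>v\<in>?T'. vert_colored S \<beta> C v"
    obtain h0 hs h1 where h: "h0 \<in> carrier H" "hs \<in> carrier H" "h1 \<in> carrier H"
      "adv dS C U q0 s h0 hs" "adv dS C W s q3 hs h1" "(if dS then h0 else h1) = \<one>"
      using adv_exists[of dS C U q0 s W q3] by blast
    obtain k0 kt k1 where k: "k0 \<in> carrier H" "kt \<in> carrier H" "k1 \<in> carrier H"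
      "adv dT C U q1 t k0 kt" "adv dT C W t q2 kt k1" "(if dT then k0 else k1) = \<one>"
      using adv_exists[of dT C U q1 t W q2] by blast
    have "(C q0, h0) = (C q3, h1) \<and> (C q1, k0) = (C q2, k1)"
      using lifted.xrel_R2[of k dS dT "(C q0, h0)" "(C q1, k0)" "(C q2, k1)" "(C q3, h1)"]
        lift[OF h(1-3) k(1-3), of C] h(4,5) k(4,5) C by blast
    then have eq: "C q0 = C q3" "C q1 = C q2" "h0 = \<one>" "h1 = \<one>" "k0 = \<one>" "k1 = \<one>"
      using h(6) k(6) by (auto split: if_splits)
    have sg: "segment ?T' C ?M ?iS \<one> ?oS" "segment ?T' C ?M ?iT \<one> ?oT"
      using segs h k eq by blast+
    have o: "?oS \<notin> ?M" "?oT \<notin> ?M" using st by auto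
    have "\<exists>k e'. e' \<notin> ?M \<and> segment ?T' C ?M e k e' \<and> segment ?T C {} e k e'"
      if "v \<in> ?T'" "e \<in> set (ins v) - ?M" for v e
    proof -
      have "e = ?iS \<or> e = ?iT"
        using that by (cases dS; cases dT; auto simp: U W ins_xing)
      then show ?thesis using sg arc_seg o by (elim disjE; hypsubst) blast+
    qed
    then show "\<exists>C'. (\<forall>e. e \<notin> {} \<longrightarrow> C' e = C e) \<and> (\<forall>v\<in>?T. vert_colored S \<beta> C' v) \<and>
          (\<forall>v\<in>?T'. \<forall>e\<in>set (ins v) - ?M. \<exists>k e'. e' \<notin> ?M \<and> segment ?T' C ?M e k e' \<and> segment ?T C' {} e k e')"
      using eq by (intro exI[of _ C] conjI) (simp_all add: vert_colored_arc)
  qed (use MR in auto)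
  ultimately show ?thesis by blast
qed

text \<open>One inclusion suffices, because a half-turn of the disc interchanges the two
  triangles.\<close>

lemma Psi_classes_R3_subset:
  assumes wf: "wf_diagram (R \<union> {AB, AC, BC})" "wf_diagram (R \<union> {AB', AC', BC'})"
    and R: "R \<inter> {AB, AC, BC} = {}" "R \<inter> {AB', AC', BC'} = {}"
    and ne: "AB \<noteq> AC" "AB \<noteq> BC" "AC \<noteq> BC" and ne': "AB' \<noteq> AC'" "AB' \<noteq> BC'" "AC' \<noteq> BC'"
    and kinds: "r3_kinds kAB kAC kBC"
    and AB: "AB = xing kAB dA dB eA eB p3 p4" and AC: "AC = xing kAC dA dC p0 eC eA p5"
    and BC: "BC = xing kBC dB dC p1 p2 eB eC"
    and AB': "AB' = xing kAB dA dB p0 p1 fA fB" and AC': "AC' = xing kAC dA dC fA p2 p3 fC"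
    and BC': "BC' = xing kBC dB dC fB fC p4 p5"
  shows "Psi_classes (R \<union> {AB, AC, BC}) \<subseteq> Psi_classes (R \<union> {AB', AC', BC'})"
proof -
  let ?T = "{AB, AC, BC}" and ?T' = "{AB', AC', BC'}" and ?M = "{eA, eB, eC}" and ?M' = "{fA, fB, fC}"
  let ?iA = "if dA then p0 else p3" and ?oA = "if dA then p3 else p0"
  let ?iB = "if dB then p1 else p4" and ?oB = "if dB then p4 else p1"
  let ?iC = "if dC then p2 else p5" and ?oC = "if dC then p5 else p2"
  have mem: "AB \<in> R \<union> ?T" "AC \<in> R \<union> ?T" "BC \<in> R \<union> ?T"
    "AB' \<in> R \<union> ?T'" "AC' \<in> R \<union> ?T'" "BC' \<in> R \<union> ?T'" by auto
  note dist = wf_xing_distinct[OF wf(1), of kAB dA dB eA eB p3 p4, folded AB, OF mem(1)]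
    wf_xing_distinct[OF wf(1), of kAC dA dC p0 eC eA p5, folded AC, OF mem(2)]
    wf_xing_distinct[OF wf(1), of kBC dB dC p1 p2 eB eC, folded BC, OF mem(3)]
  note dist' = wf_xing_distinct[OF wf(2), of kAB dA dB p0 p1 fA fB, folded AB', OF mem(4)]
    wf_xing_distinct[OF wf(2), of kAC dA dC fA p2 p3 fC, folded AC', OF mem(5)]
    wf_xing_distinct[OF wf(2), of kBC dB dC fB fC p4 p5, folded BC', OF mem(6)]
  note disj = wf_slots_disjoint[OF wf(1) mem(1,2) ne(1)] wf_slots_disjoint[OF wf(1) mem(1,3) ne(2)]
    wf_slots_disjoint[OF wf(1) mem(2,3) ne(3)]
  note disj' = wf_slots_disjoint[OF wf(2) mem(4,5) ne'(1)] wf_slots_disjoint[OF wf(2) mem(4,6) ne'(2)]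
    wf_slots_disjoint[OF wf(2) mem(5,6) ne'(3)]
  note io = ins_xing outs_xing
  have inner: "?M \<inter> {p0, p1, p2, p3, p4, p5} = {}"
    using dist disj by (cases dA; cases dB; cases dC; auto simp: AB AC BC io)
  \<comment> \<open>Distinctness lets the three inner semi-arcs of the new triangle be recolored
    independently.\<close>
  have inner': "?M' \<inter> {p0, p1, p2, p3, p4, p5} = {}" "fA \<noteq> fB" "fA \<noteq> fC" "fB \<noteq> fC"
    using dist' disj' by (cases dA; cases dB; cases dC; auto simp: AB' AC' BC' io)+
  have MR: "?M \<inter> edges R = {}"
  proof -
    have "eA \<notin> edges R"
      by (rule inner_not_outside[OF wf(1) R(1), of "if dA then AB else AC" "if dA then AC else AB"])
        (auto simp: AB AC io)
    moreover have "eB \<notin> edges R"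
      by (rule inner_not_outside[OF wf(1) R(1), of "if dB then AB else BC" "if dB then BC else AB"])
        (auto simp: AB BC io)
    moreover have "eC \<notin> edges R"
      by (rule inner_not_outside[OF wf(1) R(1), of "if dC then AC else BC" "if dC then BC else AC"])
        (auto simp: AC BC io)
    ultimately show ?thesis by blast
  qed
  have MR': "?M' \<inter> edges R = {}"
  proof -
    have "fA \<notin> edges R"
      by (rule inner_not_outside[OF wf(2) R(2), of "if dA then AC' else AB'" "if dA then AB' else AC'"])
        (auto simp: AB' AC' io)
    moreover have "fB \<notin> edges R"
      by (rule inner_not_outside[OF wf(2) R(2), of "if dB then BC' else AB'" "if dB then AB' else BC'"])
        (auto simp: AB' BC' io)
    moreover have "fC \<notin> edges R"
      by (rule inner_not_outside[OF wf(2) R(2), of "if dC then BC' else AC'" "if dC then AC' else BC'"])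
        (auto simp: AC' BC' io)
    ultimately show ?thesis by blast
  qed
  have bd: "edges ?T = {p0, p1, p2, p3, p4, p5} \<union> ?M" "edges ?T' = {p0, p1, p2, p3, p4, p5} \<union> ?M'"
    unfolding edges_insert edges_empty AB AC BC AB' AC' BC' io by (cases dA; cases dB; cases dC; auto)+
  have pA: "passes AC (if dA then p0 else eA) (if dA then eA else p0)" "passes AB (if dA then eA else p3) (if dA then p3 else eA)"
    and pB: "passes BC (if dB then p1 else eB) (if dB then eB else p1)" "passes AB (if dB then eB else p4) (if dB then p4 else eB)"
    and pC: "passes BC (if dC then p2 else eC) (if dC then eC else p2)" "passes AC (if dC then eC else p5) (if dC then p5 else eC)"
    and pA': "passes AB' (if dA then p0 else fA) (if dA then fA else p0)" "passes AC' (if dA then fA else p3) (if dA then p3 else fA)"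
    and pB': "passes AB' (if dB then p1 else fB) (if dB then fB else p1)" "passes BC' (if dB then fB else p4) (if dB then p4 else fB)"
    and pC': "passes AC' (if dC then p2 else fC) (if dC then fC else p2)" "passes BC' (if dC then fC else p5) (if dC then p5 else fC)"
    unfolding AB AC BC AB' AC' BC' by (rule passes_xing)+
  show ?thesis
  proof (rule Psi_classes_subset_local[OF wf, where M = ?M and M' = ?M'])
    show "edges ?T - ?M = edges ?T' - ?M'" using bd inner inner' by auto
    show "\<exists>k e'. e' \<notin> ?M \<and> segment ?T C ?M m k e'" if "m \<in> ?M" for C m
    proof -
      have "\<exists>v\<in>?T. \<exists>e'. e' \<in> {p0, p1, p2, p3, p4, p5} \<and> passes v m e'"
        using that pA pB pC by (cases dA; cases dB; cases dC; auto)
      then obtain v e' where "v \<in> ?T" "e' \<notin> ?M" "passes v m e'" using inner by blast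
      then show ?thesis using segment.single by metis
    qed
    fix C assume C: "\<forall>v\<in>?T. vert_colored S \<beta> C v"
    \<comment> \<open>Every strand starts with weight \<open>\<one>\<close> at its entrance. The
      weight at the other end is the product that has to reappear in the second triangle.\<close>
    obtain a0 ae a3 where a: "a0 \<in> carrier H" "ae \<in> carrier H" "a3 \<in> carrier H"
      "adv dA C AC p0 eA a0 ae" "adv dA C AB eA p3 ae a3" "(if dA then a0 else a3) = \<one>"
      using adv_exists[of dA C AC p0 eA AB p3] by blast
    obtain b1 be b4 where b: "b1 \<in> carrier H" "be \<in> carrier H" "b4 \<in> carrier H"
      "adv dB C BC p1 eB b1 be" "adv dB C AB eB p4 be b4" "(if dB then b1 else b4) = \<one>"
      using adv_exists[of dB C BC p1 eB AB p4] by blast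
    obtain c2 ce c5 where c: "c2 \<in> carrier H" "ce \<in> carrier H" "c5 \<in> carrier H"
      "adv dC C BC p2 eC c2 ce" "adv dC C AC eC p5 ce c5" "(if dC then c2 else c5) = \<one>"
      using adv_exists[of dC C BC p2 eC AC p5] by blast
    have "xrel Sl \<beta>l kAB dA dB (C eA, ae) (C eB, be) (C p3, a3) (C p4, b4)"
      by (subst xrel_lift_iff[OF dist(1) a(2) b(2) a(3) b(3) AB]) (use C a(5) b(5) in simp)
    moreover have "xrel Sl \<beta>l kAC dA dC (C p0, a0) (C eC, ce) (C eA, ae) (C p5, c5)"
      by (subst xrel_lift_iff[OF dist(3) a(1) c(2) a(2) c(3) AC]) (use C a(4) c(5) in simp)
    moreover have "xrel Sl \<beta>l kBC dB dC (C p1, b1) (C p2, c2) (C eB, be) (C eC, ce)"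
      by (subst xrel_lift_iff[OF dist(5) b(1) c(1) b(2) c(2) BC]) (use C b(4) c(4) in simp)
    \<comment> \<open>RIII for the decorated pair yields the inner colors and the inner weights of
      the second triangle at once, with boundary colors and weights kept.\<close>
    ultimately obtain XA XB XC where X: "xrel Sl \<beta>l kAB dA dB (C p0, a0) (C p1, b1) XA XB"
        "xrel Sl \<beta>l kAC dA dC XA (C p2, c2) (C p3, a3) XC" "xrel Sl \<beta>l kBC dB dC XB XC (C p4, b4) (C p5, c5)"
      using lifted.xrel_R3[OF kinds, of dA dB dC] unfolding lifted.YB3_def by blast
    have cl: "snd XA \<in> carrier H" "snd XB \<in> carrier H" "snd XC \<in> carrier H"
      using xrel_lift_closed[OF X(1)] xrel_lift_closed[OF X(2)] a b c by simp_all
    define C' where "C' = C(fA := fst XA, fB := fst XB, fC := fst XC)"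
    have C': "C' fA = fst XA" "C' fB = fst XB" "C' fC = fst XC" "C' p0 = C p0" "C' p1 = C p1"
      "C' p2 = C p2" "C' p3 = C p3" "C' p4 = C p4" "C' p5 = C p5"
      using inner' by (auto simp: C'_def)
    have 1: "vert_colored S \<beta> C' AB' \<and> adv dA C' AB' p0 fA a0 (snd XA) \<and> adv dB C' AB' p1 fB b1 (snd XB)"
      by (subst xrel_lift_iff[OF dist'(1) a(1) b(1) cl(1,2) AB', symmetric]) (use X(1) in \<open>simp add: C'\<close>)
    have 2: "vert_colored S \<beta> C' AC' \<and> adv dA C' AC' fA p3 (snd XA) a3 \<and> adv dC C' AC' p2 fC c2 (snd XC)"
      by (subst xrel_lift_iff[OF dist'(3) cl(1) c(1) a(3) cl(3) AC', symmetric]) (use X(2) in \<open>simp add: C'\<close>)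
    have 3: "vert_colored S \<beta> C' BC' \<and> adv dB C' BC' fB p4 (snd XB) b4 \<and> adv dC C' BC' fC p5 (snd XC) c5"
      by (subst xrel_lift_iff[OF dist'(5) cl(2,3) b(3) c(3) BC', symmetric]) (use X(3) in \<open>simp add: C'\<close>)
    have sA: "segment ?T C ?M ?iA (if dA then a3 else a0) ?oA" "segment ?T' C' ?M' ?iA (if dA then a3 else a0) ?oA"
      using segment_adv[of AC ?T AB eA ?M, OF _ _ _ pA a(4-6)]
        segment_adv[of AB' ?T' AC' fA ?M', OF _ _ _ pA' 1[THEN conjunct2, THEN conjunct1] 2[THEN conjunct2, THEN conjunct1] a(6)]
      by blast+
    have sB: "segment ?T C ?M ?iB (if dB then b4 else b1) ?oB" "segment ?T' C' ?M' ?iB (if dB then b4 else b1) ?oB"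
      using segment_adv[of BC ?T AB eB ?M, OF _ _ _ pB b(4-6)]
        segment_adv[of AB' ?T' BC' fB ?M', OF _ _ _ pB' 1[THEN conjunct2, THEN conjunct2] 3[THEN conjunct2, THEN conjunct1] b(6)]
      by blast+
    have sC: "segment ?T C ?M ?iC (if dC then c5 else c2) ?oC" "segment ?T' C' ?M' ?iC (if dC then c5 else c2) ?oC"
      using segment_adv[of BC ?T AC eC ?M, OF _ _ _ pC c(4-6)]
        segment_adv[of AC' ?T' BC' fC ?M', OF _ _ _ pC' 2[THEN conjunct2, THEN conjunct2] 3[THEN conjunct2, THEN conjunct2] c(6)]
      by blast+
    have o: "?oA \<notin> ?M" "?oB \<notin> ?M" "?oC \<notin> ?M" using inner by auto
    have "\<exists>k e'. e' \<notin> ?M \<and> segment ?T C ?M e k e' \<and> segment ?T' C' ?M' e k e'"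
      if "v \<in> ?T" "e \<in> set (ins v) - ?M" for v e
    proof -
      have "e = ?iA \<or> e = ?iB \<or> e = ?iC"
        using that by (cases dA; cases dB; cases dC; auto simp: AB AC BC io)
      then show ?thesis
        using sA sB sC o by (elim disjE; hypsubst) blast+
    qed
    then show "\<exists>C'. (\<forall>e. e \<notin> ?M' \<longrightarrow> C' e = C e) \<and> (\<forall>v\<in>?T'. vert_colored S \<beta> C' v) \<and>
          (\<forall>v\<in>?T. \<forall>e\<in>set (ins v) - ?M. \<exists>k e'. e' \<notin> ?M \<and> segment ?T C ?M e k e' \<and> segment ?T' C' ?M' e k e')"
      using 1 2 3 by (intro exI[of _ C'] conjI) (simp_all add: C'_def)
  qed (use MR MR' in auto)
qed

end

section \<open>Merged crossings in RIII\<close>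

lemma wf_open_ends_subset:
  assumes wf: "wf_diagram (R \<union> T)" "wf_diagram (R \<union> T')" and R: "R \<inter> T = {}" "R \<inter> T' = {}"
  shows "(\<Union>v\<in>T. set (ins v)) - (\<Union>v\<in>T. set (outs v)) \<subseteq> (\<Union>v\<in>T'. set (ins v)) - (\<Union>v\<in>T'. set (outs v))"
    and "(\<Union>v\<in>T. set (outs v)) - (\<Union>v\<in>T. set (ins v)) \<subseteq> (\<Union>v\<in>T'. set (outs v)) - (\<Union>v\<in>T'. set (ins v))"
proof -
  show "(\<Union>v\<in>T. set (ins v)) - (\<Union>v\<in>T. set (outs v)) \<subseteq> (\<Union>v\<in>T'. set (ins v)) - (\<Union>v\<in>T'. set (outs v))"
  proof
    fix e assume e: "e \<in> (\<Union>v\<in>T. set (ins v)) - (\<Union>v\<in>T. set (outs v))"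
    then obtain v where v: "v \<in> T" "e \<in> set (ins v)" by blast
    obtain u where u: "u \<in> R \<union> T" "e \<in> set (outs u)"
      using wf_ex_out[OF wf(1), of e] v edges_ins[of v "R \<union> T" e] by blast
    then have uR: "u \<in> R" using e by blast
    have "\<forall>w\<in>T'. e \<notin> set (outs w)"
      using u uR R wf_out_unique[OF wf(2), of u _ e] by blast
    moreover obtain w where w: "w \<in> R \<union> T'" "e \<in> set (ins w)"
      using wf_ex_in[OF wf(2), of e] u uR edges_outs[of u "R \<union> T'" e] by blast
    moreover have "w \<notin> R" using wf_in_unique[OF wf(1), of v w e] v w R by blast
    ultimately show "e \<in> (\<Union>v\<in>T'. set (ins v)) - (\<Union>v\<in>T'. set (outs v))" by blast
  qed
  show "(\<Union>v\<in>T. set (outs v)) - (\<Union>v\<in>T. set (ins v)) \<subseteq> (\<Union>v\<in>T'. set (outs v)) - (\<Union>v\<in>T'. set (ins v))"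
  proof
    fix e assume e: "e \<in> (\<Union>v\<in>T. set (outs v)) - (\<Union>v\<in>T. set (ins v))"
    then obtain v where v: "v \<in> T" "e \<in> set (outs v)" by blast
    obtain u where u: "u \<in> R \<union> T" "e \<in> set (ins u)"
      using wf_ex_in[OF wf(1), of e] v edges_outs[of v "R \<union> T" e] by blast
    then have uR: "u \<in> R" using e by blast
    have "\<forall>w\<in>T'. e \<notin> set (ins w)"
      using u uR R wf_in_unique[OF wf(2), of u _ e] by blast
    moreover obtain w where w: "w \<in> R \<union> T'" "e \<in> set (outs w)"
      using wf_ex_out[OF wf(2), of e] u uR edges_ins[of u "R \<union> T'" e] by blast
    moreover have "w \<notin> R" using wf_out_unique[OF wf(1), of v w e] v w R by blast
    ultimately show "e \<in> (\<Union>v\<in>T'. set (outs v)) - (\<Union>v\<in>T'. set (ins v))" by blast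
  qed
qed

text \<open>The open ends of \<open>T\<close> are the labels whose other slot lies in
  \<open>R\<close>, and \<open>R\<close> is common to both diagrams.\<close>

lemma wf_open_ends:
  assumes "wf_diagram (R \<union> T)" "wf_diagram (R \<union> T')" "R \<inter> T = {}" "R \<inter> T' = {}"
  shows "(\<Union>v\<in>T. set (ins v)) - (\<Union>v\<in>T. set (outs v)) = (\<Union>v\<in>T'. set (ins v)) - (\<Union>v\<in>T'. set (outs v))"
    and "(\<Union>v\<in>T. set (outs v)) - (\<Union>v\<in>T. set (ins v)) = (\<Union>v\<in>T'. set (outs v)) - (\<Union>v\<in>T'. set (ins v))"
  using wf_open_ends_subset[OF assms] wf_open_ends_subset[OF assms(2,1,4,3)] by (simp_all only: subset_antisym)

text \<open>A diagram is a set of vertices, so crossings of the triangle that carry the same labels are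
  merged. Well-formedness leaves only four label patterns for this, and in each of them all
  remaining crossings are kinks.\<close>
lemma R3_degenerate_labels:
  assumes wf: "wf_diagram (R \<union> {AB, AC, BC})" "wf_diagram (R \<union> {AB', AC', BC'})"
    and R: "R \<inter> {AB, AC, BC} = {}" "R \<inter> {AB', AC', BC'} = {}"
    and coll: "AB = AC \<or> AB = BC \<or> AC = BC"
    and AB: "AB = xing kAB dA dB eA eB p3 p4" and AC: "AC = xing kAC dA dC p0 eC eA p5"
    and BC: "BC = xing kBC dB dC p1 p2 eB eC"
    and AB': "AB' = xing kAB dA dB p0 p1 fA fB" and AC': "AC' = xing kAC dA dC fA p2 p3 fC"
    and BC': "BC' = xing kBC dB dC fB fC p4 p5"
  shows "dA = dB \<Longrightarrow> dB = dC \<Longrightarrow>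
      p5 = p0 \<and> fB = p0 \<and> eA = p1 \<and> fC = p1 \<and> p3 = p2 \<and> eB = p2 \<and> eC = p4 \<and> fA = p4"
    and "dA = dB \<Longrightarrow> dC = (\<not> dB) \<Longrightarrow>
      eB = p0 \<and> fC = p0 \<and> p2 = p1 \<and> fA = p1 \<and> eC = p3 \<and> fB = p3 \<and> p5 = p4 \<and> eA = p4"
    and "dB = dC \<Longrightarrow> dA = (\<not> dB) \<Longrightarrow>
      p1 = p0 \<and> eC = p0 \<and> eA = p2 \<and> fB = p2 \<and> p4 = p3 \<and> fC = p3 \<and> eB = p5 \<and> fA = p5"
    and "dA = dC \<Longrightarrow> dB = (\<not> dA) \<Longrightarrow>
      eB = eA \<and> eC = eA \<and> fB = fA \<and> fC = fA \<and> p2 = p0 \<and> p4 = p0 \<and> p3 = p1 \<and> p5 = p1"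
proof -
  let ?T = "{AB, AC, BC}" and ?T' = "{AB', AC', BC'}"
  have mem: "AB \<in> R \<union> ?T" "AC \<in> R \<union> ?T" "BC \<in> R \<union> ?T"
    "AB' \<in> R \<union> ?T'" "AC' \<in> R \<union> ?T'" "BC' \<in> R \<union> ?T'" by auto
  note dist = wf_xing_distinct[OF wf(1), of kAB dA dB eA eB p3 p4, folded AB, OF mem(1)]
    wf_xing_distinct[OF wf(1), of kAC dA dC p0 eC eA p5, folded AC, OF mem(2)]
    wf_xing_distinct[OF wf(1), of kBC dB dC p1 p2 eB eC, folded BC, OF mem(3)]
  note dist' = wf_xing_distinct[OF wf(2), of kAB dA dB p0 p1 fA fB, folded AB', OF mem(4)]
    wf_xing_distinct[OF wf(2), of kAC dA dC fA p2 p3 fC, folded AC', OF mem(5)]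
    wf_xing_distinct[OF wf(2), of kBC dB dC fB fC p4 p5, folded BC', OF mem(6)]
  note disj = wf_slots_disjoint[OF wf(1) mem(1,2)] wf_slots_disjoint[OF wf(1) mem(1,3)]
    wf_slots_disjoint[OF wf(1) mem(2,3)]
  note disj' = wf_slots_disjoint[OF wf(2) mem(4,5)] wf_slots_disjoint[OF wf(2) mem(4,6)]
    wf_slots_disjoint[OF wf(2) mem(5,6)]
  \<comment> \<open>The directed boundary labels agree on both sides. With the slot conditions, this
    leaves a finite case analysis of label equalities for each choice of orientations.\<close>
  have bal: "e \<in> set (ins AB) \<union> set (ins AC) \<union> set (ins BC) \<and> e \<notin> set (outs AB) \<union> set (outs AC) \<union> set (outs BC)
     \<longleftrightarrow> e \<in> set (ins AB') \<union> set (ins AC') \<union> set (ins BC') \<and> e \<notin> set (outs AB') \<union> set (outs AC') \<union> set (outs BC')"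
    "e \<in> set (outs AB) \<union> set (outs AC) \<union> set (outs BC) \<and> e \<notin> set (ins AB) \<union> set (ins AC) \<union> set (ins BC)
     \<longleftrightarrow> e \<in> set (outs AB') \<union> set (outs AC') \<union> set (outs BC') \<and> e \<notin> set (ins AB') \<union> set (ins AC') \<union> set (ins BC')" for e
    using wf_open_ends[OF wf R, THEN eqset_imp_iff, of e] by (simp_all only: UN_insert UN_empty Un_empty_right Diff_iff Un_assoc)
  have all: "(dA = dB \<longrightarrow> dB = dC \<longrightarrow>
      p5 = p0 \<and> fB = p0 \<and> eA = p1 \<and> fC = p1 \<and> p3 = p2 \<and> eB = p2 \<and> eC = p4 \<and> fA = p4)
    \<and> (dA = dB \<longrightarrow> dC = (\<not> dB) \<longrightarrow>
      eB = p0 \<and> fC = p0 \<and> p2 = p1 \<and> fA = p1 \<and> eC = p3 \<and> fB = p3 \<and> p5 = p4 \<and> eA = p4)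
    \<and> (dB = dC \<longrightarrow> dA = (\<not> dB) \<longrightarrow>
      p1 = p0 \<and> eC = p0 \<and> eA = p2 \<and> fB = p2 \<and> p4 = p3 \<and> fC = p3 \<and> eB = p5 \<and> fA = p5)
    \<and> (dA = dC \<longrightarrow> dB = (\<not> dA) \<longrightarrow>
      eB = eA \<and> eC = eA \<and> fB = fA \<and> fC = fA \<and> p2 = p0 \<and> p4 = p0 \<and> p3 = p1 \<and> p5 = p1)"
    using coll dist dist' disj disj' bal[of p0] bal[of p1] bal[of p2] bal[of p3] bal[of p4] bal[of p5]
    unfolding AB AC BC AB' AC' BC' ins_xing outs_xing
    by (cases dA; cases dB; cases dC; simp only: xing_eq_Cr if_True if_False simp_thms vert.inject
        Un_iff insert_iff empty_iff disjoint_insert insert_disjoint; smt (z3))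
  then show "dA = dB \<Longrightarrow> dB = dC \<Longrightarrow>
      p5 = p0 \<and> fB = p0 \<and> eA = p1 \<and> fC = p1 \<and> p3 = p2 \<and> eB = p2 \<and> eC = p4 \<and> fA = p4"
    and "dA = dB \<Longrightarrow> dC = (\<not> dB) \<Longrightarrow>
      eB = p0 \<and> fC = p0 \<and> p2 = p1 \<and> fA = p1 \<and> eC = p3 \<and> fB = p3 \<and> p5 = p4 \<and> eA = p4"
    and "dB = dC \<Longrightarrow> dA = (\<not> dB) \<Longrightarrow>
      p1 = p0 \<and> eC = p0 \<and> eA = p2 \<and> fB = p2 \<and> p4 = p3 \<and> fC = p3 \<and> eB = p5 \<and> fA = p5"
    and "dA = dC \<Longrightarrow> dB = (\<not> dA) \<Longrightarrow>
      eB = eA \<and> eC = eA \<and> fB = fA \<and> fC = fA \<and> p2 = p0 \<and> p4 = p0 \<and> p3 = p1 \<and> p5 = p1"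
    by blast+
qed

text \<open>A kink with loop \<open>l\<close> on its right or left side, and the plain marker to
  which RI reduces it.\<close>

definition kinked :: "vert \<Rightarrow> vert \<Rightarrow> bool" where
  "kinked v m \<longleftrightarrow> (\<exists>k a c l. (v = Cr k a l c l \<or> v = Cr k l a l c) \<and> m = Mark a c)"

lemma kinkedI: "kinked (Cr k a l c l) (Mark a c)" "kinked (Cr k l a l c) (Mark a c)"
  by (auto simp: kinked_def)

lemma wf_unkink:
  assumes wf: "wf_diagram (R \<union> {v})" and v: "v \<notin> R" and "kinked v m"
  shows "wf_diagram (R \<union> {m})" and "m \<notin> R"
proof -
  obtain k a c l where kk: "v = Cr k a l c l \<or> v = Cr k l a l c" and m: "m = Mark a c"
    using assms(3) by (auto simp: kinked_def)
  have ne: "a \<noteq> l" "c \<noteq> l"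
    using kk wf_crossing_distinct[OF wf] by (metis UnCI singletonI)+
  have lR: "l \<notin> edges R"
    by (rule inner_not_outside[OF wf, of v v]) (use kk v in auto)
  have "v = m" if "m \<in> R"
    by (rule wf_in_unique[OF wf, of _ _ a]) (use kk that in \<open>auto simp: m\<close>)
  then show mR: "m \<notin> R" using v by blast
  have fin: "finite R" using wf_finite[OF wf] by simp
  have eq: "count_list (ins m) e = count_list (ins v) e" "count_list (outs m) e = count_list (outs v) e"
    if "e \<noteq> l" for e
    using kk that by (auto simp: m)
  show "wf_diagram (R \<union> {m})"
    unfolding wf_diagram_def
  proof (intro conjI ballI)
    fix e assume "e \<in> edges (R \<union> {m})"
    then have el: "e \<noteq> l" and e: "e \<in> edges (R \<union> {v})"
      using ne lR kk by (auto simp: edges_Un edges_insert edges_empty m)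
    have "(\<Sum>u\<in>R \<union> {v}. count_list (ins u) e) = 1" "(\<Sum>u\<in>R \<union> {v}. count_list (outs u) e) = 1"
      using wf e by (auto simp: wf_diagram_def)
    then show "(\<Sum>u\<in>R \<union> {m}. count_list (ins u) e) = 1" "(\<Sum>u\<in>R \<union> {m}. count_list (outs u) e) = 1"
      using fin v mR by (simp_all add: eq[OF el])
  qed (use fin in simp)
qed

context cocycle
begin

lemma Psi_classes_unkink:
  assumes wf: "wf_diagram (R \<union> {v})" and v: "v \<notin> R" and "kinked v m"
  shows "Psi_classes (R \<union> {v}) = Psi_classes (R \<union> {m})"
proof -
  obtain k a c l where kk: "v = Cr k a l c l \<or> v = Cr k l a l c" and m: "m = Mark a c"
    using assms(3) by (auto simp: kinked_def)
  obtain k' where k': "sign k' = k"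
    by (metis ckind.exhaust sign.simps)
  have "sign (opposite (opposite k')) = k" using k' by (cases k') auto
  then have x: "v = xing k' True True a l l c \<or> v = xing (opposite k') True (\<not> True) a c l l"
    using kk k' by (auto simp: xing_eq_Cr)
  have ma: "m = arc True a c" by (simp add: m arc_def)
  have wfm: "wf_diagram (R \<union> {arc True a c})" using wf_unkink(1)[OF assms] unfolding ma .
  from x show ?thesis unfolding ma
    using Psi_classes_R1[OF wfm wf v] by blast
qed

lemma Psi_classes_two_kinks:
  assumes wf: "wf_diagram (R \<union> {v, w})" and R: "R \<inter> {v, w} = {}" and ne: "v \<noteq> w"
    and k: "kinked v m" "kinked w n"
  shows "Psi_classes (R \<union> {v, w}) = Psi_classes (R \<union> {m, n})"
proof -
  have nm: "w \<noteq> m" using k by (auto simp: kinked_def)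
  have 1: "wf_diagram (insert w R \<union> {v})" "v \<notin> insert w R" using wf R ne by (simp_all add: insert_commute)
  have "wf_diagram (insert w R \<union> {m})" by (rule wf_unkink(1)[OF 1 k(1)])
  then have 2: "wf_diagram (insert m R \<union> {w})" "w \<notin> insert m R"
    using R nm by (simp_all add: insert_commute)
  show ?thesis
    using Psi_classes_unkink[OF 1 k(1)] Psi_classes_unkink[OF 2 k(2)] by (simp add: insert_commute)
qed

text \<open>Removing the kinks by RI leaves the same markers on both sides: a circle of two markers
  in the first three patterns, a single marker in the last.\<close>

lemma Psi_classes_R3_degenerate:
  assumes wf: "wf_diagram (R \<union> {AB, AC, BC})" "wf_diagram (R \<union> {AB', AC', BC'})"
    and R: "R \<inter> {AB, AC, BC} = {}" "R \<inter> {AB', AC', BC'} = {}"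
    and coll: "AB = AC \<or> AB = BC \<or> AC = BC"
    and AB: "AB = xing kAB dA dB eA eB p3 p4" and AC: "AC = xing kAC dA dC p0 eC eA p5"
    and BC: "BC = xing kBC dB dC p1 p2 eB eC"
    and AB': "AB' = xing kAB dA dB p0 p1 fA fB" and AC': "AC' = xing kAC dA dC fA p2 p3 fC"
    and BC': "BC' = xing kBC dB dC fB fC p4 p5"
  shows "Psi_classes (R \<union> {AB, AC, BC}) = Psi_classes (R \<union> {AB', AC', BC'})"
proof -
  let ?T = "{AB, AC, BC}" and ?T' = "{AB', AC', BC'}"
  note labels = R3_degenerate_labels[OF wf R coll AB AC BC AB' AC' BC']
  have mem: "AB \<in> R \<union> ?T" "AC \<in> R \<union> ?T" "BC \<in> R \<union> ?T"
    "AB' \<in> R \<union> ?T'" "AC' \<in> R \<union> ?T'" "BC' \<in> R \<union> ?T'" by auto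
  note dist = wf_xing_distinct[OF wf(1), of kAB dA dB eA eB p3 p4, folded AB, OF mem(1)]
    wf_xing_distinct[OF wf(1), of kAC dA dC p0 eC eA p5, folded AC, OF mem(2)]
    wf_xing_distinct[OF wf(1), of kBC dB dC p1 p2 eB eC, folded BC, OF mem(3)]
  note dist' = wf_xing_distinct[OF wf(2), of kAB dA dB p0 p1 fA fB, folded AB', OF mem(4)]
    wf_xing_distinct[OF wf(2), of kAC dA dC fA p2 p3 fC, folded AC', OF mem(5)]
    wf_xing_distinct[OF wf(2), of kBC dB dC fB fC p4 p5, folded BC', OF mem(6)]
  note io = ins_xing outs_xing
  consider (1) "dA = dB" "dB = dC" | (2) "dA = dB" "dC = (\<not> dB)" | (3) "dB = dC" "dA = (\<not> dB)"
    | (4) "dA = dC" "dB = (\<not> dA)" by blast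
  then show ?thesis
  proof cases
    case 1
    note l = labels(1)[OF 1]
    \<comment> \<open>Under this pattern the two crossings share an incoming label, so they are the
      same vertex; the other cases use shared labels in the same way.\<close>
    have "AB = BC" by (rule wf_in_unique[OF wf(1) mem(1,3), of "if dB then p2 else p4"]) (simp_all add: 1 l AB BC io)
    moreover have "AB' = BC'" by (rule wf_in_unique[OF wf(2) mem(4,6), of "if dB then p0 else p4"]) (simp_all add: 1 l AB' BC' io)
    ultimately have T: "?T = {AB, AC}" "?T' = {AB', AC'}" by auto
    have "AB \<noteq> AC" "AB' \<noteq> AC'"
      using dist dist' by (cases dC; simp add: 1 l AB AC AB' AC' xing_eq_Cr)+
    moreover have "kinked AB (if dB then Mark p1 p4 else Mark p4 p1)" "kinked AC (if dB then Mark p4 p1 else Mark p1 p4)"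
      "kinked AB' (if dB then Mark p1 p4 else Mark p4 p1)" "kinked AC' (if dB then Mark p4 p1 else Mark p1 p4)"
      by (cases dC; simp add: 1 l kinkedI AB AC AB' AC' xing_eq_Cr)+
    ultimately show ?thesis
      using Psi_classes_two_kinks[OF wf(1)[unfolded T] R(1)[unfolded T]]
        Psi_classes_two_kinks[OF wf(2)[unfolded T] R(2)[unfolded T]] unfolding T by metis
  next
    case 2
    note l = labels(2)[OF 2]
    have "AB = AC" by (rule wf_in_unique[OF wf(1) mem(1,2), of "if dB then p4 else p3"]) (simp_all add: 2 l AB AC io)
    moreover have "AB' = AC'" by (rule wf_in_unique[OF wf(2) mem(4,5), of "if dB then p1 else p3"]) (simp_all add: 2 l AB' AC' io)
    ultimately have T: "?T = {AB, BC}" "?T' = {AB', BC'}" by auto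
    have "AB \<noteq> BC" "AB' \<noteq> BC'"
      using dist dist' by (cases dB; simp add: 2 l AB BC AB' BC' xing_eq_Cr)+
    moreover have "kinked AB (if dB then Mark p0 p3 else Mark p3 p0)" "kinked BC (if dB then Mark p3 p0 else Mark p0 p3)"
      "kinked AB' (if dB then Mark p0 p3 else Mark p3 p0)" "kinked BC' (if dB then Mark p3 p0 else Mark p0 p3)"
      by (cases dB; simp add: 2 l kinkedI AB BC AB' BC' xing_eq_Cr)+
    ultimately show ?thesis
      using Psi_classes_two_kinks[OF wf(1)[unfolded T] R(1)[unfolded T]]
        Psi_classes_two_kinks[OF wf(2)[unfolded T] R(2)[unfolded T]] unfolding T by metis
  next
    case 3
    note l = labels(3)[OF 3]
    have "AC = BC" by (rule wf_in_unique[OF wf(1) mem(2,3), of "if dB then p0 else p5"]) (simp_all add: 3 l AC BC io)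
    moreover have "AC' = BC'" by (rule wf_in_unique[OF wf(2) mem(5,6), of "if dB then p2 else p3"]) (simp_all add: 3 l AC' BC' io)
    ultimately have T: "?T = {AB, BC}" "?T' = {AB', BC'}" by auto
    have "AB \<noteq> BC" "AB' \<noteq> BC'"
      using dist dist' by (cases dB; simp add: 3 l AB BC AB' BC' xing_eq_Cr)+
    moreover have "kinked AB (if dB then Mark p5 p2 else Mark p2 p5)" "kinked BC (if dB then Mark p2 p5 else Mark p5 p2)"
      "kinked AB' (if dB then Mark p5 p2 else Mark p2 p5)" "kinked BC' (if dB then Mark p2 p5 else Mark p5 p2)"
      by (cases dB; simp add: 3 l kinkedI AB BC AB' BC' xing_eq_Cr)+
    ultimately show ?thesis
      using Psi_classes_two_kinks[OF wf(1)[unfolded T] R(1)[unfolded T]]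
        Psi_classes_two_kinks[OF wf(2)[unfolded T] R(2)[unfolded T]] unfolding T by metis
  next
    case 4
    note l = labels(4)[OF 4]
    have "AB = AC" by (rule wf_in_unique[OF wf(1) mem(1,2), of eA]) (simp_all add: 4 l AB AC io)
    moreover have "AB = BC" by (rule wf_in_unique[OF wf(1) mem(1,3), of eA]) (simp_all add: 4 l AB BC io)
    ultimately have T: "?T = {AB}" by auto
    have "AB' = AC'" by (rule wf_in_unique[OF wf(2) mem(4,5), of fA]) (simp_all add: 4 l AB' AC' io)
    moreover have "AB' = BC'" by (rule wf_in_unique[OF wf(2) mem(4,6), of fA]) (simp_all add: 4 l AB' BC' io)
    ultimately have T': "?T' = {AB'}" by auto
    have "kinked AB (if dA then Mark p0 p1 else Mark p1 p0)" "kinked AB' (if dA then Mark p0 p1 else Mark p1 p0)"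
      by (cases dA; simp add: 4 l kinkedI AB AB' xing_eq_Cr)+
    then show ?thesis
      using Psi_classes_unkink[of R AB] Psi_classes_unkink[of R AB'] wf R unfolding T T' by simp
  qed
qed

end

section \<open>Half-turns, subdivision, relabeling, and the moves in general\<close>

lemma xing_rotate: "xing k dP dQ P0 Q0 P1 Q1 = xing k (\<not> dP) (\<not> dQ) P1 Q1 P0 Q0"
  by (cases dP; cases dQ; simp add: xing_eq_Cr)

lemma ins_map_vert: "ins (map_vert h v) = map h (ins v)"
  and outs_map_vert: "outs (map_vert h v) = map h (outs v)"
  by (cases v; simp)+

lemma passes_map_vert: "passes v e m \<Longrightarrow> passes (map_vert h v) (h e) (h m)"
  by (cases v) auto

lemma edges_map_vert: "edges (map_vert h ` D) = h ` edges D"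
  by (auto simp: edges_def ins_map_vert outs_map_vert)

lemma vert_colored_map_vert: "vert_colored S \<beta> C (map_vert h v) \<longleftrightarrow> vert_colored S \<beta> (C \<circ> h) v"
proof (cases v)
  case (Cr k a b c d)
  then show ?thesis by (cases k) auto
qed auto

lemma vert_weight_map_vert:
  "inj h \<Longrightarrow> vert_weight H f g C (map_vert h v) (h e) = vert_weight H f g (C \<circ> h) v e"
proof (cases v)
  case (Cr k a b c d)
  then show "inj h \<Longrightarrow> vert_weight H f g C (map_vert h v) (h e) = vert_weight H f g (C \<circ> h) v e"
    by (cases k) (auto simp: inj_eq)
qed auto

lemma ins_rename_in: "set (ins (rename_in e0 e1 v)) = (\<lambda>e. if e = e0 then e1 else e) ` set (ins v)"
  and outs_rename_in: "outs (rename_in e0 e1 v) = outs v"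
  by (cases v; simp)+

lemma passes_rename_in:
  "passes v e m \<Longrightarrow> passes (rename_in e0 e1 v) (if e = e0 then e1 else e) m"
  by (cases v) auto

lemma vert_colored_rename_in:
  assumes "\<And>e. e \<in> set (ins v) \<union> set (outs v) \<Longrightarrow> C' e = C e" "C' e1 = C e0"
  shows "vert_colored S \<beta> C' (rename_in e0 e1 v) \<longleftrightarrow> vert_colored S \<beta> C v"
proof (cases v)
  case (Cr k a b c d)
  then show ?thesis using assms by (cases k) auto
qed (use assms in auto)

lemma vert_weight_rename_in:
  assumes "\<And>e. e \<in> set (ins v) \<union> set (outs v) \<Longrightarrow> C' e = C e" "C' e1 = C e0"
    and "e \<noteq> e1" "e1 \<notin> set (ins v)"
  shows "vert_weight H f g C' (rename_in e0 e1 v) (if e = e0 then e1 else e) = vert_weight H f g C v e"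
proof (cases v)
  case (Cr k a b c d)
  then show ?thesis using assms by (cases k) auto
qed simp

context cocycle
begin

lemma Psi_classes_R3:
  assumes wf: "wf_diagram (R \<union> {AB, AC, BC})" "wf_diagram (R \<union> {AB', AC', BC'})"
    and R: "R \<inter> {AB, AC, BC} = {}" "R \<inter> {AB', AC', BC'} = {}"
    and kinds: "r3_kinds kAB kAC kBC"
    and AB: "AB = xing kAB dA dB eA eB p3 p4" and AC: "AC = xing kAC dA dC p0 eC eA p5"
    and BC: "BC = xing kBC dB dC p1 p2 eB eC"
    and AB': "AB' = xing kAB dA dB p0 p1 fA fB" and AC': "AC' = xing kAC dA dC fA p2 p3 fC"
    and BC': "BC' = xing kBC dB dC fB fC p4 p5"
  shows "Psi_classes (R \<union> {AB, AC, BC}) = Psi_classes (R \<union> {AB', AC', BC'})"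
proof -
  \<comment> \<open>After a half-turn the second triangle has the form of the first, with all
    orientations negated and the inner labels \<open>fA\<close>, \<open>fB\<close>,
    \<open>fC\<close> in place of \<open>eA\<close>, \<open>eB\<close>, \<open>eC\<close>.\<close>
  note rot = AB'[unfolded xing_rotate[of _ dA]] AC'[unfolded xing_rotate[of _ dA]] BC'[unfolded xing_rotate[of _ dB]]
    AB[unfolded xing_rotate[of _ dA]] AC[unfolded xing_rotate[of _ dA]] BC[unfolded xing_rotate[of _ dB]]
  consider "AB = AC \<or> AB = BC \<or> AC = BC" | "AB' = AC' \<or> AB' = BC' \<or> AC' = BC'"
    | (generic) "AB \<noteq> AC" "AB \<noteq> BC" "AC \<noteq> BC" "AB' \<noteq> AC'" "AB' \<noteq> BC'" "AC' \<noteq> BC'" by blast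
  then show ?thesis
  proof cases
    case 1
    then show ?thesis using Psi_classes_R3_degenerate[OF wf R 1 AB AC BC AB' AC' BC'] by blast
  next
    case 2
    then show ?thesis using Psi_classes_R3_degenerate[OF wf(2,1) R(2,1) 2 rot] by blast
  next
    case generic
    show ?thesis
      using Psi_classes_R3_subset[OF wf R generic kinds AB AC BC AB' AC' BC']
        Psi_classes_R3_subset[OF wf(2,1) R(2,1) generic(4-6,1-3) kinds rot] by blast
  qed
qed

lemma Psi_circle:
  assumes "wf_diagram D" "Mark x x \<in> D"
  shows "\<Psi> D C x = \<one>"
proof (rule Psi_eqI[OF assms(1)])
  show "x \<in> edges D" using edges_ins[OF assms(2)] by simp
  show "first_return D C x 1 x \<one>"
    using first_return.last[OF assms(2), of x x C] by simp
qed

text \<open>A plain circle contributes the class of \<open>\<one>\<close> for every coloring, which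
  the circle at \<open>y\<close> contributes already. Colorings are functions on all labels, so the
  extra circle does not restrict them.\<close>

lemma Psi_classes_drop_circle:
  assumes wf: "wf_diagram D" "wf_diagram (insert (Mark x x) D)" and y: "Mark y y \<in> D"
  shows "Psi_classes (insert (Mark x x) D) = Psi_classes D"
proof -
  let ?D = "insert (Mark x x) D"
  have ed: "edges ?D = insert x (edges D)" by (simp add: edges_insert)
  have yD: "y \<in> edges D" using edges_ins[OF y] by simp
  have col: "colorings S \<beta> ?D = colorings S \<beta> D" by (auto simp: colorings_def)
  have eq: "\<Psi> ?D C e = \<Psi> D C e" if "e \<in> edges D" for C e
  proof (rule Psi_transfer[OF wf _ _ _ _ _ that, where M = "{}" and M' = "{}"])
    fix e assume "e \<in> edges D"
    then obtain v m where v: "v \<in> D" "passes v e m" using wf_ex_passes[OF wf(1)] by metis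
    then have "m \<in> edges D" using passes_in_out edges_outs by metis
    then show "\<exists>k e'. e' \<in> edges D \<and> segment D C {} e k e' \<and> segment ?D C {} e k e'"
      using segment.single[OF v] segment.single[of v ?D e m C "{}"] v by blast
  qed (auto simp: ed)
  have one: "\<Psi> ?D C x = \<Psi> D C y" for C
    using Psi_circle[OF wf(2), of x C] Psi_circle[OF wf(1) y, of C] by simp
  show ?thesis
  proof (intro equalityI subsetI)
    fix z assume "z \<in> Psi_classes ?D"
    then obtain C e where *: "z = conj_class H (\<Psi> ?D C e)" "e \<in> edges ?D" "C \<in> colorings S \<beta> D"
      unfolding Psi_classes_def col by blast
    then show "z \<in> Psi_classes D"
    proof (cases "e \<in> edges D")
      case True
      then have "z = conj_class H (\<Psi> D C e)" using * eq by simp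
      then show ?thesis using * True unfolding Psi_classes_def by blast
    next
      case False
      then have "e = x" using * by (simp add: ed)
      then have "z = conj_class H (\<Psi> D C y)" using * one by simp
      then show ?thesis using * yD unfolding Psi_classes_def by blast
    qed
  next
    fix z assume "z \<in> Psi_classes D"
    then obtain C e where *: "z = conj_class H (\<Psi> D C e)" "e \<in> edges D" "C \<in> colorings S \<beta> D"
      unfolding Psi_classes_def by blast
    then have "z = conj_class H (\<Psi> ?D C e)" "e \<in> edges ?D" using eq by (auto simp: ed)
    then show "z \<in> Psi_classes ?D" using *(3) unfolding Psi_classes_def col by blast
  qed
qed

text \<open>As in the case of RIII, the two crossings of the bigon may be the same vertex.\<close>
lemma Psi_classes_R2_degenerate:
  assumes wf: "wf_diagram (R \<union> {arc dS q0 q3, arc dT q1 q2})" "wf_diagram (R \<union> {U, W})"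
    and R: "R \<inter> {arc dS q0 q3, arc dT q1 q2} = {}" "R \<inter> {U, W} = {}" and UW: "U = W"
    and U: "U = xing k dS dT q0 q1 s t" and W: "W = xing (opposite k) dT dS t s q2 q3"
  shows "Psi_classes (R \<union> {arc dS q0 q3, arc dT q1 q2}) = Psi_classes (R \<union> {U, W})"
proof (cases "dS = dT")
  case True
  \<comment> \<open>For parallel strands the merged bigon is one closed curve with a single
    crossing, while the plain side consists of two circles. The component counts differ, but every
    component involved contributes only the class of \<open>\<one>\<close>.\<close>
  have l: "t = q0" "q3 = q0" "s = q1" "q2 = q1" and Ueq: "U = Cr (sign k) q0 q1 q0 q1 \<or> U = Cr (sign k) q1 q0 q1 q0"
    using UW True U W by (cases dS; auto simp: xing_eq_Cr)+
  have T: "{arc dS q0 q3, arc dT q1 q2} = {Mark q0 q0, Mark q1 q1}" by (auto simp: l arc_def)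
  have k: "kinked U (Mark q1 q1)" using Ueq by (auto simp: kinkedI)
  have UR: "U \<notin> R" and wfU: "wf_diagram (R \<union> {U})" using R wf UW by auto
  have "Psi_classes (R \<union> {U}) = Psi_classes (R \<union> {Mark q1 q1})"
    by (rule Psi_classes_unkink[OF wfU UR k])
  also have "\<dots> = Psi_classes (insert (Mark q0 q0) (R \<union> {Mark q1 q1}))"
    by (rule Psi_classes_drop_circle[symmetric, OF wf_unkink(1)[OF wfU UR k]]) (use wf(1) T in auto)
  finally show ?thesis unfolding T using UW by simp
next
  case False
  have l: "t = s \<and> q2 = q0 \<and> q3 = q1"
    using UW False U W by (cases dS; cases dT) (metis xing_eq_Cr vert.inject(2))+
  have dT: "dT = (\<not> dS)" using False by blast
  \<comment> \<open>For antiparallel strands the two plain arcs coincide as well, and the merged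
    crossing is a kink on this one arc.\<close>
  have "{arc dS q0 q3, arc dT q1 q2} = {arc dS q0 q1}" by (simp add: l dT arc_def)
  moreover have k: "kinked U (arc dS q0 q1)"
    by (cases dS; simp add: U l dT xing_eq_Cr arc_def kinkedI)
  moreover have "U \<notin> R" "wf_diagram (R \<union> {U})" using R wf UW by auto
  ultimately show ?thesis using Psi_classes_unkink[OF _ _ k, of R] UW by simp
qed

lemma Psi_classes_local_move:
  assumes "wf_diagram D" "wf_diagram D'" "local_move D D'"
  shows "Psi_classes D = Psi_classes D'"
proof -
  obtain R T T' where D: "D = R \<union> T" "D' = R \<union> T'" and R: "R \<inter> T = {}" "R \<inter> T' = {}"
    and m: "move_R1 T T' \<or> move_R2 T T' \<or> move_R3 T T'"
    using assms(3) unfolding local_move_def by blast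
  note wf = assms(1,2)[unfolded D]
  from m show ?thesis
  proof (elim disjE)
    assume "move_R1 T T'"
    then obtain dir q0 q1 l ov where T: "T = {arc dir q0 q1}"
      and T': "T' = {gx ov (q0, dir) (l, dir) (l, \<not> dir) (q1, \<not> dir)} \<or>
       T' = {gx ov (q0, dir) (q1, \<not> dir) (l, \<not> dir) (l, dir)}"
      unfolding move_R1_def by blast
    obtain k where ov: "ov = ov_first02 k" by (metis over_info.exhaust ov_first02.simps)
    obtain v where v: "T' = {v}" "v = xing k dir dir q0 l l q1 \<or> v = xing k dir (\<not> dir) q0 q1 l l"
      using T' unfolding ov xing_def by auto
    have "v \<notin> R" using R v by blast
    from Psi_classes_R1[OF wf[unfolded T v(1)] this v(2)] show ?thesis unfolding D T v(1) .
  next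
    assume "move_R2 T T'"
    then obtain dS dT q0 q1 q2 q3 sM tM ovU ovW where
      ov: "(ovU, ovW) \<in> {(Over02, Over13), (Over13, Over02), (OVirt, OVirt)}"
      and T: "T = {arc dS q0 q3, arc dT q1 q2}"
      and T': "T' = {gx ovU (q0, dS) (q1, dT) (sM, \<not> dS) (tM, \<not> dT),
            gx ovW (tM, dT) (sM, dS) (q2, \<not> dT) (q3, \<not> dS)}"
      unfolding move_R2_def by blast
    have "\<exists>k. ovU = ov_first02 k \<and> ovW = ov_first02 (opposite k)"
      using ov by (metis insert_iff empty_iff prod.inject opposite.simps ov_first02.simps)
    then obtain k where "ovU = ov_first02 k" "ovW = ov_first02 (opposite k)" by blast
    then have T': "T' = {xing k dS dT q0 q1 sM tM, xing (opposite k) dT dS tM sM q2 q3}"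
      using T' by (simp add: xing_def)
    note wf' = wf[unfolded T T'] and R' = R[unfolded T T']
    show ?thesis
    proof (cases "xing k dS dT q0 q1 sM tM = xing (opposite k) dT dS tM sM q2 q3")
      case True
      from Psi_classes_R2_degenerate[OF wf' R' this refl refl] show ?thesis unfolding D T T' .
    next
      case False
      from Psi_classes_R2[OF wf' R'(2) this refl refl] show ?thesis unfolding D T T' .
    qed
  next
    assume "move_R3 T T'"
    then obtain dA dB dC p0 p1 p2 p3 p4 p5 eA eB eC fA fB fC kAB kAC kBC where
      kinds: "r3_kinds kAB kAC kBC" and
      T: "T = {xing kAB dA dB eA eB p3 p4, xing kAC dA dC p0 eC eA p5, xing kBC dB dC p1 p2 eB eC}" and
      T': "T' = {xing kAB dA dB p0 p1 fA fB, xing kAC dA dC fA p2 p3 fC, xing kBC dB dC fB fC p4 p5}"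
      unfolding move_R3_def gx_eq_xing by blast
    from Psi_classes_R3[OF wf[unfolded T T'] R[unfolded T T'] kinds refl refl refl refl refl refl]
    show ?thesis unfolding D T T' .
  qed
qed

text \<open>The new label \<open>e1\<close> has to carry the color of \<open>e0\<close>, and the
  marker contributes \<open>\<one>\<close>; so the semi-arcs of \<open>D\<close> are joined by the
  same products in both diagrams.\<close>

lemma Psi_classes_subdivide:
  assumes wf: "wf_diagram D" "wf_diagram D'" and "subdivide D D'"
  shows "Psi_classes D = Psi_classes D'"
proof -
  obtain e0 e1 where e0: "e0 \<in> edges D" and e1: "e1 \<notin> edges D"
    and D': "D' = rename_in e0 e1 ` D \<union> {Mark e0 e1}"
    using assms(3) unfolding subdivide_def by blast
  let ?r = "\<lambda>e. if e = e0 then e1 else e"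
  have labels: "set (ins v) \<union> set (outs v) \<subseteq> edges D" if "v \<in> D" for v
    using that by (auto simp: edges_def)
  have BD: "edges D \<subseteq> edges D'"
  proof
    fix e assume "e \<in> edges D"
    then obtain v where "v \<in> D" "e \<in> set (outs v)" using wf_ex_out[OF wf(1)] by blast
    then have "rename_in e0 e1 v \<in> D'" "e \<in> set (outs (rename_in e0 e1 v))" by (auto simp: D' outs_rename_in)
    then show "e \<in> edges D'" using edges_outs by blast
  qed
  have D'B: "edges D' \<subseteq> insert e1 (edges D)"
    using e0 labels by (auto simp: D' edges_def ins_rename_in outs_rename_in split: if_splits)
  have seg: "\<exists>k e'. e' \<in> edges D \<and> segment D C {} e k e' \<and> segment D' C' {e1} e k e'"
    if e: "e \<in> edges D" and CC: "\<And>e. e \<in> edges D \<Longrightarrow> C' e = C e" "C' e1 = C e0" for e C C'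
  proof -
    obtain v m where v: "v \<in> D" "passes v e m" using wf_ex_passes[OF wf(1) e] by metis
    have m: "m \<in> edges D" using passes_in_out v edges_outs by metis
    have w: "vw C' (rename_in e0 e1 v) (?r e) = vw C v e"
      by (rule vert_weight_rename_in) (use CC labels[OF v(1)] e e1 in auto)
    have rv: "rename_in e0 e1 v \<in> D'" using v by (simp add: D')
    have s: "segment D' C' {e1} (?r e) (vw C v e) m"
      using segment.single[OF rv passes_rename_in[OF v(2)], of C' "{e1}"] w by simp
    \<comment> \<open>From \<open>e0\<close> the subdivided diagram needs one step more, through the
      marker to \<open>e1\<close>; elsewhere the renamed vertex is reached directly.\<close>
    have "segment D' C' {e1} e (vw C v e) m"
    proof (cases "e = e0")
      case True
      then show ?thesis
        using segment.step[of "Mark e0 e1" D' e0 e1 "{e1}" C' "vw C v e" m] s by (simp add: D')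
    qed (use s in simp)
    then show ?thesis using segment.single[OF v, of C "{}"] m by blast
  qed
  have "Psi_classes D \<subseteq> Psi_classes D'"
  proof (rule Psi_classes_subset[OF wf, where B = "edges D" and M = "{}" and M' = "{e1}"])
    fix C assume C: "C \<in> colorings S \<beta> D"
    define C' where "C' = C(e1 := C e0)"
    have CC: "C' e = C e" if "e \<in> edges D" for e using that e1 by (auto simp: C'_def)
    have C1: "C' e1 = C e0" by (simp add: C'_def)
    have "vert_colored S \<beta> C' (rename_in e0 e1 v)" if "v \<in> D" for v
      using vert_colored_rename_in[of v C' C e1 e0 S \<beta>] CC C1 labels[OF that] C that
      unfolding colorings_def by blast
    then have "C' \<in> colorings S \<beta> D'"
      using CC[OF e0] C1 by (auto simp: colorings_def D')
    then show "\<exists>C'\<in>colorings S \<beta> D'. \<forall>e\<in>edges D. \<exists>k e'. e' \<in> edges D \<and>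
        segment D C {} e k e' \<and> segment D' C' {e1} e k e'"
      using seg[of _ C' C] CC C1 by blast
  qed (use BD e1 in auto)
  moreover have "Psi_classes D' \<subseteq> Psi_classes D"
  proof (rule Psi_classes_subset[OF wf(2,1), where B = "edges D" and M' = "{}" and M = "{e1}"])
    fix C e assume "e \<in> edges D' - edges D"
    then have "e = e1" using D'B by blast
    moreover obtain v m where v: "v \<in> D" "passes v e0 m" using wf_ex_passes[OF wf(1) e0] by metis
    moreover have "m \<in> edges D" using passes_in_out v edges_outs by metis
    moreover have "rename_in e0 e1 v \<in> D'" "passes (rename_in e0 e1 v) e1 m"
      using v passes_rename_in[OF v(2), of e0 e1] by (auto simp: D')
    ultimately show "\<exists>k e'. e' \<in> edges D \<and> segment D' C {e1} e k e'"
      using segment.single by blast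
  next
    fix C assume C: "C \<in> colorings S \<beta> D'"
    then have C1: "C e1 = C e0" by (auto simp: colorings_def D')
    have "vert_colored S \<beta> C v" if "v \<in> D" for v
      using vert_colored_rename_in[of v C C e1 e0 S \<beta>] C1 C that by (auto simp: colorings_def D')
    then have "C \<in> colorings S \<beta> D" by (simp add: colorings_def)
    moreover have "\<exists>k e'. e' \<in> edges D \<and> segment D' C {e1} e k e' \<and> segment D C {} e k e'"
      if "e \<in> edges D" for e
      using seg[OF that refl C1] by blast
    ultimately show "\<exists>C'\<in>colorings S \<beta> D. \<forall>e\<in>edges D. \<exists>k e'. e' \<in> edges D \<and>
        segment D' C {e1} e k e' \<and> segment D C' {} e k e'"
      by blast
  qed (use BD e1 in auto)
  ultimately show ?thesis by blast
qed

lemma first_return_map_vert: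
  "first_return D C' b n e k \<Longrightarrow> inj h \<Longrightarrow> C' = C \<circ> h \<Longrightarrow> first_return (map_vert h ` D) C (h b) n (h e) k"
proof (induction rule: first_return.induct)
  case (last v e)
  then show ?case
    using first_return.last[of "map_vert h v" "map_vert h ` D" "h e" "h b" C] passes_map_vert[OF last(2), of h] vert_weight_map_vert[of h H f g C v e]
    by (simp add: comp_def)
next
  case (step v e m n k)
  then show ?case
    using first_return.step[of "map_vert h v" "map_vert h ` D" "h e" "h m" "h b" C n k] passes_map_vert[OF step(2), of h] vert_weight_map_vert[of h H f g C v e]
    by (simp add: inj_eq comp_def)
qed

lemma Psi_classes_relabel:
  assumes wf: "wf_diagram D" "wf_diagram D'" and "relabel D D'"
  shows "Psi_classes D = Psi_classes D'"
proof -
  obtain h where h: "inj h" and D': "D' = map_vert h ` D"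
    using assms(3) unfolding relabel_def by blast
  have eq: "\<Psi> D' C (h e) = \<Psi> D (C \<circ> h) e" if "e \<in> edges D" for C e
    by (rule Psi_eqI[OF wf(2)])
      (use that first_return_map_vert[OF first_return_Psi[OF wf(1) that] h refl, folded D'] in \<open>auto simp: D' edges_map_vert\<close>)
  have col: "C \<in> colorings S \<beta> D' \<longleftrightarrow> C \<circ> h \<in> colorings S \<beta> D" for C
    by (auto simp: colorings_def D' vert_colored_map_vert)
  show ?thesis
  proof (intro equalityI subsetI)
    fix z assume "z \<in> Psi_classes D"
    then obtain C e where *: "z = conj_class H (\<Psi> D C e)" "e \<in> edges D" "C \<in> colorings S \<beta> D"
      unfolding Psi_classes_def by blast
    \<comment> \<open>A left inverse of the injection \<open>h\<close> transports colorings of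
      \<open>D\<close> to colorings of \<open>D'\<close>.\<close>
    have "C \<circ> inv_into UNIV h \<circ> h = C" using h by (simp add: comp_assoc)
    then have "z = conj_class H (\<Psi> D' (C \<circ> inv_into UNIV h) (h e))" "C \<circ> inv_into UNIV h \<in> colorings S \<beta> D'"
      "h e \<in> edges D'"
      using * eq[of e "C \<circ> inv_into UNIV h"] col by (simp_all add: D' edges_map_vert)
    then show "z \<in> Psi_classes D'" unfolding Psi_classes_def by blast
  next
    fix z assume "z \<in> Psi_classes D'"
    then obtain C e where "z = conj_class H (\<Psi> D' C (h e))" "e \<in> edges D" "C \<in> colorings S \<beta> D'"
      unfolding Psi_classes_def by (auto simp: D' edges_map_vert)
    then have "z = conj_class H (\<Psi> D (C \<circ> h) e)" "e \<in> edges D" "C \<circ> h \<in> colorings S \<beta> D"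
      using eq col by simp_all
    then show "z \<in> Psi_classes D" unfolding Psi_classes_def by blast
  qed
qed

lemma Psi_classes_vlink_equiv:
  assumes "vlink_equiv D D'" "wf_diagram D"
  shows "wf_diagram D' \<and> Psi_classes D' = Psi_classes D"
  using assms(1) unfolding vlink_equiv_def
proof (induction rule: equivclp_induct)
  case base
  then show ?case using assms(2) by simp
next
  case (step E E')
  have "wf_diagram E \<and> wf_diagram E' \<and> Psi_classes E = Psi_classes E'"
    using step(2) Psi_classes_local_move Psi_classes_subdivide Psi_classes_relabel
    unfolding diagram_move_def by metis
  then show ?case using step by simp
qed

end

theorem mainTheorem1:
  fixes S \<beta> :: "'a \<times> 'a \<Rightarrow> 'a \<times> 'a"
    and H :: "('h, 'm) monoid_scheme"
    and f g :: "'a \<times> 'a \<Rightarrow> 'h"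
    and D D' :: diagram
    and bp bp' :: "nat set \<Rightarrow> nat"
  assumes "virtual_pair S \<beta>"
    and "group H"
    and "nc_cocycle_pair H S \<beta> f g"
    and "wf_diagram D"
    and "vlink_equiv D D'"
    and "base_points D bp"
    and "base_points D' bp'"
  shows "Psi_inv H S \<beta> f g D bp = Psi_inv H S \<beta> f g D' bp'"
proof -
  interpret cocycle S \<beta> H f g
    using assms(1-3) by (intro cocycle.intro vpair.intro cocycle_axioms.intro)
  from Psi_classes_vlink_equiv[OF assms(5,4)] show ?thesis
    using assms(4,6,7) by (simp add: Psi_inv_eq_Psi_classes)
qed

end
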